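(* Suppose $\eta < 1$, where $\eta = \sum_{r \in \Sigma_R} p_r K_r^{-\alpha_{\min}}$. Then: (1) There exists a unique acs probability measure $\mu_{\mathbf p}$ for $F$. Moreover, $F$ is ergodic with respect to $\mathbb P \times \mu_{\mathbf p}$. (2) The density $\frac{d\mu_{\mathbf p}}{d\lambda}$ is bounded away from zero, and on each of the intervals $(0,\frac12]$ and $(\frac12,1]$ it is decreasing and locally Lipschitz. Furthermore, for each $\beta \in (\alpha_{\min},\gamma)\cap(0,1]$ there exist $a_1,a_2>0$ such that $$\frac{d\mu_{\mathbf p}}{d\lambda}(x) \le a_1\, x^{-\alpha_{\min}-1+\beta} \quad \text{for } x \in \left(0,\tfrac12\right],$$ $$\frac{d\mu_{\mathbf p}}{d\lambda}(x) \le a_2 \left(x-\tfrac12\right)^{-1+\beta} \quad \text{for } x\in\left(\tfrac12,1\right].$$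
   Context: For $\alpha \in (0,\infty)$ let $S_\alpha : [0,1]\to[0,1]$ be given by $S_\alpha(x) = x(1+2^\alpha x^\alpha)$ if $x \in [0,\frac12]$ and $S_\alpha(x) = 2x-1$ if $x \in (\frac12,1]$. For $\alpha \in (0,\infty)$ and $K \in (0,1)$ let $R_{\alpha,K}:[0,1]\to[0,1]$ be given by $R_{\alpha,K}(x) = x(1+2^\alpha x^\alpha)$ if $x \in [0,\frac12]$ and $R_{\alpha,K}(x) = \frac12 + K(x-\frac12) + 2(1-K)(x-\frac12)^2$ if $x\in(\frac12,1]$. Let $\mathfrak S = \{S_\alpha : \alpha \in (0,\infty)\}$ and $\mathfrak R = \{R_{\alpha,K} : \alpha\in(0,\infty), K\in(0,1)\}$. Let $T_1,\ldots,T_N \in \mathfrak S \cup \mathfrak R$ be a finite collection, $\Sigma = \{1,\ldots,N\}$, $\Sigma_S = \{j \in \Sigma : T_j \in \mathfrak S\}$, $\Sigma_R = \{j\in\Sigma : T_j \in \mathfrak R\}$, and assume $\Sigma_S, \Sigma_R \neq \emptyset$. For $j \in \Sigma$ let $\alpha_j\in(0,\infty)$ be the parameter with $T_j(x) = x(1+2^{\alpha_j}x^{\alpha_j})$ on $[0,\frac12]$; for $j \in \Sigma_R$ let $K_j \in (0,1)$ be the parameter with $T_j(x) = \frac12 + K_j(x-\frac12)+2(1-K_j)(x-\frac12)^2$ on $(\frac12,1]$. Let $\alpha_{\min} = \min\{\alpha_j : j \in \Sigma\}$; it is assumed throughout that $\alpha_{\min}<1$. Let $\mathbf p = (p_j)_{j\in\Sigma}$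 be a probability vector with strictly positive entries, and let $\mathbb P$ be the $\mathbf p$-Bernoulli (product) measure on $\Sigma^{\mathbb N}$. Set $\gamma = \sup\{\delta \ge 0 : \sum_{r\in\Sigma_R} p_r K_r^{-\delta} < 1\}$ (if $\eta<1$ then $\gamma>\alpha_{\min}$). The skew product is $F:\Sigma^{\mathbb N}\times[0,1]\to\Sigma^{\mathbb N}\times[0,1]$, $F(\omega,x) = (\sigma\omega, T_{\omega_1}(x))$, with $\sigma$ the left shift. An acs (absolutely continuous stationary) measure for $F$ is a Borel measure $\mu$ on $[0,1]$, absolutely continuous with respect to Lebesgue measure $\lambda$ on $[0,1]$, with $\sum_{j\in\Sigma} p_j\mu(T_j^{-1}A) = \mu(A)$ for all Borel $A\subseteq[0,1]$; then $\mathbb P\times\mu$ is $F$-invariant. Pointwise statements about the density $\frac{d\mu_{\mathbf p}}{d\lambda}$, which is only defined $\lambda$-a.e., refer to a suitable version of it. "Decreasing" is meant in the non-strict sense. *)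

theory Defs
  imports "HOL-Probability.Probability"
begin

text \<open>
  Self-maps of \<open>[0,1]\<close> are represented as functions on \<^typ>\<open>real\<close> that take the value
  \<^const>\<open>undefined\<close> outside \<open>[0,1]\<close>, so that equality of such functions is equality of maps.
\<close>

definition S_map :: "real \<Rightarrow> real \<Rightarrow> real" where
  "S_map \<alpha> = (\<lambda>x\<in>{0..1}.
     if x \<le> 1/2 then x * (1 + 2 powr \<alpha> * x powr \<alpha>) else 2 * x - 1)"

definition R_map :: "real \<Rightarrow> real \<Rightarrow> real \<Rightarrow> real" where
  "R_map \<alpha> K = (\<lambda>x\<in>{0..1}.
     if x \<le> 1/2 then x * (1 + 2 powr \<alpha> * x powr \<alpha>)
     else 1/2 + K * (x - 1/2) + 2 * (1 - K) * (x - 1/2)\<^sup>2)"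

definition S_family :: "(real \<Rightarrow> real) set" where
  "S_family = {S_map \<alpha> |\<alpha>. \<alpha> > 0}"

definition R_family :: "(real \<Rightarrow> real) set" where
  "R_family = {R_map \<alpha> K |\<alpha> K. \<alpha> > 0 \<and> 0 < K \<and> K < 1}"

definition lborel01 :: "real measure" where
  "lborel01 = restrict_space lborel {0..1}"

text \<open>
  Sequences in \<open>\<Sigma>\<^sup>\<nat>\<close> are indexed from \<open>0\<close>, so \<open>\<omega> 0\<close> is the first symbol.
\<close>

definition bernoulli_measure :: "'i set \<Rightarrow> ('i \<Rightarrow> real) \<Rightarrow> (nat \<Rightarrow> 'i) measure" where
  "bernoulli_measure \<Sigma> p = (\<Pi>\<^sub>M n\<in>UNIV. point_measure \<Sigma> (\<lambda>j. ennreal (p j)))"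

definition skew_product ::
    "('i \<Rightarrow> real \<Rightarrow> real) \<Rightarrow> (nat \<Rightarrow> 'i) \<times> real \<Rightarrow> (nat \<Rightarrow> 'i) \<times> real" where
  "skew_product T = (\<lambda>(\<omega>, x). (\<lambda>n. \<omega> (Suc n), T (\<omega> 0) x))"

definition acs_measure ::
    "'i set \<Rightarrow> ('i \<Rightarrow> real) \<Rightarrow> ('i \<Rightarrow> real \<Rightarrow> real) \<Rightarrow> real measure \<Rightarrow> bool" where
  "acs_measure \<Sigma> p T \<mu> \<longleftrightarrow>
     sets \<mu> = sets (restrict_space borel {0..1}) \<and>
     absolutely_continuous lborel01 \<mu> \<and>
     (\<forall>A\<in>sets (restrict_space borel {0..1}).
        (\<Sum>j\<in>\<Sigma>. ennreal (p j) * emeasure \<mu> (T j -` A \<inter> {0..1})) = emeasure \<mu> A)"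

definition acs_prob_measure ::
    "'i set \<Rightarrow> ('i \<Rightarrow> real) \<Rightarrow> ('i \<Rightarrow> real \<Rightarrow> real) \<Rightarrow> real measure \<Rightarrow> bool" where
  "acs_prob_measure \<Sigma> p T \<mu> \<longleftrightarrow> acs_measure \<Sigma> p T \<mu> \<and> prob_space \<mu>"

definition measure_preserving_map :: "'a measure \<Rightarrow> ('a \<Rightarrow> 'a) \<Rightarrow> bool" where
  "measure_preserving_map M f \<longleftrightarrow> f \<in> measurable M M \<and> distr M M f = M"

definition ergodic_map :: "'a measure \<Rightarrow> ('a \<Rightarrow> 'a) \<Rightarrow> bool" where
  "ergodic_map M f \<longleftrightarrow> measure_preserving_map M f \<and>
     (\<forall>A\<in>sets M. f -` A \<inter> space M = A \<longrightarrow>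
        emeasure M A = 0 \<or> emeasure M (space M - A) = 0)"

definition density_version :: "real measure \<Rightarrow> (real \<Rightarrow> real) \<Rightarrow> bool" where
  "density_version \<mu> h \<longleftrightarrow>
     h \<in> borel_measurable lborel01 \<and> (\<forall>x\<in>{0..1}. 0 \<le> h x) \<and>
     \<mu> = density lborel01 (\<lambda>x. ennreal (h x))"

definition locally_lipschitz_on :: "'a::metric_space set \<Rightarrow> ('a \<Rightarrow> 'b::metric_space) \<Rightarrow> bool" where
  "locally_lipschitz_on X f \<longleftrightarrow>
     (\<forall>x\<in>X. \<exists>e>0. \<exists>L. L-lipschitz_on (X \<inter> ball x e) f)"

end

theory Submission
  imports Defs
begin

text \<open>
  A branch \<open>T : (a,b] \<rightarrow> (c,d]\<close> of one of the maps is increasing and convex, hence its transfer operator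
  preserves the decreasing functions. A bound on the distortion of \<open>T\<close> in terms of the slopes
  \<open>(T x - T a) / (x - a)\<close> shows that it also maps the functions \<open>f\<close> with \<open>(x - a)\<^sup>n f(x)\<close> increasing to
  those with \<open>(x - c)\<^sup>n f(x)\<close> increasing, for a common large \<open>n\<close>; such functions are locally
  Lipschitz.

  Existence: the bounds of part (2) hold with suitable constants for all iterates of the averaged
  transfer operator on the constant density \<open>1\<close>. Near \<open>1/2\<close> this uses \<open>\<Sum> p\<^sub>r K\<^sub>r powr (-\<beta>) < 1\<close>, near
  \<open>0\<close> the strict gain of the map with the least exponent. As the mass cannot concentrate
  at the left end points, the iterates are uniformly bounded away from zero. By
  Tychonoff's theorem their averages have a pointwise cluster point; it is a fixed point because
  the operator is a finite sum of weighted point evaluations, and the lower bound makes it nonzero.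

  Ergodicity and uniqueness need only one map \<open>S\<^sub>\<alpha>\<close>. Pushing the constant density forward from a cylinder
  whose last branch is the right one gives a density comparable to \<open>1\<close>, so an invariant set of positive
  measure occupies a fixed proportion of each cylinder, hence of each Borel set. For the skew product, the
  measure \<open>\<phi>(x)\<close> of the section at \<open>x\<close> of an invariant set is harmonic, and a variance
  argument shows that \<open>\<phi>\<close> is invariant under each map, hence a constant \<open>c\<close>. The section is then
  independent of all cylinder sets and so of itself, whence \<open>c = c\<^sup>2\<close>.
\<close>

section \<open>Convex branches and cones of decreasing functions\<close>

definition decr_cone :: "nat \<Rightarrow> real \<Rightarrow> real \<Rightarrow> (real \<Rightarrow> real) \<Rightarrow> bool" where
  "decr_cone n a b f \<longleftrightarrow> (\<forall>x\<in>{a<..b}. 0 \<le> f x) \<and> antimono_on {a<..b} f \<and>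
     mono_on {a<..b} (\<lambda>x. (x - a) ^ n * f x)"

lemma decr_coneD:
  assumes "decr_cone n a b f"
  shows "a < x \<Longrightarrow> x \<le> b \<Longrightarrow> 0 \<le> f x"
    and "a < x \<Longrightarrow> x \<le> y \<Longrightarrow> y \<le> b \<Longrightarrow> f y \<le> f x"
    and "a < x \<Longrightarrow> x \<le> y \<Longrightarrow> y \<le> b \<Longrightarrow> (x - a) ^ n * f x \<le> (y - a) ^ n * f y"
  using assms by (auto simp: decr_cone_def monotone_on_def)

lemma decr_coneI:
  assumes "\<And>x. a < x \<Longrightarrow> x \<le> b \<Longrightarrow> 0 \<le> f x"
    and "\<And>x y. a < x \<Longrightarrow> x \<le> y \<Longrightarrow> y \<le> b \<Longrightarrow> f y \<le> f x"
    and "\<And>x y. a < x \<Longrightarrow> x \<le> y \<Longrightarrow> y \<le> b \<Longrightarrow> (x - a) ^ n * f x \<le> (y - a) ^ n * f y"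
  shows "decr_cone n a b f"
  using assms by (auto simp: decr_cone_def monotone_on_def)

lemma decr_cone_add:
  assumes "decr_cone n a b f" "decr_cone n a b g"
  shows "decr_cone n a b (\<lambda>x. f x + g x)"
  using decr_coneD[OF assms(1)] decr_coneD[OF assms(2)]
  by (intro decr_coneI) (simp_all add: distrib_left add_mono)

lemma decr_cone_scale:
  assumes "0 \<le> k" "decr_cone n a b f"
  shows "decr_cone n a b (\<lambda>x. k * f x)"
  using assms(1) decr_coneD[OF assms(2)]
  by (intro decr_coneI) (simp_all add: mult.left_commute[of _ k] mult_left_mono)

lemma decr_cone_sum:
  assumes "\<And>i. i \<in> I \<Longrightarrow> decr_cone n a b (f i)"
  shows "decr_cone n a b (\<lambda>x. \<Sum>i\<in>I. f i x)"
  using assms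
  using decr_coneD[OF assms]
  by (intro decr_coneI) (simp_all add: sum_distrib_left sum_nonneg sum_mono)

lemma decr_cone_const: "0 \<le> k \<Longrightarrow> decr_cone n a b (\<lambda>_. k)"
  by (intro decr_coneI) (auto intro!: mult_right_mono power_mono)

lemma decr_cone_cong:
  assumes "decr_cone n a b f" "\<And>x. a < x \<Longrightarrow> x \<le> b \<Longrightarrow> g x = f x"
  shows "decr_cone n a b g"
  using decr_coneD[OF assms(1)] by (intro decr_coneI) (simp_all add: assms(2))

lemma decr_cone_subinterval:
  assumes f: "decr_cone n a b f" and "a \<le> a'" "b' \<le> b"
  shows "decr_cone n a' b' f"
proof (rule decr_coneI)
  fix x y assume xy: "a' < x" "x \<le> y" "y \<le> b'"
  have "(x - a') * (y - a) \<le> (y - a') * (x - a)"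
  proof -
    have "0 \<le> (a' - a) * (y - x)" using assms xy by simp
    then show ?thesis by (simp add: algebra_simps)
  qed
  then have "(x - a') ^ n * (y - a) ^ n \<le> (y - a') ^ n * (x - a) ^ n"
    using assms xy by (auto simp flip: power_mult_distrib intro!: power_mono mult_nonneg_nonneg)
  then have "((x - a') ^ n * (y - a) ^ n) * f x \<le> ((y - a') ^ n * (x - a) ^ n) * f x"
    using decr_coneD(1)[OF f, of x] assms xy by (intro mult_right_mono) auto
  also have "\<dots> = (y - a') ^ n * ((x - a) ^ n * f x)" by simp
  also have "\<dots> \<le> (y - a') ^ n * ((y - a) ^ n * f y)"
    using decr_coneD(3)[OF f, of x y] assms xy by (intro mult_left_mono) auto
  finally have "(y - a) ^ n * ((x - a') ^ n * f x) \<le> (y - a) ^ n * ((y - a') ^ n * f y)"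
    by (simp add: mult_ac)
  moreover have "0 < (y - a) ^ n" using assms xy by simp
  ultimately show "(x - a') ^ n * f x \<le> (y - a') ^ n * f y" by simp
qed (use assms in \<open>auto intro: decr_coneD[OF f]\<close>)

definition push_fwd ::
    "real \<Rightarrow> real \<Rightarrow> (real \<Rightarrow> real) \<Rightarrow> (real \<Rightarrow> real) \<Rightarrow> (real \<Rightarrow> real) \<Rightarrow> real \<Rightarrow> real" where
  "push_fwd a b T T' f x =
     (if x \<in> {T a<..T b}
      then f (the_inv_into {a..b} T x) / T' (the_inv_into {a..b} T x) else 0)"

locale branch =
  fixes n :: nat and a b :: real and T T' :: "real \<Rightarrow> real"
  assumes less: "a < b"
    and deriv: "x \<in> {a..b} \<Longrightarrow> (T has_real_derivative T' x) (at x)"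
    and cont_deriv: "continuous_on {a..b} T'"
    and meas_deriv [measurable]: "T' \<in> borel_measurable borel"
    and deriv_pos: "x \<in> {a..b} \<Longrightarrow> 0 < T' x"
    and deriv_mono: "a \<le> x \<Longrightarrow> x \<le> y \<Longrightarrow> y \<le> b \<Longrightarrow> T' x \<le> T' y"
    and distortion: "a < x \<Longrightarrow> x \<le> y \<Longrightarrow> y \<le> b \<Longrightarrow>
      T' y * ((T x - T a) / (x - a)) ^ n \<le> T' x * ((T y - T a) / (y - a)) ^ n"
begin

abbreviation "inv_br \<equiv> the_inv_into {a..b} T"
abbreviation "push \<equiv> push_fwd a b T T'"

lemma strict: "a \<le> x \<Longrightarrow> x < y \<Longrightarrow> y \<le> b \<Longrightarrow> T x < T y"
  by (rule DERIV_pos_imp_increasing[of x y T])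
     (auto intro!: exI[of _ "T' z" for z] deriv deriv_pos)

lemma le: "a \<le> x \<Longrightarrow> x \<le> y \<Longrightarrow> y \<le> b \<Longrightarrow> T x \<le> T y"
  using strict[of x y] by (cases "x = y") auto

lemma inj: "inj_on T {a..b}"
  by (rule inj_onI) (metis atLeastAtMost_iff linorder_neqE_linordered_idom strict less_irrefl)

lemma cont: "continuous_on {a..b} T"
  using deriv by (meson DERIV_isCont continuous_at_imp_continuous_on)

lemma inv_mem:
  assumes "x \<in> {T a<..T b}"
  shows "inv_br x \<in> {a<..b}" "T (inv_br x) = x"
proof -
  obtain y where y: "a \<le> y" "y \<le> b" "T y = x"
    using IVT'[of T a x b] cont less assms by auto
  then have "y \<noteq> a" using assms by auto
  with y have "inv_br x = y" using inj by (auto intro: the_inv_into_f_eq)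
  with y \<open>y \<noteq> a\<close> show "inv_br x \<in> {a<..b}" "T (inv_br x) = x" by auto
qed

lemma inv_T [simp]: "y \<in> {a..b} \<Longrightarrow> inv_br (T y) = y"
  by (rule the_inv_into_f_f[OF inj])

lemma T_mem: "y \<in> {a<..b} \<Longrightarrow> T y \<in> {T a<..T b}"
  using strict[of a y] le[of y b] by auto

lemma inv_mono:
  assumes "T a < x" "x \<le> y" "y \<le> T b"
  shows "inv_br x \<le> inv_br y"
proof (rule ccontr)
  assume "\<not> ?thesis"
  then have "T (inv_br y) < T (inv_br x)"
    using inv_mem[of x] inv_mem[of y] assms by (intro strict) auto
  then show False using inv_mem[of x] inv_mem[of y] assms by auto
qed

lemma push_T: "y \<in> {a<..b} \<Longrightarrow> push f (T y) = f y / T' y"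
  using T_mem[of y] by (simp add: push_fwd_def)

lemma push_at:
  assumes "x \<in> {T a<..T b}"
  obtains y where "y \<in> {a<..b}" "T y = x" "push f x = f y / T' y"
  using inv_mem[OF assms] assms by (auto simp: push_fwd_def)

lemma push_nonneg: "(\<And>y. y \<in> {a<..b} \<Longrightarrow> 0 \<le> f y) \<Longrightarrow> 0 \<le> push f x"
  using inv_mem[of x] deriv_pos[of "inv_br x"] by (auto simp: push_fwd_def less_imp_le)

lemma push_decr_cone:
  assumes f: "decr_cone n a b f"
  shows "decr_cone n (T a) (T b) (push f)"
proof (rule decr_coneI)
  show "0 \<le> push f x" for x
    using decr_coneD(1)[OF f] by (intro push_nonneg) auto
next
  fix u v assume uv: "T a < u" "u \<le> v" "v \<le> T b"
  define x y where "x = inv_br u" and "y = inv_br v"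
  have xy: "a < x" "x \<le> y" "y \<le> b" and [simp]: "T x = u" "T y = v"
    using inv_mem[of u] inv_mem[of v] uv inv_mono[of u v] by (auto simp: x_def y_def)
  have pu: "push f u = f x / T' x" and pv: "push f v = f y / T' y"
    using uv by (auto simp: push_fwd_def x_def y_def)
  have pos: "0 < T' x" "0 < T' y" using xy deriv_pos by auto
  show "push f v \<le> push f u" unfolding pu pv
    using xy pos decr_coneD(1,2)[OF f] deriv_mono[of x y] by (intro frac_le) auto
  have fx: "0 \<le> f x" using decr_coneD(1)[OF f] xy by auto
  have 1: "T' y * ((u - T a) / (x - a)) ^ n \<le> T' x * ((v - T a) / (y - a)) ^ n"
    using distortion[of x y] xy by simp
  have "(u - T a) ^ n * f x / T' x
      = ((u - T a) / (x - a)) ^ n / T' x * ((x - a) ^ n * f x)"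
    using xy by (simp add: power_divide)
  also have "\<dots> \<le> ((v - T a) / (y - a)) ^ n / T' y * ((x - a) ^ n * f x)"
    using 1 pos fx xy by (intro mult_right_mono) (auto simp: field_simps)
  also have "\<dots> \<le> ((v - T a) / (y - a)) ^ n / T' y * ((y - a) ^ n * f y)"
    using decr_coneD(3)[OF f, of x y] xy pos uv by (intro mult_left_mono) auto
  also have "\<dots> = (v - T a) ^ n * f y / T' y"
    using xy by (simp add: power_divide)
  finally show "(u - T a) ^ n * push f u \<le> (v - T a) ^ n * push f v"
    by (simp add: pu pv)
qed

lemma push_measurable [measurable]:
  assumes [measurable]: "f \<in> borel_measurable borel"
  shows "push f \<in> borel_measurable borel"
proof -
  have "inv_br \<in> borel_measurable (restrict_space borel {T a<..T b})"
    by (rule borel_measurable_mono_on_fnc) (auto intro!: mono_onI inv_mono)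
  then have [measurable]: "(\<lambda>x. if x \<in> {T a<..T b} then inv_br x else 0) \<in> borel_measurable borel"
    by (subst (asm) measurable_restrict_space_iff[where c=0]) auto
  have "push f = (\<lambda>x. if x \<in> {T a<..T b}
      then f (if x \<in> {T a<..T b} then inv_br x else 0) / T' (if x \<in> {T a<..T b} then inv_br x else 0)
      else 0)"
    by (auto simp: push_fwd_def fun_eq_iff)
  also have "\<dots> \<in> borel_measurable borel" by measurable
  finally show ?thesis .
qed

lemma nn_integral_push:
  assumes [measurable]: "f \<in> borel_measurable borel" "g \<in> borel_measurable borel"
  shows "(\<integral>\<^sup>+x. g x * ennreal (push f x) \<partial>lborel) =
    (\<integral>\<^sup>+y. g (T y) * ennreal (f y) * indicator {a<..b} y \<partial>lborel)"
proof -
  let ?F = "\<lambda>x. g x * ennreal (push f x)"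
  have "(\<integral>\<^sup>+x. ?F x \<partial>lborel) = (\<integral>\<^sup>+x. ?F x * indicator {T a..T b} x \<partial>lborel)"
    by (intro nn_integral_cong) (auto simp: indicator_def push_fwd_def)
  also have "\<dots> = (\<integral>\<^sup>+x. ?F (T x) * ennreal (T' x) * indicator {a..b} x \<partial>lborel)"
    by (rule nn_integral_substitution_aux)
       (auto intro!: deriv cont_deriv less_imp_le[OF deriv_pos] simp: less)
  also have "\<dots> = (\<integral>\<^sup>+y. g (T y) * ennreal (f y) * indicator {a<..b} y \<partial>lborel)"
  proof (rule nn_integral_cong)
    fix y
    have "?F (T y) * ennreal (T' y) = g (T y) * ennreal (f y)" if "y \<in> {a<..b}"
    proof -
      have "ennreal (f y / T' y) * ennreal (T' y) = ennreal (f y)"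
        using deriv_pos[of y] that by (subst ennreal_mult''[symmetric]) auto
      with that show ?thesis by (simp add: push_T mult.assoc)
    qed
    moreover have "?F (T a) = 0" by (simp add: push_fwd_def)
    ultimately show "?F (T y) * ennreal (T' y) * indicator {a..b} y =
        g (T y) * ennreal (f y) * indicator {a<..b} y"
      using less by (cases "y = a") (auto simp: indicator_def)
  qed
  finally show ?thesis .
qed

end

lemma decr_cone_lipschitz:
  assumes f: "decr_cone n a b f"
  shows "locally_lipschitz_on {a<..b} f"
  unfolding locally_lipschitz_on_def
proof
  fix x assume x: "x \<in> {a<..b}"
  define m where "m = (a + x) / 2"
  have m: "a < m" "m \<le> b" using x by (auto simp: m_def)
  define C where "C = f m * real n / (m - a)"
  have C0: "0 \<le> C" using decr_coneD(1)[OF f] m by (auto simp: C_def)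
  have le: "\<bar>f u - f v\<bar> \<le> C * \<bar>u - v\<bar>" if uv: "m < u" "u \<le> v" "v \<le> b" for u v
  proof -
    have a: "a < u" "u \<le> b" "a < v" using uv m by auto
    define t where "t = (u - a) / (v - a)"
    have t: "0 < t" "1 - t = (v - u) / (v - a)" using a uv by (auto simp: t_def field_simps)
    have fu: "0 \<le> f u" "f u \<le> f m" and fv: "f v \<le> f u"
      using decr_coneD(1,2)[OF f] a uv m by auto
    have "(u - a) ^ n * f u \<le> (v - a) ^ n * f v"
      using decr_coneD(3)[OF f] a uv by auto
    then have "t ^ n * f u \<le> f v"
      using a by (auto simp: t_def power_divide field_simps)
    moreover have "1 - real n * (1 - t) \<le> t ^ n"
      using Bernoulli_inequality[of "t - 1" n] t by (simp add: algebra_simps)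
    then have "(1 - real n * (1 - t)) * f u \<le> t ^ n * f u"
      using fu(1) by (rule mult_right_mono)
    ultimately have "f u - f v \<le> f u * (real n * (1 - t))" by (simp add: algebra_simps)
    also have "\<dots> \<le> f m * (real n * ((v - u) / (m - a)))"
      unfolding t using fu a uv m by (intro mult_mono mult_nonneg_nonneg divide_left_mono) auto
    finally show ?thesis using fv uv by (simp add: C_def)
  qed
  have "C-lipschitz_on ({a<..b} \<inter> ball x (x - m)) f"
  proof (rule lipschitz_onI)
    fix u v assume "u \<in> {a<..b} \<inter> ball x (x - m)" "v \<in> {a<..b} \<inter> ball x (x - m)"
    then have "m < u" "m < v" "u \<le> b" "v \<le> b" by (auto simp: dist_real_def)
    then show "dist (f u) (f v) \<le> C * dist u v"
      using le[of u v] le[of v u] by (cases "u \<le> v") (auto simp: dist_real_def abs_minus_commute)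
  qed (rule C0)
  then show "\<exists>e>0. \<exists>L. L-lipschitz_on ({a<..b} \<inter> ball x e) f"
    using x by (intro exI[of _ "x - m"]) (auto simp: m_def)
qed

lemma borel_measurable_piecewise_antimono:
  fixes f :: "real \<Rightarrow> real"
  assumes "antimono_on {a<..b} f" "antimono_on {b<..c} f" "\<And>x. x \<notin> {a<..c} \<Longrightarrow> f x = 0"
    and "a \<le> b" "b \<le> c"
  shows "f \<in> borel_measurable borel"
proof -
  have "(\<lambda>x. - f x) \<in> borel_measurable borel"
    by (rule borel_measurable_piecewise_mono[of "{{..a}, {a<..b}, {b<..c}, {c<..}}"])
       (use assms in \<open>auto simp: monotone_on_def\<close>)
  then show ?thesis by simp
qed

definition left_br :: "real \<Rightarrow> real \<Rightarrow> real" where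
  "left_br \<alpha> x = x * (1 + 2 powr \<alpha> * x powr \<alpha>)"

definition left_br_deriv :: "real \<Rightarrow> real \<Rightarrow> real" where
  "left_br_deriv \<alpha> x = 1 + (1 + \<alpha>) * (2 powr \<alpha> * x powr \<alpha>)"

definition dbl_br :: "real \<Rightarrow> real" where
  "dbl_br x = 2 * x - 1"

definition slow_br :: "real \<Rightarrow> real \<Rightarrow> real" where
  "slow_br K x = 1 / 2 + K * (x - 1 / 2) + 2 * (1 - K) * (x - 1 / 2)\<^sup>2"

definition slow_br_deriv :: "real \<Rightarrow> real \<Rightarrow> real" where
  "slow_br_deriv K x = K + 4 * (1 - K) * (x - 1 / 2)"

lemma left_br_0 [simp]: "left_br \<alpha> 0 = 0" by (simp add: left_br_def)

lemma left_br_half [simp]: "left_br \<alpha> (1/2) = 1"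
proof -
  have "2 powr \<alpha> * (1/2) powr \<alpha> = (1::real)"
    by (subst powr_mult[symmetric]) auto
  then show ?thesis by (simp add: left_br_def)
qed

lemma dbl_br_half [simp]: "dbl_br (1/2) = 0" and dbl_br_1 [simp]: "dbl_br 1 = 1"
  by (simp_all add: dbl_br_def)

lemma slow_br_half [simp]: "slow_br K (1/2) = 1/2" and slow_br_1 [simp]: "slow_br K 1 = 1"
  by (simp_all add: slow_br_def power2_eq_square field_simps)

lemma left_br_has_derivative:
  assumes "0 < \<alpha>"
  shows "(left_br \<alpha> has_real_derivative left_br_deriv \<alpha> x) (at x)"
proof (cases "x = 0")
  case True
  have "((\<lambda>h. 1 + 2 powr \<alpha> * \<bar>h\<bar> powr \<alpha>) \<longlongrightarrow> 1 + 2 powr \<alpha> * \<bar>0\<bar> powr \<alpha>) (at 0)"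
    using assms by (intro tendsto_intros) auto
  moreover have "\<forall>\<^sub>F h in at 0. 1 + 2 powr \<alpha> * \<bar>h\<bar> powr \<alpha> = (left_br \<alpha> (0 + h) - left_br \<alpha> 0) / h"
    by (auto simp: eventually_at_filter left_br_def powr_def abs_if ln_minus)
  ultimately have "((\<lambda>h. (left_br \<alpha> (0 + h) - left_br \<alpha> 0) / h) \<longlongrightarrow> 1 + 2 powr \<alpha> * \<bar>0\<bar> powr \<alpha>) (at 0)"
    by (rule Lim_transform_eventually)
  with True assms show ?thesis by (simp add: DERIV_def left_br_deriv_def)
next
  case False
  have *: "((\<lambda>x. \<bar>x\<bar> powr \<alpha>) has_real_derivative \<alpha> * \<bar>x\<bar> powr \<alpha> / x) (at x)"
  proof (cases "0 < x")
    case True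
    have "((\<lambda>x. x powr \<alpha>) has_real_derivative \<alpha> * x powr \<alpha> / x) (at x)"
      using True by (auto intro!: derivative_eq_intros simp: powr_diff)
    moreover have "\<forall>\<^sub>F y in nhds x. \<bar>y\<bar> powr \<alpha> = y powr \<alpha>"
      using True eventually_nhds_in_open[of "{0<..}" x] by (auto elim!: eventually_mono)
    ultimately show ?thesis using True by (subst DERIV_cong_ev[OF refl _ refl]) auto
  next
    case neg: False
    then have x: "x < 0" using False by auto
    have "((\<lambda>x. (- x) powr \<alpha>) has_real_derivative \<alpha> * (- x) powr \<alpha> / x) (at x)"
      using x by (auto intro!: derivative_eq_intros simp: powr_diff)
    moreover have "\<forall>\<^sub>F y in nhds x. \<bar>y\<bar> powr \<alpha> = (- y) powr \<alpha>"
      using x eventually_nhds_in_open[of "{..<0}" x] by (auto elim!: eventually_mono)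
    ultimately show ?thesis using x by (subst DERIV_cong_ev[OF refl _ refl]) auto
  qed
  have "left_br \<alpha> = (\<lambda>x. x * (1 + 2 powr \<alpha> * \<bar>x\<bar> powr \<alpha>))"
    by (auto simp: left_br_def powr_def abs_if ln_minus)
  moreover have "left_br_deriv \<alpha> x = 1 + (1 + \<alpha>) * (2 powr \<alpha> * \<bar>x\<bar> powr \<alpha>)"
    by (auto simp: left_br_deriv_def powr_def abs_if ln_minus)
  moreover have "((\<lambda>x. x * (1 + 2 powr \<alpha> * \<bar>x\<bar> powr \<alpha>)) has_real_derivative
      x * (2 powr \<alpha> * (\<alpha> * \<bar>x\<bar> powr \<alpha> / x)) + 1 * (1 + 2 powr \<alpha> * \<bar>x\<bar> powr \<alpha>)) (at x)"
    using DERIV_mult'[OF DERIV_ident DERIV_add[OF DERIV_const DERIV_cmult[OF *]], of 1 "2 powr \<alpha>"]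
    by simp
  ultimately show ?thesis using False by (simp add: algebra_simps)
qed

lemma distortion_from_linear:
  fixes q r :: real
  assumes "0 < q" "q \<le> r" "0 \<le> s" "t * q \<le> s * (q + real n * (r - q))"
  shows "t * q ^ n \<le> s * r ^ n"
proof -
  have "t \<le> s * (1 + real n * (r / q - 1))"
    using assms by (simp add: field_simps)
  also have "\<dots> \<le> s * (r / q) ^ n"
    using Bernoulli_inequality[of "r / q - 1" n] assms by (intro mult_left_mono) auto
  finally show ?thesis using assms(1) by (simp add: power_divide field_simps)
qed

lemma branch_left_br:
  assumes \<alpha>: "0 < \<alpha>" "1 + \<alpha> \<le> real n"
  shows "branch n 0 (1/2) (left_br \<alpha>) (left_br_deriv \<alpha>)"
proof
  show "continuous_on {0..1/2} (left_br_deriv \<alpha>)"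
    unfolding left_br_deriv_def[abs_def] using \<alpha> by (intro continuous_intros continuous_on_powr') auto
  show "left_br_deriv \<alpha> \<in> borel_measurable borel"
    unfolding left_br_deriv_def[abs_def] by measurable
  fix x y :: real
  show "x \<in> {0..1/2} \<Longrightarrow> 0 < left_br_deriv \<alpha> x"
    using \<alpha> by (auto simp: left_br_deriv_def intro!: add_pos_nonneg)
  show "left_br_deriv \<alpha> x \<le> left_br_deriv \<alpha> y" if "0 \<le> x" "x \<le> y"
    using \<alpha> that by (auto simp: left_br_deriv_def intro!: mult_left_mono powr_mono2)
  assume xy: "0 < x" "x \<le> y"
  define s t where "s = 2 powr \<alpha> * x powr \<alpha>" and "t = 2 powr \<alpha> * y powr \<alpha>"
  have st: "0 \<le> s" "s \<le> t" using \<alpha> xy by (auto simp: s_def t_def intro!: mult_left_mono powr_mono2)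
  have "0 \<le> (t - s) * (real n * (1 + (1 + \<alpha>) * s) - (1 + \<alpha>) * (1 + s))"
  proof (rule mult_nonneg_nonneg)
    have "(1 + \<alpha>) * (1 + s) \<le> (1 + \<alpha>) * (1 + (1 + \<alpha>) * s)"
      using \<alpha> st by (intro mult_left_mono) (auto simp: distrib_right)
    also have "\<dots> \<le> real n * (1 + (1 + \<alpha>) * s)"
      using \<alpha> st by (intro mult_right_mono) auto
    finally show "0 \<le> real n * (1 + (1 + \<alpha>) * s) - (1 + \<alpha>) * (1 + s)" by simp
  qed (use st in auto)
  then have "(1 + (1 + \<alpha>) * t) * (1 + s) ^ n \<le> (1 + (1 + \<alpha>) * s) * (1 + t) ^ n"
    using st \<alpha> by (intro distortion_from_linear) (auto simp: algebra_simps)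
  then show "left_br_deriv \<alpha> y * ((left_br \<alpha> x - left_br \<alpha> 0) / (x - 0)) ^ n
      \<le> left_br_deriv \<alpha> x * ((left_br \<alpha> y - left_br \<alpha> 0) / (y - 0)) ^ n"
    using xy by (simp add: left_br_deriv_def left_br_def s_def t_def)
qed (use left_br_has_derivative[OF \<alpha>(1)] in auto)

lemma branch_dbl_br: "branch n (1/2) 1 dbl_br (\<lambda>_. 2)"
proof
  fix x y :: real
  have slope: "(dbl_br z - dbl_br (1/2)) / (z - 1/2) = 2" if "1/2 < z" for z
  proof -
    have "dbl_br z - dbl_br (1/2) = 2 * (z - 1/2)" by (simp add: dbl_br_def)
    with that show ?thesis by (simp only: nonzero_mult_div_cancel_right)
  qed
  show "(dbl_br has_real_derivative 2) (at x)"
    unfolding dbl_br_def[abs_def] by (auto intro!: derivative_eq_intros)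
  assume "1/2 < x" "x \<le> y"
  then show "2 * ((dbl_br x - dbl_br (1/2)) / (x - 1/2)) ^ n \<le> 2 * ((dbl_br y - dbl_br (1/2)) / (y - 1/2)) ^ n"
    by (simp only: slope)
qed auto

lemma branch_slow_br:
  assumes K: "0 < K" "K < 1" and n: "2 \<le> n"
  shows "branch n (1/2) 1 (slow_br K) (slow_br_deriv K)"
proof
  fix x y :: real
  show "(slow_br K has_real_derivative slow_br_deriv K x) (at x)"
    unfolding slow_br_def[abs_def] slow_br_deriv_def by (auto intro!: derivative_eq_intros) (simp add: algebra_simps)
  show "x \<in> {1/2..1} \<Longrightarrow> 0 < slow_br_deriv K x"
    using K by (auto simp: slow_br_deriv_def intro!: add_pos_nonneg)
  show "x \<le> y \<Longrightarrow> slow_br_deriv K x \<le> slow_br_deriv K y"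
    using K by (auto simp: slow_br_deriv_def intro!: mult_left_mono)
  assume xy: "1/2 < x" "x \<le> y"
  define u v c where "u = x - 1/2" and "v = y - 1/2" and "c = 2 * (1 - K)"
  have uv: "0 < u" "u \<le> v" "0 < c" using xy K by (auto simp: u_def v_def c_def)
  have q: "(slow_br K x - slow_br K (1/2)) / (x - 1/2) = K + c * u"
    "(slow_br K y - slow_br K (1/2)) / (y - 1/2) = K + c * v"
    using xy by (auto simp: slow_br_def u_def v_def c_def field_simps power2_eq_square)
  have d: "slow_br_deriv K x = K + 2 * c * u" "slow_br_deriv K y = K + 2 * c * v"
    by (auto simp: slow_br_deriv_def u_def v_def c_def)
  have "0 \<le> (v - u) * c * (real n * (K + 2 * c * u) - 2 * (K + c * u))"
  proof (rule mult_nonneg_nonneg)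
    have "2 * (K + c * u) \<le> 2 * (K + 2 * c * u)" using uv by auto
    also have "\<dots> \<le> real n * (K + 2 * c * u)"
      using n K uv by (intro mult_right_mono) auto
    finally show "0 \<le> real n * (K + 2 * c * u) - 2 * (K + c * u)" by simp
  qed (use uv in auto)
  then show "slow_br_deriv K y * ((slow_br K x - slow_br K (1/2)) / (x - 1/2)) ^ n
      \<le> slow_br_deriv K x * ((slow_br K y - slow_br K (1/2)) / (y - 1/2)) ^ n"
    unfolding q d using uv K
    by (intro distortion_from_linear) (auto simp: algebra_simps add_pos_nonneg intro!: mult_left_mono)
qed (auto simp: slow_br_deriv_def[abs_def] intro!: continuous_intros)

section \<open>Ergodicity of the maps with two expanding branches\<close>

lemma branch_dbl_br_push:
  assumes "0 < x" "x \<le> 1"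
  shows "push_fwd (1/2) 1 dbl_br (\<lambda>_. 2) f x = f ((x + 1) / 2) / 2"
proof -
  interpret S: branch 0 "1/2" 1 dbl_br "\<lambda>_. 2" by (rule branch_dbl_br)
  have "push_fwd (1/2) 1 dbl_br (\<lambda>_. 2) f (dbl_br ((x + 1) / 2)) = f ((x + 1) / 2) / 2"
    using assms by (intro S.push_T) auto
  then show ?thesis by (simp add: dbl_br_def field_simps)
qed

lemma left_br_expand:
  assumes "0 < \<alpha>" "x \<in> {0<..1/2}" "y \<in> {0<..1/2}"
  shows "\<bar>x - y\<bar> \<le> \<bar>left_br \<alpha> x - left_br \<alpha> y\<bar>"
proof -
  have "v - u \<le> left_br \<alpha> v - left_br \<alpha> u" if "0 < u" "u \<le> v" for u v
  proof -
    have "u * (2 powr \<alpha> * u powr \<alpha>) \<le> v * (2 powr \<alpha> * v powr \<alpha>)"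
      using that assms(1) by (intro mult_mono powr_mono2) auto
    then show ?thesis by (simp add: left_br_def algebra_simps)
  qed
  from this[of x y] this[of y x] assms show ?thesis by (cases "x \<le> y") auto
qed

lemma left_br_iterate_escape:
  assumes "0 < \<alpha>" "x \<in> {0<..1}"
  shows "\<exists>k. (left_br \<alpha> ^^ k) x \<in> {1/2<..1} \<and> (\<forall>i<k. (left_br \<alpha> ^^ i) x \<in> {0<..1/2})"
proof -
  define r where "r = 1 + 2 powr \<alpha> * x powr \<alpha>"
  have r: "1 < r" using assms by (auto simp: r_def)
  have step: "left_br \<alpha> y \<in> {r * y..}" if "x \<le> y" for y
  proof -
    have "x powr \<alpha> \<le> y powr \<alpha>" using that assms by (intro powr_mono2) auto
    then have "y * r \<le> y * (1 + 2 powr \<alpha> * y powr \<alpha>)"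
      unfolding r_def using that assms by (intro mult_left_mono) auto
    then show ?thesis by (simp add: left_br_def mult.commute)
  qed
  have grow: "x * r ^ k \<le> (left_br \<alpha> ^^ k) x" for k
  proof (induction k)
    case (Suc k)
    have "x * 1 \<le> x * r ^ k" using assms r by (intro mult_left_mono) auto
    with Suc have "r * (left_br \<alpha> ^^ k) x \<le> left_br \<alpha> ((left_br \<alpha> ^^ k) x)" using step by auto
    moreover have "r * (x * r ^ k) \<le> r * (left_br \<alpha> ^^ k) x" using Suc r by (intro mult_left_mono) auto
    ultimately show ?case by (simp add: mult_ac)
  qed simp
  obtain k0 where "1 / x < r ^ k0" using real_arch_pow[OF r] by blast
  then have "1 < x * r ^ k0" using assms by (simp add: field_simps)
  with grow[of k0] have ex: "1/2 < (left_br \<alpha> ^^ k0) x" by linarith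
  define k where "k = (LEAST k. 1/2 < (left_br \<alpha> ^^ k) x)"
  have k: "1/2 < (left_br \<alpha> ^^ k) x" and below: "\<And>i. i < k \<Longrightarrow> (left_br \<alpha> ^^ i) x \<le> 1/2"
    unfolding k_def using ex by (auto intro: LeastI dest: not_less_Least)
  have pos: "0 < (left_br \<alpha> ^^ i) x" for i
    using grow[of i] assms r by (smt (verit) greaterThanAtMost_iff mult_pos_pos zero_less_power)
  have "(left_br \<alpha> ^^ k) x \<le> 1"
  proof (cases k)
    case 0 then show ?thesis using assms by simp
  next
    case (Suc i)
    interpret L: branch "nat \<lceil>1 + \<alpha>\<rceil>" 0 "1/2" "left_br \<alpha>" "left_br_deriv \<alpha>"
      using assms by (intro branch_left_br) (auto simp: real_nat_ceiling_ge)
    show ?thesis using Suc L.le[of "(left_br \<alpha> ^^ i) x" "1/2"] below[of i] pos[of i] by simp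
  qed
  with k below pos show ?thesis by auto
qed

text \<open>
  The letter \<^const>\<open>True\<close> stands for the right branch, whose inverse contracts by \<open>1/2\<close>; the cylinders
  of the words in \<open>words m\<close> thus have length at most \<open>2\<^sup>-\<^sup>m\<close>.
\<close>

fun cyl :: "real \<Rightarrow> bool list \<Rightarrow> real set" where
  "cyl \<alpha> [] = {0<..1}"
| "cyl \<alpha> (False # w) = {x \<in> {0<..1/2}. left_br \<alpha> x \<in> cyl \<alpha> w}"
| "cyl \<alpha> (True # w) = {x \<in> {1/2<..1}. dbl_br x \<in> cyl \<alpha> w}"

definition words :: "nat \<Rightarrow> bool list set" where
  "words m = {w. count_list w True = m \<and> (w = [] \<or> last w)}"

lemma left_br_measurable [measurable]: "left_br \<alpha> \<in> borel_measurable borel"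
  and dbl_br_measurable [measurable]: "dbl_br \<in> borel_measurable borel"
  and slow_br_measurable [measurable]: "slow_br K \<in> borel_measurable borel"
  by (simp_all add: left_br_def[abs_def] dbl_br_def[abs_def] slow_br_def[abs_def])

lemma cyl_measurable [measurable]: "cyl \<alpha> w \<in> sets borel"
proof (induction w)
  case (Cons b w)
  note [measurable] = Cons
  show ?case by (cases b) (simp_all, measurable)
qed simp

lemma cyl_diameter:
  assumes "0 < \<alpha>"
  shows "x \<in> cyl \<alpha> w \<Longrightarrow> y \<in> cyl \<alpha> w \<Longrightarrow> \<bar>x - y\<bar> \<le> (1/2) ^ count_list w True"
proof (induction w arbitrary: x y)
  case (Cons b w)
  show ?case
  proof (cases b)
    case True
    with Cons have "\<bar>dbl_br x - dbl_br y\<bar> \<le> (1/2) ^ count_list w True" by auto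
    moreover have "\<bar>dbl_br x - dbl_br y\<bar> = 2 * \<bar>x - y\<bar>" by (simp add: dbl_br_def abs_if)
    ultimately show ?thesis using True by simp
  next
    case False
    with Cons left_br_expand[of \<alpha> x y] assms show ?thesis by fastforce
  qed
qed auto

lemma words_0: "words 0 = {[]}"
proof -
  have "w = []" if "w \<in> words 0" for w
    using that last_in_set[of w] by (cases "w = []") (auto simp: words_def count_list_0_iff)
  then show ?thesis by (auto simp: words_def)
qed

lemma words_ConsD: "b # w \<in> words m \<Longrightarrow> w \<in> words (if b then m - 1 else m)"
  by (cases "w = []"; cases b) (auto simp: words_def)

lemma cyl_disjoint:
  "w \<in> words m \<Longrightarrow> v \<in> words m \<Longrightarrow> x \<in> cyl \<alpha> w \<Longrightarrow> x \<in> cyl \<alpha> v \<Longrightarrow> w = v"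
proof (induction w arbitrary: v m x)
  case Nil
  then have "m = 0" by (simp add: words_def)
  with Nil show ?case by (simp add: words_0)
next
  case (Cons b w)
  have "m \<noteq> 0" using Cons.prems(1) words_0 by (metis list.distinct(1) singletonD)
  with Cons.prems(2) obtain c u where v: "v = c # u" by (cases v) (auto simp: words_def)
  have bc: "b = c" using Cons.prems(3,4) v by (cases b; cases c) auto
  have "(if b then dbl_br x else left_br \<alpha> x) \<in> cyl \<alpha> w"
    "(if b then dbl_br x else left_br \<alpha> x) \<in> cyl \<alpha> u"
    using Cons.prems(3,4) v bc by (cases b; simp)+
  then have "w = u"
    using Cons.IH[OF words_ConsD[OF Cons.prems(1)] words_ConsD[of b u m]] Cons.prems(2) v bc by simp
  with v bc show ?case by simp
qed

lemma cyl_cover: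
  assumes "0 < \<alpha>"
  shows "x \<in> {0<..1} \<Longrightarrow> \<exists>w\<in>words m. x \<in> cyl \<alpha> w"
proof (induction m arbitrary: x)
  case 0
  then show ?case by (auto simp: words_def intro!: exI[of _ "[]"])
next
  case (Suc m)
  obtain k where k: "(left_br \<alpha> ^^ k) x \<in> {1/2<..1}" "\<And>i. i < k \<Longrightarrow> (left_br \<alpha> ^^ i) x \<in> {0<..1/2}"
    using left_br_iterate_escape[OF assms Suc.prems] by blast
  have "dbl_br ((left_br \<alpha> ^^ k) x) \<in> {0<..1}" using k(1) by (auto simp: dbl_br_def)
  then obtain w where w: "w \<in> words m" "dbl_br ((left_br \<alpha> ^^ k) x) \<in> cyl \<alpha> w" using Suc.IH by blast
  have "j \<le> k \<Longrightarrow> \<exists>v\<in>words (Suc m). (left_br \<alpha> ^^ (k - j)) x \<in> cyl \<alpha> v" for j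
  proof (induction j)
    case 0
    then show ?case using w k(1) by (intro bexI[of _ "True # w"]) (auto simp: words_def)
  next
    case (Suc j)
    then obtain v where v: "v \<in> words (Suc m)" "(left_br \<alpha> ^^ (k - j)) x \<in> cyl \<alpha> v" by auto
    have "k - j = Suc (k - Suc j)" using Suc.prems by simp
    with v(2) have "left_br \<alpha> ((left_br \<alpha> ^^ (k - Suc j)) x) \<in> cyl \<alpha> v" by simp
    with v(1) k(2)[of "k - Suc j"] Suc.prems show ?case
      by (intro bexI[of _ "False # v"]) (auto simp: words_def)
  qed
  from this[of k] show ?case by simp
qed

lemma cyl_lower_bound:
  assumes \<alpha>: "0 < \<alpha>" "1 + \<alpha> \<le> real n"
    and B [measurable]: "B \<in> sets borel" "B \<subseteq> {0<..1}"
    and L: "AE x in lborel. x \<in> {0<..1/2} \<longrightarrow> (left_br \<alpha> x \<in> B \<longleftrightarrow> x \<in> B)"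
    and S: "AE x in lborel. x \<in> {1/2<..1} \<longrightarrow> (dbl_br x \<in> B \<longleftrightarrow> x \<in> B)"
    and k: "0 \<le> k" "ennreal (2 ^ n * k) \<le> emeasure lborel B"
    and f: "decr_cone n 0 1 f" "f \<in> borel_measurable borel"
    and w: "w = [] \<and> (\<forall>x\<in>{0<..1}. f x \<le> 2 ^ n * f 1) \<or> w \<noteq> [] \<and> last w"
  shows "ennreal k * (\<integral>\<^sup>+x. indicator (cyl \<alpha> w) x * ennreal (f x) \<partial>lborel)
    \<le> (\<integral>\<^sup>+x. indicator (cyl \<alpha> w \<inter> B) x * ennreal (f x) \<partial>lborel)"
  using f w
proof (induction w arbitrary: f)
  case Nil
  then have f1: "0 \<le> f 1" and le: "\<And>x. x \<in> {0<..1} \<Longrightarrow> f x \<le> 2 ^ n * f 1"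
    and ge: "\<And>x. x \<in> {0<..1} \<Longrightarrow> f 1 \<le> f x"
    using decr_coneD(1,2)[OF Nil(1)] by auto
  have "(\<integral>\<^sup>+x. indicator {0<..1} x * ennreal (f x) \<partial>lborel)
      \<le> (\<integral>\<^sup>+x. indicator {0<..1::real} x * ennreal (2 ^ n * f 1) \<partial>lborel)"
    using le by (intro nn_integral_mono) (auto simp: indicator_def intro!: ennreal_leI)
  also have "\<dots> = ennreal (2 ^ n * f 1)" by (simp add: nn_integral_multc)
  finally have "ennreal k * (\<integral>\<^sup>+x. indicator {0<..1} x * ennreal (f x) \<partial>lborel)
      \<le> ennreal k * ennreal (2 ^ n * f 1)"
    by (rule mult_left_mono) simp
  also have "\<dots> = ennreal (2 ^ n * k) * ennreal (f 1)"
    using k f1 by (simp add: ennreal_mult[symmetric] mult_ac)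
  also have "\<dots> \<le> emeasure lborel B * ennreal (f 1)"
    using k(2) by (rule mult_right_mono) simp
  also have "\<dots> = (\<integral>\<^sup>+x. indicator B x * ennreal (f 1) \<partial>lborel)"
    by (simp add: nn_integral_multc)
  also have "\<dots> \<le> (\<integral>\<^sup>+x. indicator ({0<..1} \<inter> B) x * ennreal (f x) \<partial>lborel)"
    using B ge by (intro nn_integral_mono) (auto simp: indicator_def intro!: ennreal_leI)
  finally show ?case by simp
next
  case (Cons b w)
  note [measurable] = Cons.prems(2)
  define a c T T' where "a = (if b then 1/2 else 0::real)" and "c = (if b then 1 else 1/2::real)"
    and "T = (if b then dbl_br else left_br \<alpha>)" and "T' = (if b then \<lambda>_. 2 else left_br_deriv \<alpha>)"
  have [measurable]: "T \<in> borel_measurable borel" by (simp add: T_def)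
  interpret branch n a c T T'
    using branch_dbl_br branch_left_br[OF \<alpha>] by (auto simp: a_def c_def T_def T'_def)
  have Tac: "T a = 0" "T c = 1" by (auto simp: T_def a_def c_def)
  have inv: "AE x in lborel. x \<in> {a<..c} \<longrightarrow> (T x \<in> B \<longleftrightarrow> x \<in> B)"
    using L S by (auto simp: T_def a_def c_def)
  have cyl_eq: "cyl \<alpha> (b # w) = {x \<in> {a<..c}. T x \<in> cyl \<alpha> w}"
    by (cases b) (auto simp: T_def a_def c_def)
  have f: "decr_cone n a c f"
    by (rule decr_cone_subinterval[OF Cons.prems(1)]) (auto simp: a_def c_def)
  have E: "(\<integral>\<^sup>+x. indicator (cyl \<alpha> (b # w)) x * ennreal (f x) \<partial>lborel)
      = (\<integral>\<^sup>+x. indicator (cyl \<alpha> w) x * ennreal (push f x) \<partial>lborel)"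
    unfolding cyl_eq by (subst nn_integral_push) (auto intro!: nn_integral_cong simp: indicator_def)
  have EB: "(\<integral>\<^sup>+x. indicator (cyl \<alpha> (b # w) \<inter> B) x * ennreal (f x) \<partial>lborel)
      = (\<integral>\<^sup>+x. indicator (cyl \<alpha> w \<inter> B) x * ennreal (push f x) \<partial>lborel)"
  proof -
    have "AE x in lborel. indicator (cyl \<alpha> (b # w) \<inter> B) x * ennreal (f x)
        = indicator (cyl \<alpha> w \<inter> B) (T x) * ennreal (f x) * indicator {a<..c} x"
      using inv by eventually_elim (auto simp: indicator_def cyl_eq)
    then show ?thesis by (subst nn_integral_push) (auto intro: nn_integral_cong_AE)
  qed
  have "w = [] \<and> (\<forall>x\<in>{0<..1}. push f x \<le> 2 ^ n * push f 1) \<or> w \<noteq> [] \<and> last w"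
  proof (cases "w = []")
    case True
    with Cons.prems(3) have b by simp
    then have push: "push f x = f ((x + 1) / 2) / 2" if "x \<in> {0<..1}" for x
      using that branch_dbl_br_push[of x f] by (simp add: a_def c_def T_def T'_def)
    have "push f x \<le> 2 ^ n * push f 1" if x: "x \<in> {0<..1}" for x
    proof -
      define y where "y = (x + 1) / 2"
      have y: "1/2 \<le> y" "y \<le> 1" using x by (auto simp: y_def)
      have "(1/2) ^ n * f y \<le> y ^ n * f y"
        using y decr_coneD(1)[OF Cons.prems(1), of y] by (intro mult_right_mono power_mono) auto
      also have "\<dots> \<le> f 1"
        using y decr_coneD(3)[OF Cons.prems(1), of y 1] by auto
      finally have "f y \<le> 2 ^ n * f 1" by (simp add: power_divide field_simps)
      then show ?thesis using x by (simp add: push y_def)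
    qed
    with True show ?thesis by simp
  next
    case False
    with Cons.prems(3) show ?thesis by simp
  qed
  then show ?case unfolding E EB
    using push_decr_cone[OF f] by (intro Cons.IH) (auto simp: Tac)
qed

theorem S_map_ergodic:
  assumes \<alpha>: "0 < \<alpha>"
    and A [measurable]: "A \<in> sets borel"
    and L: "AE x in lborel. x \<in> {0<..1/2} \<longrightarrow> (left_br \<alpha> x \<in> A \<longleftrightarrow> x \<in> A)"
    and S: "AE x in lborel. x \<in> {1/2<..1} \<longrightarrow> (dbl_br x \<in> A \<longleftrightarrow> x \<in> A)"
  shows "emeasure lborel (A \<inter> {0<..1}) = 0 \<or> emeasure lborel ({0<..1} - A) = 0"
proof -
  define n where "n = nat \<lceil>1 + \<alpha>\<rceil>"
  have n: "1 + \<alpha> \<le> real n" by (simp add: n_def real_nat_ceiling_ge)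
  define B where "B = {0<..1} - A"
  have B [measurable]: "B \<in> sets borel" and B01: "B \<subseteq> {0<..1}" by (auto simp: B_def)
  interpret Lb: branch n 0 "1/2" "left_br \<alpha>" "left_br_deriv \<alpha>" using \<alpha> n by (rule branch_left_br)
  have LB: "AE x in lborel. x \<in> {0<..1/2} \<longrightarrow> (left_br \<alpha> x \<in> B \<longleftrightarrow> x \<in> B)"
    using L Lb.T_mem by (auto elim!: eventually_mono simp: B_def)
  have SB: "AE x in lborel. x \<in> {1/2<..1} \<longrightarrow> (dbl_br x \<in> B \<longleftrightarrow> x \<in> B)"
    using S by (auto elim!: eventually_mono simp: B_def dbl_br_def)
  have fin: "emeasure lborel X \<noteq> \<infinity>" if "X \<subseteq> {0<..1}" for X :: "real set"
    using emeasure_mono[OF that, of lborel] by (auto simp: top_unique)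
  define k where "k = measure lborel B / 2 ^ n"
  have k: "0 \<le> k" "ennreal (2 ^ n * k) = emeasure lborel B"
    using fin[OF B01] by (auto simp: k_def emeasure_eq_ennreal_measure top_unique)
  have word: "ennreal k * emeasure lborel (cyl \<alpha> w) \<le> emeasure lborel (cyl \<alpha> w \<inter> B)"
    if "w \<noteq> []" "last w" for w
    using cyl_lower_bound[OF \<alpha> n B B01 LB SB k(1) eq_refl[OF k(2)], of "\<lambda>_. 1" w] that
      decr_cone_const[of 1] by simp
  have "ennreal k * emeasure lborel (U \<inter> {0<..1}) \<le> emeasure lborel (U \<inter> B)" if "open U" for U
  proof -
    have [measurable]: "U \<in> sets borel" using that by simp
    define W where "W m = {w \<in> words (Suc m). cyl \<alpha> w \<subseteq> U}" for m
    define V where "V m = (\<Union>w\<in>W m. cyl \<alpha> w)" for m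
    have cW: "countable (W m)" for m by simp
    have [measurable]: "V m \<in> sets borel" for m
      unfolding V_def by (intro sets.countable_UN' cW) auto
    have disj: "disjoint_family_on (cyl \<alpha>) (W m)" for m
      by (auto simp: disjoint_family_on_def W_def dest: cyl_disjoint)
    have V: "ennreal k * emeasure lborel (V m) \<le> emeasure lborel (U \<inter> B)" for m
    proof -
      have "ennreal k * emeasure lborel (V m)
          = ennreal k * (\<integral>\<^sup>+w. emeasure lborel (cyl \<alpha> w) \<partial>count_space (W m))"
        unfolding V_def by (subst emeasure_UN_countable[OF _ cW disj]) auto
      also have "\<dots> = (\<integral>\<^sup>+w. ennreal k * emeasure lborel (cyl \<alpha> w) \<partial>count_space (W m))"
        by (simp add: nn_integral_cmult)
      also have "\<dots> \<le> (\<integral>\<^sup>+w. emeasure lborel (cyl \<alpha> w \<inter> B) \<partial>count_space (W m))"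
        by (intro nn_integral_mono word) (auto simp: W_def words_def)
      also have "\<dots> = emeasure lborel (\<Union>w\<in>W m. cyl \<alpha> w \<inter> B)"
        using disj[of m] by (subst emeasure_UN_countable[OF _ cW]) (auto simp: disjoint_family_on_def)
      also have "\<dots> \<le> emeasure lborel (U \<inter> B)"
        by (intro emeasure_mono) (auto simp: W_def)
      finally show ?thesis .
    qed
    define V' where "V' m = (\<Inter>i\<in>{m..}. V i)" for m
    have [measurable]: "V' m \<in> sets borel" for m
      unfolding V'_def by (intro sets.countable_INT') auto
    have "\<exists>m. x \<in> V' m" if x: "x \<in> U" "x \<in> {0<..1}" for x
    proof -
      obtain e where e: "0 < e" "ball x e \<subseteq> U" using \<open>open U\<close> x openE by blast
      obtain m where m: "(1/2::real) ^ m < e" using real_arch_pow_inv[OF e(1), of "1/2"] by auto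
      have "x \<in> V i" if "m \<le> i" for i
      proof -
        obtain w where w: "w \<in> words (Suc i)" "x \<in> cyl \<alpha> w" using cyl_cover[OF \<alpha>] x by blast
        have "cyl \<alpha> w \<subseteq> ball x e"
        proof
          fix y assume "y \<in> cyl \<alpha> w"
          with w have "\<bar>x - y\<bar> \<le> (1/2) ^ Suc i"
            using cyl_diameter[OF \<alpha>, of x w y] by (auto simp: words_def)
          also have "\<dots> \<le> (1/2) ^ m" using that by (intro power_decreasing) auto
          finally show "y \<in> ball x e" using m by (simp add: dist_real_def)
        qed
        with w e(2) show ?thesis by (auto simp: V_def W_def)
      qed
      then show ?thesis by (auto simp: V'_def)
    qed
    then have sub: "U \<inter> {0<..1} \<subseteq> (\<Union>m. V' m)" by auto
    have "ennreal k * emeasure lborel (U \<inter> {0<..1}) \<le> ennreal k * emeasure lborel (\<Union>m. V' m)"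
      using sub by (intro mult_left_mono emeasure_mono) auto
    also have "emeasure lborel (\<Union>m. V' m) = (SUP m. emeasure lborel (V' m))"
      by (rule SUP_emeasure_incseq[symmetric]) (auto simp: V'_def incseq_def)
    also have "ennreal k * \<dots> = (SUP m. ennreal k * emeasure lborel (V' m))"
      by (rule SUP_mult_left_ennreal)
    also have "\<dots> \<le> emeasure lborel (U \<inter> B)"
    proof (rule SUP_least)
      fix m
      have "ennreal k * emeasure lborel (V' m) \<le> ennreal k * emeasure lborel (V m)"
        by (intro mult_left_mono emeasure_mono) (auto simp: V'_def)
      also note V
      finally show "ennreal k * emeasure lborel (V' m) \<le> emeasure lborel (U \<inter> B)" .
    qed
    finally show ?thesis .
  qed
  note opens = this
  have "ennreal k * emeasure lborel (A \<inter> {0<..1}) \<le> 0"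
  proof (rule ennreal_le_epsilon)
    fix e :: real assume "0 < e"
    obtain U where U: "open U" "A \<inter> {0<..1} \<subseteq> U" "emeasure lborel (U - A \<inter> {0<..1}) < ennreal e"
      using outer_regular_lborel[of "A \<inter> {0<..1}" e] \<open>0 < e\<close> by auto
    have [measurable]: "U \<in> sets borel" using U by simp
    have "ennreal k * emeasure lborel (A \<inter> {0<..1}) \<le> ennreal k * emeasure lborel (U \<inter> {0<..1})"
      using U by (intro mult_left_mono emeasure_mono) auto
    also have "\<dots> \<le> emeasure lborel (U \<inter> B)" by (rule opens[OF U(1)])
    also have "\<dots> \<le> emeasure lborel (U - A \<inter> {0<..1})"
      by (intro emeasure_mono) (auto simp: B_def)
    finally show "ennreal k * emeasure lborel (A \<inter> {0<..1}) \<le> 0 + ennreal e" using U(3) by simp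
  qed
  then have "k = 0 \<or> emeasure lborel (A \<inter> {0<..1}) = 0"
    using k(1) by auto
  then show ?thesis
    using k(2) by (auto simp: B_def)
qed

section \<open>The averaged transfer operator\<close>

locale random_maps =
  fixes I RR :: "nat set" and p \<alpha> K :: "nat \<Rightarrow> real" and n j\<^sub>0 :: nat
  assumes fin [simp]: "finite I" and RR: "RR \<subseteq> I" "I - RR \<noteq> {}"
    and p_pos: "j \<in> I \<Longrightarrow> 0 < p j" and p_sum: "(\<Sum>j\<in>I. p j) = 1"
    and \<alpha>_pos: "j \<in> I \<Longrightarrow> 0 < \<alpha> j" and K: "j \<in> RR \<Longrightarrow> 0 < K j" "j \<in> RR \<Longrightarrow> K j < 1"
    and n: "2 \<le> n" "j \<in> I \<Longrightarrow> 1 + \<alpha> j \<le> real n"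
    and j\<^sub>0: "j\<^sub>0 \<in> I"
begin

definition right_br :: "nat \<Rightarrow> real \<Rightarrow> real" where
  "right_br j = (if j \<in> RR then slow_br (K j) else dbl_br)"

definition right_br_deriv :: "nat \<Rightarrow> real \<Rightarrow> real" where
  "right_br_deriv j = (if j \<in> RR then slow_br_deriv (K j) else (\<lambda>_. 2))"

definition rmap :: "nat \<Rightarrow> real \<Rightarrow> real" where
  "rmap j x = (if x \<le> 1/2 then left_br (\<alpha> j) x else right_br j x)"

abbreviation "PL j \<equiv> push_fwd 0 (1/2) (left_br (\<alpha> j)) (left_br_deriv (\<alpha> j))"
abbreviation "PR j \<equiv> push_fwd (1/2) 1 (right_br j) (right_br_deriv j)"

definition transfer_op :: "(real \<Rightarrow> real) \<Rightarrow> real \<Rightarrow> real" where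
  "transfer_op f x = (\<Sum>j\<in>I. p j * (PL j f x + PR j f x))"

definition cone_density :: "(real \<Rightarrow> real) \<Rightarrow> bool" where
  "cone_density f \<longleftrightarrow> decr_cone n 0 (1/2) f \<and> decr_cone n (1/2) 1 f \<and> (\<forall>x. x \<notin> {0<..1} \<longrightarrow> f x = 0)"

lemma branch_L: "j \<in> I \<Longrightarrow> branch n 0 (1/2) (left_br (\<alpha> j)) (left_br_deriv (\<alpha> j))"
  by (intro branch_left_br \<alpha>_pos n)

lemma branch_R: "j \<in> I \<Longrightarrow> branch n (1/2) 1 (right_br j) (right_br_deriv j)"
  using branch_dbl_br branch_slow_br[OF K n(1)] by (auto simp: right_br_def right_br_deriv_def)

lemma right_br_measurable [measurable]: "right_br j \<in> borel_measurable borel"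
  by (simp add: right_br_def)

lemma rmap_measurable [measurable]: "rmap j \<in> borel_measurable borel"
  unfolding rmap_def[abs_def] by measurable

lemma right_br_1: "right_br j 1 = 1"
  and right_br_half: "right_br j (1/2) = (if j \<in> RR then 1/2 else 0)"
  by (simp_all add: right_br_def)

lemma rmap_mem: "j \<in> I \<Longrightarrow> x \<in> {0<..1} \<Longrightarrow> rmap j x \<in> {0<..1}"
  using branch.T_mem[OF branch_L, of j x] branch.T_mem[OF branch_R, of j x]
  by (auto simp: rmap_def right_br_1 right_br_half split: if_splits)

lemma PL_at:
  assumes "j \<in> I" "x \<in> {0<..1}"
  obtains y where "y \<in> {0<..1/2}" "left_br (\<alpha> j) y = x" "PL j f x = f y / left_br_deriv (\<alpha> j) y"
  using branch.push_at[OF branch_L[OF assms(1)], of x f] assms(2) by auto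

lemma PR_S: "j \<in> I - RR \<Longrightarrow> x \<in> {0<..1} \<Longrightarrow> PR j f x = f ((x + 1) / 2) / 2"
  using branch_dbl_br_push[of x f] by (simp add: right_br_def right_br_deriv_def)

lemma PR_R_zero: "j \<in> RR \<Longrightarrow> x \<le> 1/2 \<Longrightarrow> PR j f x = 0"
  by (simp add: push_fwd_def right_br_half)

lemma densD:
  assumes "cone_density f"
  shows "decr_cone n 0 (1/2) f" "decr_cone n (1/2) 1 f" "x \<notin> {0<..1} \<Longrightarrow> f x = 0" "0 \<le> f x"
  using assms decr_coneD(1)[of n 0 "1/2" f x] decr_coneD(1)[of n "1/2" 1 f x]
  by (auto simp: cone_density_def) (metis greaterThanAtMost_iff linorder_not_less order_refl)

lemma dens_measurable: "cone_density f \<Longrightarrow> f \<in> borel_measurable borel"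
  by (rule borel_measurable_piecewise_antimono[of 0 "1/2" _ 1]) (auto simp: cone_density_def decr_cone_def)

lemma PL_cone: "cone_density f \<Longrightarrow> j \<in> I \<Longrightarrow> decr_cone n 0 1 (PL j f)"
  using branch.push_decr_cone[OF branch_L densD(1)] by simp

lemma PR_cone:
  assumes "cone_density f" "j \<in> I"
  shows "decr_cone n 0 (1/2) (PR j f)" "decr_cone n (1/2) 1 (PR j f)"
proof -
  have *: "decr_cone n (right_br j (1/2)) 1 (PR j f)"
    using branch.push_decr_cone[OF branch_R densD(2)] assms by (simp add: right_br_1)
  show "decr_cone n (1/2) 1 (PR j f)"
    by (rule decr_cone_subinterval[OF *]) (simp_all add: right_br_half)
  show "decr_cone n 0 (1/2) (PR j f)"
  proof (cases "j \<in> RR")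
    case True
    show ?thesis by (rule decr_cone_cong[OF decr_cone_const[of 0]]) (simp_all add: PR_R_zero True)
  next
    case False
    show ?thesis by (rule decr_cone_subinterval[OF *]) (simp_all add: right_br_half False)
  qed
qed

lemma tr_dens:
  assumes "cone_density f"
  shows "cone_density (transfer_op f)"
  unfolding cone_density_def
proof (intro conjI allI impI)
  show "decr_cone n 0 (1/2) (transfer_op f)" "decr_cone n (1/2) 1 (transfer_op f)"
    unfolding transfer_op_def[abs_def]
    using decr_cone_subinterval[OF PL_cone[OF assms]] PR_cone[OF assms] p_pos
    by (intro decr_cone_sum decr_cone_scale decr_cone_add; force intro: less_imp_le)+
  show "transfer_op f x = 0" if "x \<notin> {0<..1}" for x
    using that by (auto simp: transfer_op_def push_fwd_def right_br_1 right_br_half intro!: sum.neutral)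
qed

lemma tr_integral:
  assumes f: "cone_density f" and g [measurable]: "g \<in> borel_measurable borel"
  shows "(\<integral>\<^sup>+x. g x * ennreal (transfer_op f x) \<partial>lborel) =
    (\<Sum>j\<in>I. ennreal (p j) * (\<integral>\<^sup>+y. g (rmap j y) * ennreal (f y) \<partial>lborel))"
proof -
  note [measurable] = dens_measurable[OF f]
  have [measurable]: "PL j f \<in> borel_measurable borel" "PR j f \<in> borel_measurable borel" if "j \<in> I" for j
    using branch.push_measurable[OF branch_L[OF that]] branch.push_measurable[OF branch_R[OF that]] by auto
  have nonneg: "0 \<le> PL j f x" "0 \<le> PR j f x" if "j \<in> I" for j x
    using branch.push_nonneg[OF branch_L[OF that]] branch.push_nonneg[OF branch_R[OF that]] densD(4)[OF f]
    by auto
  have "(\<integral>\<^sup>+x. g x * ennreal (transfer_op f x) \<partial>lborel)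
      = (\<integral>\<^sup>+x. (\<Sum>j\<in>I. ennreal (p j) * (g x * ennreal (PL j f x) + g x * ennreal (PR j f x))) \<partial>lborel)"
  proof (rule nn_integral_cong)
    fix x
    have "ennreal (transfer_op f x) = (\<Sum>j\<in>I. ennreal (p j) * (ennreal (PL j f x) + ennreal (PR j f x)))"
    proof -
      have "ennreal (transfer_op f x) = (\<Sum>j\<in>I. ennreal (p j * (PL j f x + PR j f x)))"
        unfolding transfer_op_def
        by (intro sum_ennreal[symmetric] mult_nonneg_nonneg add_nonneg_nonneg nonneg less_imp_le[OF p_pos])
      also have "\<dots> = (\<Sum>j\<in>I. ennreal (p j) * (ennreal (PL j f x) + ennreal (PR j f x)))"
      proof (rule sum.cong[OF refl])
        fix j assume j: "j \<in> I"
        show "ennreal (p j * (PL j f x + PR j f x)) = ennreal (p j) * (ennreal (PL j f x) + ennreal (PR j f x))"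
          using nonneg[OF j] p_pos[OF j] by (simp only: ennreal_mult' ennreal_plus less_imp_le)
      qed
      finally show ?thesis .
    qed
    then show "g x * ennreal (transfer_op f x)
      = (\<Sum>j\<in>I. ennreal (p j) * (g x * ennreal (PL j f x) + g x * ennreal (PR j f x)))"
      by (simp add: sum_distrib_left distrib_left mult_ac)
  qed
  also have "\<dots> = (\<Sum>j\<in>I. ennreal (p j) *
      ((\<integral>\<^sup>+x. g x * ennreal (PL j f x) \<partial>lborel) + (\<integral>\<^sup>+x. g x * ennreal (PR j f x) \<partial>lborel)))"
    by (subst nn_integral_sum) (auto intro!: sum.cong simp: nn_integral_cmult nn_integral_add)
  also have "\<dots> = (\<Sum>j\<in>I. ennreal (p j) * (\<integral>\<^sup>+y. g (rmap j y) * ennreal (f y) \<partial>lborel))"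
  proof (intro sum.cong refl arg_cong2[where f="(*)"])
    fix j assume j: "j \<in> I"
    interpret L: branch n 0 "1/2" "left_br (\<alpha> j)" "left_br_deriv (\<alpha> j)" by (rule branch_L[OF j])
    interpret R: branch n "1/2" 1 "right_br j" "right_br_deriv j" by (rule branch_R[OF j])
    have "(\<integral>\<^sup>+x. g x * ennreal (PL j f x) \<partial>lborel) + (\<integral>\<^sup>+x. g x * ennreal (PR j f x) \<partial>lborel)
      = (\<integral>\<^sup>+y. g (left_br (\<alpha> j) y) * ennreal (f y) * indicator {0<..1/2} y
          + g (right_br j y) * ennreal (f y) * indicator {1/2<..1} y \<partial>lborel)"
      by (simp add: L.nn_integral_push R.nn_integral_push nn_integral_add)
    also have "\<dots> = (\<integral>\<^sup>+y. g (rmap j y) * ennreal (f y) \<partial>lborel)"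
      using densD(3)[OF f] by (intro nn_integral_cong) (auto simp: rmap_def indicator_def)
    finally show "(\<integral>\<^sup>+x. g x * ennreal (PL j f x) \<partial>lborel) + (\<integral>\<^sup>+x. g x * ennreal (PR j f x) \<partial>lborel)
      = (\<integral>\<^sup>+y. g (rmap j y) * ennreal (f y) \<partial>lborel)" .
  qed
  finally show ?thesis .
qed

lemma sum_p_ennreal: "(\<Sum>j\<in>I. ennreal (p j)) = 1"
  using sum_ennreal[of I p] p_pos p_sum by (simp add: less_imp_le)

lemma tr_mass:
  assumes "cone_density f"
  shows "(\<integral>\<^sup>+x. ennreal (transfer_op f x) \<partial>lborel) = (\<integral>\<^sup>+x. ennreal (f x) \<partial>lborel)"
proof -
  have "(\<integral>\<^sup>+x. ennreal (transfer_op f x) \<partial>lborel) = (\<Sum>j\<in>I. ennreal (p j) * (\<integral>\<^sup>+x. ennreal (f x) \<partial>lborel))"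
    using tr_integral[OF assms, of "\<lambda>_. 1"] by simp
  also have "\<dots> = (\<Sum>j\<in>I. ennreal (p j)) * (\<integral>\<^sup>+x. ennreal (f x) \<partial>lborel)"
    by (rule sum_distrib_right[symmetric])
  finally show ?thesis by (simp only: sum_p_ennreal mult_1)
qed

lemma dens_mass_bound:
  assumes f: "cone_density f" "(\<integral>\<^sup>+x. ennreal (f x) \<partial>lborel) \<le> 1"
  shows "x \<in> {1/4..1/2} \<Longrightarrow> f x \<le> 4" and "x \<in> {3/4..1} \<Longrightarrow> f x \<le> 4"
proof -
  have *: "f (a + 1/4) \<le> 4" if a: "decr_cone n a b f" "a + 1/4 \<le> b" for a b
  proof -
    have "ennreal (f (a + 1/4)) * ennreal (1/4)
        = (\<integral>\<^sup>+x. ennreal (f (a + 1/4)) * indicator {a<..a + 1/4} x \<partial>lborel)"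
      by (subst nn_integral_cmult_indicator) auto
    also have "\<dots> \<le> (\<integral>\<^sup>+x. ennreal (f x) \<partial>lborel)"
      using decr_coneD(2)[OF a(1)] a(2) by (intro nn_integral_mono) (auto simp: indicator_def intro!: ennreal_leI)
    finally have "ennreal (f (a + 1/4) * (1/4)) \<le> ennreal 1"
      using f densD(4)[OF f(1)] by (subst ennreal_mult) auto
    then show ?thesis by (subst (asm) ennreal_le_iff) auto
  qed
  show "f x \<le> 4" if "x \<in> {1/4..1/2}"
    using that *[OF densD(1)[OF f(1)]] decr_coneD(2)[OF densD(1)[OF f(1)], of "1/4" x] by auto
  show "f x \<le> 4" if "x \<in> {3/4..1}"
    using that *[OF densD(2)[OF f(1)]] decr_coneD(2)[OF densD(2)[OF f(1)], of "3/4" x] by auto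
qed


definition power_bound :: "real \<Rightarrow> real \<Rightarrow> real \<Rightarrow> (real \<Rightarrow> real) \<Rightarrow> bool" where
  "power_bound \<beta> A\<^sub>1 A\<^sub>2 f \<longleftrightarrow> (\<forall>x\<in>{0<..1/2}. f x \<le> A\<^sub>1 * x powr (\<beta> - \<alpha> j\<^sub>0 - 1)) \<and>
     (\<forall>x\<in>{1/2<..1}. f x \<le> A\<^sub>2 * (x - 1/2) powr (\<beta> - 1))"

lemma PL_at_deriv:
  assumes "j \<in> I" "x \<in> {0<..1}"
  obtains y t where "y \<in> {0<..1/2}" "0 < t" "t \<le> 1" "t = (2 * y) powr \<alpha> j" "x = y * (1 + t)"
    "PL j f x = f y / (1 + (1 + \<alpha> j) * t)" "x \<le> 2 * y"
proof -
  obtain y where y: "y \<in> {0<..1/2}" "left_br (\<alpha> j) y = x" "PL j f x = f y / left_br_deriv (\<alpha> j) y"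
    using PL_at[OF assms] by metis
  define t where "t = (2 * y) powr \<alpha> j"
  have t: "t = 2 powr \<alpha> j * y powr \<alpha> j" using y(1) by (simp add: t_def powr_mult)
  have "0 < t" "t \<le> 1"
    using y(1) \<alpha>_pos[OF assms(1)] powr_mono2[of "\<alpha> j" "2 * y" 1] by (auto simp: t_def)
  moreover have "x = y * (1 + t)" using y(2) by (simp add: left_br_def t)
  moreover have "y * (1 + t) \<le> y * 2" using \<open>t \<le> 1\<close> y(1) by (intro mult_left_mono) auto
  ultimately show ?thesis using y(1,3) that[of y t] by (simp add: t_def[symmetric] left_br_deriv_def t)
qed

lemma PR_R_bound:
  assumes r: "j \<in> RR" and \<beta>: "0 < \<beta>" "\<beta> \<le> 1" and A: "0 \<le> A"
    and f: "\<And>x. x \<in> {1/2<..1} \<Longrightarrow> f x \<le> A * (x - 1/2) powr (\<beta> - 1)"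
    and x: "x \<in> {1/2<..1}"
  shows "PR j f x \<le> A * K j powr (- \<beta>) * (x - 1/2) powr (\<beta> - 1)"
proof -
  have j: "j \<in> I" using r RR by auto
  obtain y where y: "y \<in> {1/2<..1}" "right_br j y = x" "PR j f x = f y / right_br_deriv j y"
    using branch.push_at[OF branch_R[OF j], of x f] x r by (auto simp: right_br_1 right_br_half)
  define v c q where "v = y - 1/2" and "c = 2 * (1 - K j)" and "q = K j + c * v"
  have v: "0 < v" using y by (simp add: v_def)
  have c: "0 < c" using K[OF r] by (simp add: c_def)
  have q: "K j \<le> q" "0 < q" using v c K[OF r] by (auto simp: q_def add_pos_pos)
  have u: "x - 1/2 = v * q"
    using y(2) r by (simp add: right_br_def slow_br_def v_def c_def q_def power2_eq_square algebra_simps)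
  have d: "right_br_deriv j y = q + c * v"
    using r by (simp add: right_br_deriv_def slow_br_deriv_def v_def c_def q_def)
  have "1 / (q + c * v) \<le> 1 / q"
    using q v c by (simp add: frac_le)
  also have "1 / q = q powr (-\<beta> + (\<beta> - 1))" using q by (simp add: powr_minus_divide)
  also have "\<dots> = q powr (-\<beta>) * q powr (\<beta> - 1)" by (rule powr_add)
  also have "\<dots> \<le> K j powr (-\<beta>) * q powr (\<beta> - 1)"
    using q K[OF r] \<beta> by (intro mult_right_mono powr_mono2') auto
  finally have *: "1 / (q + c * v) \<le> K j powr (-\<beta>) * q powr (\<beta> - 1)" .
  have "PR j f x \<le> A * v powr (\<beta> - 1) * (1 / (q + c * v))"
    using f[OF y(1)] q v c unfolding y(3) d by (simp add: v_def[symmetric] divide_right_mono)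
  also have "\<dots> \<le> A * v powr (\<beta> - 1) * (K j powr (-\<beta>) * q powr (\<beta> - 1))"
    using * A by (intro mult_left_mono) auto
  also have "\<dots> = A * K j powr (-\<beta>) * (x - 1/2) powr (\<beta> - 1)"
    using v q by (simp add: u powr_mult)
  finally show ?thesis .
qed

lemma PL_bound_right:
  assumes f: "cone_density f" "(\<integral>\<^sup>+x. ennreal (f x) \<partial>lborel) \<le> 1" and j: "j \<in> I" and x: "x \<in> {1/2<..1}"
  shows "PL j f x \<le> 4"
proof -
  obtain y t where y: "y \<in> {0<..1/2}" "0 < t" "PL j f x = f y / (1 + (1 + \<alpha> j) * t)" "x \<le> 2 * y"
    using PL_at_deriv[OF j, of x f] x by (metis greaterThanAtMost_iff less_trans zero_less_divide_1_iff zero_less_numeral)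
  have "0 \<le> (1 + \<alpha> j) * t" using y(2) \<alpha>_pos[OF j] by auto
  then have "PL j f x \<le> f y / 1"
    unfolding y(3) using densD(4)[OF f(1), of y] by (intro divide_left_mono) auto
  also have "\<dots> \<le> 4" using dens_mass_bound(1)[OF f, of y] y(1,4) x by auto
  finally show ?thesis .
qed

lemma bnd_tr_right:
  assumes \<beta>: "0 < \<beta>" "\<beta> \<le> 1" and \<theta>: "\<theta> = (\<Sum>r\<in>RR. p r * K r powr (- \<beta>))" "\<theta> < 1"
    and A: "6 / (1 - \<theta>) \<le> A"
    and f: "cone_density f" "(\<integral>\<^sup>+x. ennreal (f x) \<partial>lborel) \<le> 1"
    and le: "\<And>x. x \<in> {1/2<..1} \<Longrightarrow> f x \<le> A * (x - 1/2) powr (\<beta> - 1)"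
    and x: "x \<in> {1/2<..1}"
  shows "transfer_op f x \<le> A * (x - 1/2) powr (\<beta> - 1)"
proof -
  have A0: "0 \<le> A" using A \<theta>(2) by (meson diff_gt_0_iff_gt divide_nonneg_pos order_trans zero_le_numeral)
  define u where "u = (x - 1/2) powr (\<beta> - 1)"
  have "(1/2) powr (\<beta> - 1) \<le> u"
    unfolding u_def using x \<beta> by (intro powr_mono2') auto
  moreover have "1 \<le> (1/2::real) powr (\<beta> - 1)"
    using \<beta> powr_mono2'[of "\<beta> - 1" "1/2" 1] by auto
  ultimately have u1: "1 \<le> u" by simp
  define w where "w j = (if j \<in> RR then A * K j powr (- \<beta>) * u else 0)" for j
  have PR: "PR j f x \<le> 2 + w j" if j: "j \<in> I" for j
  proof (cases "j \<in> RR")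
    case True
    then show ?thesis using PR_R_bound[OF True \<beta> A0 le x] by (simp add: u_def w_def)
  next
    case False
    then show ?thesis
      using PR_S[of j x f] dens_mass_bound(2)[OF f, of "(x + 1) / 2"] j x by (auto simp: w_def)
  qed
  have "transfer_op f x \<le> (\<Sum>j\<in>I. p j * (6 + w j))"
    unfolding transfer_op_def
    using PR PL_bound_right[OF f _ x] p_pos
    by (intro sum_mono mult_left_mono) (force intro: less_imp_le)+
  also have "\<dots> = 6 + (\<Sum>j\<in>I. p j * w j)"
    by (simp add: distrib_left sum.distrib p_sum flip: sum_distrib_right)
  also have "(\<Sum>j\<in>I. p j * w j) = (\<Sum>j\<in>RR. p j * w j)"
    using RR by (intro sum.mono_neutral_right) (auto simp: w_def)
  also have "\<dots> = A * u * \<theta>"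
    by (auto simp: \<theta> w_def sum_distrib_left mult_ac intro!: sum.cong)
  finally have "transfer_op f x \<le> 6 + A * u * \<theta>" .
  also have "6 \<le> A * (1 - \<theta>) * u"
  proof -
    have "6 * 1 \<le> (A * (1 - \<theta>)) * u"
      using A \<theta>(2) u1 A0 by (intro mult_mono) (auto simp: field_simps)
    then show ?thesis by simp
  qed
  then have "6 + A * u * \<theta> \<le> A * u" by (simp add: algebra_simps)
  finally show ?thesis by (simp add: u_def)
qed

lemma bnd_tr_left:
  assumes \<beta>: "\<alpha> j\<^sub>0 < \<beta>" "\<beta> \<le> 1"
    and A: "0 \<le> A\<^sub>2" "A\<^sub>2 * (2 + \<alpha> j\<^sub>0) / (p j\<^sub>0 * \<alpha> j\<^sub>0) \<le> A\<^sub>1"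
    and f: "cone_density f" "power_bound \<beta> A\<^sub>1 A\<^sub>2 f"
    and x: "x \<in> {0<..1/2}"
  shows "transfer_op f x \<le> A\<^sub>1 * x powr (\<beta> - \<alpha> j\<^sub>0 - 1)"
proof -
  have \<alpha>\<^sub>0: "0 < \<alpha> j\<^sub>0" "0 < p j\<^sub>0" using \<alpha>_pos[OF j\<^sub>0] p_pos[OF j\<^sub>0] by auto
  have A1: "0 \<le> A\<^sub>1" using A \<alpha>\<^sub>0 by (meson add_nonneg_nonneg divide_nonneg_pos less_imp_le mult_nonneg_nonneg mult_pos_pos order_trans zero_le_numeral)
  have A12: "A\<^sub>2 \<le> p j\<^sub>0 * (A\<^sub>1 * (\<alpha> j\<^sub>0 / (2 + \<alpha> j\<^sub>0)))"
    using A(2) \<alpha>\<^sub>0 by (simp add: field_simps)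
  define \<kappa> where "\<kappa> = \<beta> - \<alpha> j\<^sub>0"
  have \<kappa>: "0 < \<kappa>" "\<kappa> \<le> 1" using \<beta> \<alpha>\<^sub>0 by (auto simp: \<kappa>_def)
  have x01: "x \<in> {0<..1}" using x by auto
  define e where "e j = (if j = j\<^sub>0 then A\<^sub>1 * (\<alpha> j\<^sub>0 / (2 + \<alpha> j\<^sub>0)) * x powr (\<beta> - 1) else 0)" for j
  have PL: "PL j f x \<le> A\<^sub>1 * x powr (\<kappa> - 1) - e j" if j: "j \<in> I" for j
  proof -
    obtain y t where y: "y \<in> {0<..1/2}" "0 < t" "t \<le> 1" "t = (2 * y) powr \<alpha> j" "x = y * (1 + t)"
      "PL j f x = f y / (1 + (1 + \<alpha> j) * t)" "x \<le> 2 * y"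
      using PL_at_deriv[OF j, of x f] x01 by metis
    have a: "0 < \<alpha> j" by (rule \<alpha>_pos[OF j])
    have den: "0 < 1 + (1 + \<alpha> j) * t" using y(2) a by (simp add: add_pos_pos)
    have "y powr (\<kappa> - 1) = x powr (\<kappa> - 1) * (1 + t) powr (1 - \<kappa>)"
      using y(1,2) by (simp add: y(5) powr_mult powr_add[symmetric] mult.assoc)
    also have "\<dots> \<le> x powr (\<kappa> - 1) * (1 + t)"
      using \<kappa> y(2) powr_mono[of "1 - \<kappa>" 1 "1 + t"] by (intro mult_left_mono) auto
    finally have yx: "y powr (\<kappa> - 1) \<le> x powr (\<kappa> - 1) * (1 + t)" .
    have "f y \<le> A\<^sub>1 * y powr (\<kappa> - 1)"
      using f(2) y(1) by (auto simp: power_bound_def \<kappa>_def)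
    also have "\<dots> \<le> A\<^sub>1 * (x powr (\<kappa> - 1) * (1 + t))" using yx A1 by (rule mult_left_mono)
    finally have "PL j f x \<le> A\<^sub>1 * (x powr (\<kappa> - 1) * (1 + t)) / (1 + (1 + \<alpha> j) * t)"
      unfolding y(6) using den by (simp add: divide_right_mono)
    also have "\<dots> = A\<^sub>1 * x powr (\<kappa> - 1) * ((1 + t) / (1 + (1 + \<alpha> j) * t))" by simp
    also have "(1 + t) / (1 + (1 + \<alpha> j) * t) = 1 - \<alpha> j * t / (1 + (1 + \<alpha> j) * t)"
      using den by (simp add: field_simps)
    also have "A\<^sub>1 * x powr (\<kappa> - 1) * \<dots> = A\<^sub>1 * x powr (\<kappa> - 1)
        - A\<^sub>1 * x powr (\<kappa> - 1) * (\<alpha> j * t / (1 + (1 + \<alpha> j) * t))" by (simp add: algebra_simps)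
    also have "\<dots> \<le> A\<^sub>1 * x powr (\<kappa> - 1) - e j"
    proof (cases "j = j\<^sub>0")
      case True
      have "x powr \<alpha> j \<le> t" unfolding y(4) using a x y(7) by (intro powr_mono2) auto
      then have "\<alpha> j * x powr \<alpha> j / (2 + \<alpha> j) \<le> \<alpha> j * t / (1 + (1 + \<alpha> j) * t)"
      proof (intro frac_le mult_left_mono)
        have "(1 + \<alpha> j) * t \<le> (1 + \<alpha> j) * 1" using y(3) a by (intro mult_left_mono) auto
        then show "1 + (1 + \<alpha> j) * t \<le> 2 + \<alpha> j" by simp
      qed (use a y(2) den in auto)
      then have "A\<^sub>1 * x powr (\<kappa> - 1) * (\<alpha> j * x powr \<alpha> j / (2 + \<alpha> j))
        \<le> A\<^sub>1 * x powr (\<kappa> - 1) * (\<alpha> j * t / (1 + (1 + \<alpha> j) * t))"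
        using A1 by (intro mult_left_mono) auto
      moreover have "x powr (\<kappa> - 1) * x powr \<alpha> j = x powr (\<beta> - 1)"
        using True by (simp add: powr_add[symmetric] \<kappa>_def)
      then have "A\<^sub>1 * x powr (\<kappa> - 1) * (\<alpha> j * x powr \<alpha> j / (2 + \<alpha> j)) = e j"
        using True by (simp add: e_def)
      ultimately show ?thesis by simp
    next
      case False
      have "0 \<le> A\<^sub>1 * x powr (\<kappa> - 1) * (\<alpha> j * t / (1 + (1 + \<alpha> j) * t))"
        using A1 a y(2) den by (intro mult_nonneg_nonneg divide_nonneg_pos) auto
      with False show ?thesis by (simp add: e_def)
    qed
    finally show ?thesis .
  qed
  have PR: "PR j f x \<le> A\<^sub>2 * x powr (\<beta> - 1)" if j: "j \<in> I" for j
  proof (cases "j \<in> RR")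
    case True
    then show ?thesis using PR_R_zero[OF True, of x f] x A(1) by simp
  next
    case False
    have "PR j f x = f ((x + 1) / 2) / 2" using PR_S False j x by auto
    also have "f ((x + 1) / 2) \<le> A\<^sub>2 * ((x + 1) / 2 - 1/2) powr (\<beta> - 1)"
      using f(2) x by (auto simp: power_bound_def)
    also have "(x + 1) / 2 - 1/2 = x * (1/2)" by (simp add: field_simps)
    also have "(x * (1/2)) powr (\<beta> - 1) \<le> x powr (\<beta> - 1) * 2"
    proof -
      have "(1/2::real) powr (\<beta> - 1) \<le> (1/2) powr (-1)"
        using \<beta> \<alpha>\<^sub>0 by (intro powr_mono') auto
      then show ?thesis using x by (subst powr_mult) (auto simp: powr_minus intro!: mult_left_mono)
    qed
    finally show ?thesis using A(1) by (simp add: mult_left_mono divide_right_mono)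
  qed
  have "transfer_op f x \<le> (\<Sum>j\<in>I. p j * ((A\<^sub>1 * x powr (\<kappa> - 1) - e j) + A\<^sub>2 * x powr (\<beta> - 1)))"
    unfolding transfer_op_def using PL PR p_pos
    by (intro sum_mono mult_left_mono add_mono) (auto intro: less_imp_le)
  also have "\<dots> = (\<Sum>j\<in>I. p j * (A\<^sub>1 * x powr (\<kappa> - 1) + A\<^sub>2 * x powr (\<beta> - 1)) - p j * e j)"
    by (simp add: algebra_simps)
  also have "\<dots> = (A\<^sub>1 * x powr (\<kappa> - 1) + A\<^sub>2 * x powr (\<beta> - 1)) - (\<Sum>j\<in>I. p j * e j)"
    by (simp add: sum_subtractf p_sum flip: sum_distrib_right)
  also have "(\<Sum>j\<in>I. p j * e j) = p j\<^sub>0 * e j\<^sub>0"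
    using j\<^sub>0 by (subst sum.remove[of _ j\<^sub>0]) (auto simp: e_def intro!: sum.neutral)
  finally have "transfer_op f x \<le> A\<^sub>1 * x powr (\<kappa> - 1) + A\<^sub>2 * x powr (\<beta> - 1)
      - p j\<^sub>0 * (A\<^sub>1 * (\<alpha> j\<^sub>0 / (2 + \<alpha> j\<^sub>0)) * x powr (\<beta> - 1))"
    by (simp add: e_def)
  moreover have "A\<^sub>2 * x powr (\<beta> - 1) \<le> p j\<^sub>0 * (A\<^sub>1 * (\<alpha> j\<^sub>0 / (2 + \<alpha> j\<^sub>0))) * x powr (\<beta> - 1)"
    using A12 by (rule mult_right_mono) simp
  ultimately show ?thesis by (simp add: \<kappa>_def mult.assoc)
qed

lemma bnd_tr:
  assumes "\<alpha> j\<^sub>0 < \<beta>" "\<beta> \<le> 1" "\<theta> = (\<Sum>r\<in>RR. p r * K r powr (- \<beta>))" "\<theta> < 1"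
    and "6 / (1 - \<theta>) \<le> A\<^sub>2" "A\<^sub>2 * (2 + \<alpha> j\<^sub>0) / (p j\<^sub>0 * \<alpha> j\<^sub>0) \<le> A\<^sub>1"
    and "cone_density f" "(\<integral>\<^sup>+x. ennreal (f x) \<partial>lborel) \<le> 1" "power_bound \<beta> A\<^sub>1 A\<^sub>2 f"
  shows "power_bound \<beta> A\<^sub>1 A\<^sub>2 (transfer_op f)"
proof -
  have "0 < \<alpha> j\<^sub>0" by (rule \<alpha>_pos[OF j\<^sub>0])
  moreover have "0 \<le> A\<^sub>2"
    using assms(4,5) by (meson diff_gt_0_iff_gt divide_nonneg_pos order_trans zero_le_numeral)
  ultimately show ?thesis
    using assms bnd_tr_left[of \<beta> A\<^sub>2 A\<^sub>1 f] bnd_tr_right[of \<beta> \<theta> A\<^sub>2 f] by (auto simp: power_bound_def)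
qed

end

lemma small_powr_mass:
  fixes A s a :: real
  assumes "0 < s" "0 \<le> A"
  obtains \<delta> where "0 < \<delta>" "\<delta> \<le> 1/2"
    "(\<integral>\<^sup>+x. ennreal (A * (x - a) powr (s - 1)) * indicator {a<..a + \<delta>} x \<partial>lborel) \<le> ennreal (1/4)"
proof -
  define \<delta> where "\<delta> = min (1/2) ((s / (4 * (A + 1))) powr (1 / s))"
  have \<delta>: "0 < \<delta>" "\<delta> \<le> 1/2" using assms by (auto simp: \<delta>_def)
  have "\<delta> powr s \<le> ((s / (4 * (A + 1))) powr (1 / s)) powr s"
    using assms \<delta> by (intro powr_mono2) (auto simp: \<delta>_def)
  also have "\<dots> = s / (4 * (A + 1))" using assms by (simp add: powr_powr)
  finally have "A * (\<delta> powr s / s) \<le> A * (s / (4 * (A + 1)) / s)"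
    using assms by (intro mult_left_mono divide_right_mono) auto
  also have "\<dots> = A / (A + 1) / 4" using assms by simp
  also have "\<dots> \<le> 1/4" using assms by (simp add: divide_le_eq)
  finally have le: "A * (\<delta> powr s / s) \<le> 1/4" .
  have "((\<lambda>x. A * x powr (s - 1)) has_integral A * (\<delta> powr s / s)) {0..\<delta>}"
    using has_integral_mult_right[OF has_integral_powr_from_0[of "s - 1" \<delta>], of A] assms \<delta> by simp
  then have "(\<integral>\<^sup>+x. ennreal (indicator {0..\<delta>} x * (A * x powr (s - 1))) \<partial>lborel) = ennreal (A * (\<delta> powr s / s))"
    using assms by (intro nn_integral_has_integral_lebesgue) auto
  moreover have "(\<integral>\<^sup>+x. ennreal (A * (x - a) powr (s - 1)) * indicator {a<..a + \<delta>} x \<partial>lborel)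
      = (\<integral>\<^sup>+x. ennreal (indicator {0..\<delta>} x * (A * x powr (s - 1))) \<partial>lborel)"
    by (subst nn_integral_real_affine[of _ 1 a])
       (auto intro!: nn_integral_cong simp: indicator_def)
  ultimately show ?thesis using \<delta> le by (intro that[of \<delta>]) (auto simp: ennreal_leI)
qed

context random_maps
begin

lemma PL_nonneg: "cone_density f \<Longrightarrow> j \<in> I \<Longrightarrow> 0 \<le> PL j f x"
  and PR_nonneg: "cone_density f \<Longrightarrow> j \<in> I \<Longrightarrow> 0 \<le> PR j f x"
  using branch.push_nonneg[OF branch_L] branch.push_nonneg[OF branch_R] densD(4) by auto

lemma tr_ge_left:
  assumes f: "cone_density f" and x: "x \<in> {0<..1}"
  shows "f (1/2) / (real n + 1) \<le> transfer_op f x"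
proof -
  have PL: "f (1/2) / (real n + 1) \<le> PL j f x" if j: "j \<in> I" for j
  proof -
    obtain y t where y: "y \<in> {0<..1/2}" "0 < t" "t \<le> 1" "PL j f x = f y / (1 + (1 + \<alpha> j) * t)"
      using PL_at_deriv[OF j x, of f] by metis
    have "(1 + \<alpha> j) * t \<le> real n * 1"
      using n(2)[OF j] \<alpha>_pos[OF j] y(2,3) by (intro mult_mono) auto
    then show ?thesis unfolding y(4)
      using decr_coneD(2)[OF densD(1)[OF f], of y "1/2"] densD(4)[OF f] y(1,2) \<alpha>_pos[OF j]
      by (intro frac_le) (auto simp: add_pos_pos)
  qed
  have "(\<Sum>j\<in>I. p j * (f (1/2) / (real n + 1))) \<le> transfer_op f x"
    unfolding transfer_op_def using PL PR_nonneg[OF f] p_pos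
    by (intro sum_mono mult_left_mono) (auto intro: less_imp_le add_increasing2)
  then show ?thesis by (simp only: sum_distrib_right[symmetric] p_sum)
qed

lemma tr_ge_right:
  assumes f: "cone_density f" and x: "x \<in> {0<..1}"
  shows "(\<Sum>j\<in>I - RR. p j) * (f 1 / 2) \<le> transfer_op f x"
proof -
  have PR: "f 1 / 2 \<le> PR j f x" if j: "j \<in> I - RR" for j
    using decr_coneD(2)[OF densD(2)[OF f], of "(x + 1) / 2" 1] x by (simp add: PR_S[OF j x])
  have "(\<Sum>j\<in>I - RR. p j * (f 1 / 2)) \<le> (\<Sum>j\<in>I - RR. p j * (PL j f x + PR j f x))"
    using PR PL_nonneg[OF f] p_pos
    by (intro sum_mono mult_left_mono) (auto intro: less_imp_le add_increasing)
  also have "\<dots> \<le> transfer_op f x"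
    unfolding transfer_op_def using PL_nonneg[OF f] PR_nonneg[OF f] p_pos
    by (intro sum_mono2) (auto intro!: mult_nonneg_nonneg add_nonneg_nonneg less_imp_le[OF p_pos])
  finally show ?thesis by (simp only: sum_distrib_right)
qed

lemma bnd_mass_split:
  assumes "\<alpha> j\<^sub>0 < \<beta>" "0 \<le> A\<^sub>1" "0 \<le> A\<^sub>2"
  shows "\<exists>\<delta>\<^sub>1>0. \<exists>\<delta>\<^sub>2>0. \<forall>f F\<^sub>1 F\<^sub>2. cone_density f \<and> power_bound \<beta> A\<^sub>1 A\<^sub>2 f \<and> 0 \<le> F\<^sub>1 \<and> 0 \<le> F\<^sub>2 \<and>
      (\<forall>y\<in>{\<delta>\<^sub>1<..1/2}. f y \<le> F\<^sub>1) \<and> (\<forall>y\<in>{1/2 + \<delta>\<^sub>2<..1}. f y \<le> F\<^sub>2) \<longrightarrow>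
      (\<integral>\<^sup>+x. ennreal (f x) \<partial>lborel) \<le> ennreal (1/2 + F\<^sub>1 / 2 + F\<^sub>2 / 2)"
proof -
  have \<beta>: "0 < \<beta> - \<alpha> j\<^sub>0" "0 < \<beta>" using \<alpha>_pos[OF j\<^sub>0] assms(1) by auto
  obtain \<delta>\<^sub>1 where \<delta>\<^sub>1: "0 < \<delta>\<^sub>1" "\<delta>\<^sub>1 \<le> 1/2"
    "(\<integral>\<^sup>+x. ennreal (A\<^sub>1 * (x - 0) powr (\<beta> - \<alpha> j\<^sub>0 - 1)) * indicator {0<..0 + \<delta>\<^sub>1} x \<partial>lborel) \<le> ennreal (1/4)"
    by (rule small_powr_mass[OF \<beta>(1) assms(2)])
  obtain \<delta>\<^sub>2 where \<delta>\<^sub>2: "0 < \<delta>\<^sub>2" "\<delta>\<^sub>2 \<le> 1/2"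
    "(\<integral>\<^sup>+x. ennreal (A\<^sub>2 * (x - 1/2) powr (\<beta> - 1)) * indicator {1/2<..1/2 + \<delta>\<^sub>2} x \<partial>lborel) \<le> ennreal (1/4)"
    by (rule small_powr_mass[OF \<beta>(2) assms(3)])
  show ?thesis
  proof (rule exI[of _ \<delta>\<^sub>1], rule conjI[OF \<delta>\<^sub>1(1)], rule exI[of _ \<delta>\<^sub>2], rule conjI[OF \<delta>\<^sub>2(1)],
      intro allI impI, elim conjE)
    fix f F\<^sub>1 F\<^sub>2
    assume f: "cone_density f" "power_bound \<beta> A\<^sub>1 A\<^sub>2 f" and F: "0 \<le> F\<^sub>1" "0 \<le> F\<^sub>2"
      and F1: "\<forall>y\<in>{\<delta>\<^sub>1<..1/2}. f y \<le> F\<^sub>1" and F2: "\<forall>y\<in>{1/2 + \<delta>\<^sub>2<..1}. f y \<le> F\<^sub>2"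
    have le: "ennreal (f y) \<le> ennreal (A\<^sub>1 * (y - 0) powr (\<beta> - \<alpha> j\<^sub>0 - 1)) * indicator {0<..0 + \<delta>\<^sub>1} y
      + ennreal (A\<^sub>2 * (y - 1/2) powr (\<beta> - 1)) * indicator {1/2<..1/2 + \<delta>\<^sub>2} y
      + ennreal F\<^sub>1 * indicator {0<..1/2} y + ennreal F\<^sub>2 * indicator {1/2<..1} y" for y
    proof -
      consider "y \<notin> {0<..1}" | "0 < y" "y \<le> \<delta>\<^sub>1" | "\<delta>\<^sub>1 < y" "y \<le> 1/2"
        | "1/2 < y" "y \<le> 1/2 + \<delta>\<^sub>2" | "1/2 + \<delta>\<^sub>2 < y" "y \<le> 1"
        by fastforce
      then show ?thesis
      proof cases
        case 1 then show ?thesis using densD(3)[OF f(1)] by simp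
      next
        case 2 then show ?thesis using f(2) \<delta>\<^sub>1
          by (intro add_increasing2) (auto simp: power_bound_def intro!: ennreal_leI)
      next
        case 3
        then show ?thesis using bspec[OF F1, of y] \<delta>\<^sub>1 by (simp add: ennreal_leI)
      next
        case 4
        then have "f y \<le> A\<^sub>2 * (y - 1/2) powr (\<beta> - 1)" using f(2) \<delta>\<^sub>2(2) by (auto simp: power_bound_def)
        then show ?thesis using 4 \<delta>\<^sub>1(2) by (simp add: ennreal_leI add_increasing2)
      next
        case 5
        then show ?thesis using bspec[OF F2, of y] \<delta>\<^sub>2(1) \<delta>\<^sub>1(2) by (simp add: ennreal_leI)
      qed
    qed
    have "(\<integral>\<^sup>+x. ennreal (f x) \<partial>lborel) \<le> (\<integral>\<^sup>+y. ennreal (A\<^sub>1 * (y - 0) powr (\<beta> - \<alpha> j\<^sub>0 - 1)) * indicator {0<..0 + \<delta>\<^sub>1} y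
      + ennreal (A\<^sub>2 * (y - 1/2) powr (\<beta> - 1)) * indicator {1/2<..1/2 + \<delta>\<^sub>2} y
      + ennreal F\<^sub>1 * indicator {0<..1/2} y + ennreal F\<^sub>2 * indicator {1/2<..1} y \<partial>lborel)"
      by (intro nn_integral_mono le)
    also have "\<dots> = (\<integral>\<^sup>+y. ennreal (A\<^sub>1 * (y - 0) powr (\<beta> - \<alpha> j\<^sub>0 - 1)) * indicator {0<..0 + \<delta>\<^sub>1} y \<partial>lborel)
      + (\<integral>\<^sup>+y. ennreal (A\<^sub>2 * (y - 1/2) powr (\<beta> - 1)) * indicator {1/2<..1/2 + \<delta>\<^sub>2} y \<partial>lborel)
      + ennreal F\<^sub>1 * ennreal (1/2) + ennreal F\<^sub>2 * ennreal (1/2)"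
      by (simp add: nn_integral_add nn_integral_cmult_indicator)
    also have "\<dots> \<le> ennreal (1/4) + ennreal (1/4) + ennreal F\<^sub>1 * ennreal (1/2) + ennreal F\<^sub>2 * ennreal (1/2)"
      by (intro add_mono \<delta>\<^sub>1 \<delta>\<^sub>2 order_refl)
    also have "\<dots> = ennreal (1/4 + 1/4 + F\<^sub>1 * (1/2) + F\<^sub>2 * (1/2))"
    proof -
      have "0 \<le> (1/4::real)" "0 \<le> (1/2::real)" by auto
      then show ?thesis
        by (simp only: ennreal_plus ennreal_mult F add_nonneg_nonneg mult_nonneg_nonneg)
    qed
    finally show "(\<integral>\<^sup>+x. ennreal (f x) \<partial>lborel) \<le> ennreal (1/2 + F\<^sub>1 / 2 + F\<^sub>2 / 2)" by simp
  qed
qed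

lemma bnd_mass_finite:
  assumes f: "cone_density f" "power_bound \<beta> A\<^sub>1 A\<^sub>2 f" and "\<alpha> j\<^sub>0 < \<beta>" "0 \<le> A\<^sub>1" "0 \<le> A\<^sub>2"
  shows "(\<integral>\<^sup>+x. ennreal (f x) \<partial>lborel) < \<infinity>"
proof -
  obtain \<delta>\<^sub>1 \<delta>\<^sub>2 where \<delta>: "0 < \<delta>\<^sub>1" "0 < \<delta>\<^sub>2"
    and split: "\<forall>f F\<^sub>1 F\<^sub>2. cone_density f \<and> power_bound \<beta> A\<^sub>1 A\<^sub>2 f \<and> 0 \<le> F\<^sub>1 \<and> 0 \<le> F\<^sub>2 \<and>
      (\<forall>y\<in>{\<delta>\<^sub>1<..1/2}. f y \<le> F\<^sub>1) \<and> (\<forall>y\<in>{1/2 + \<delta>\<^sub>2<..1}. f y \<le> F\<^sub>2) \<longrightarrow>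
      (\<integral>\<^sup>+x. ennreal (f x) \<partial>lborel) \<le> ennreal (1/2 + F\<^sub>1 / 2 + F\<^sub>2 / 2)"
    using bnd_mass_split[OF assms(3-5)] by (elim exE conjE)
  have "(\<integral>\<^sup>+x. ennreal (f x) \<partial>lborel) \<le> ennreal (1/2 + f \<delta>\<^sub>1 / 2 + f (1/2 + \<delta>\<^sub>2) / 2)"
    using \<delta> decr_coneD(2)[OF densD(1)[OF f(1)]] decr_coneD(2)[OF densD(2)[OF f(1)]] densD(4)[OF f(1)]
    by (intro split[rule_format]) (auto simp: f)
  also have "\<dots> < \<infinity>" by simp
  finally show ?thesis .
qed

lemma tr_lower_bound:
  assumes "\<alpha> j\<^sub>0 < \<beta>" "0 \<le> A\<^sub>1" "0 \<le> A\<^sub>2"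
  shows "\<exists>c>0. \<forall>f x. cone_density f \<and> (\<integral>\<^sup>+x. ennreal (f x) \<partial>lborel) = 1 \<and> power_bound \<beta> A\<^sub>1 A\<^sub>2 f \<and> x \<in> {0<..1} \<longrightarrow> c \<le> transfer_op f x"
proof -
  obtain \<delta>\<^sub>1 \<delta>\<^sub>2 where \<delta>: "0 < \<delta>\<^sub>1" "0 < \<delta>\<^sub>2"
    and split: "\<forall>f F\<^sub>1 F\<^sub>2. cone_density f \<and> power_bound \<beta> A\<^sub>1 A\<^sub>2 f \<and> 0 \<le> F\<^sub>1 \<and> 0 \<le> F\<^sub>2 \<and>
      (\<forall>y\<in>{\<delta>\<^sub>1<..1/2}. f y \<le> F\<^sub>1) \<and> (\<forall>y\<in>{1/2 + \<delta>\<^sub>2<..1}. f y \<le> F\<^sub>2) \<longrightarrow>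
      (\<integral>\<^sup>+x. ennreal (f x) \<partial>lborel) \<le> ennreal (1/2 + F\<^sub>1 / 2 + F\<^sub>2 / 2)"
    using bnd_mass_split[OF assms] by (elim exE conjE)
  define P where "P = (\<Sum>j\<in>I - RR. p j)"
  have P: "0 < P" unfolding P_def using RR p_pos by (intro sum_pos) auto
  define c where "c = min (\<delta>\<^sub>1 ^ n / 4 / (real n + 1)) (P * (\<delta>\<^sub>2 ^ n / 4 / 2))"
  have "0 < c" using \<delta> P by (auto simp: c_def)
  moreover have "c \<le> transfer_op f x"
    if f: "cone_density f" "(\<integral>\<^sup>+x. ennreal (f x) \<partial>lborel) = 1" "power_bound \<beta> A\<^sub>1 A\<^sub>2 f" and x: "x \<in> {0<..1}" for f x
  proof -
    define F\<^sub>1 F\<^sub>2 where "F\<^sub>1 = f (1/2) / \<delta>\<^sub>1 ^ n" and "F\<^sub>2 = f 1 / \<delta>\<^sub>2 ^ n"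
    have F: "0 \<le> F\<^sub>1" "0 \<le> F\<^sub>2" using densD(4)[OF f(1)] \<delta> by (auto simp: F\<^sub>1_def F\<^sub>2_def)
    have *: "f y \<le> f b / d ^ n"
      if "decr_cone n a b f" "a + d \<le> y" "y \<le> b" "0 < d" "b \<le> a + 1" for a b d y
    proof -
      have "d ^ n * f y \<le> (y - a) ^ n * f y"
        using that densD(4)[OF f(1)] by (intro mult_right_mono power_mono) auto
      also have "\<dots> \<le> (b - a) ^ n * f b" using that by (intro decr_coneD(3)[OF that(1)]) auto
      also have "\<dots> \<le> 1 * f b"
        using that densD(4)[OF f(1)] by (intro mult_right_mono power_le_one) auto
      finally show ?thesis using that by (simp add: field_simps)
    qed
    have "1 \<le> ennreal (1/2 + F\<^sub>1 / 2 + F\<^sub>2 / 2)"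
      unfolding f(2)[symmetric] using \<delta> *[OF densD(1)[OF f(1)], of \<delta>\<^sub>1] *[OF densD(2)[OF f(1)], of \<delta>\<^sub>2]
      by (intro split[rule_format]) (use f F in \<open>auto simp: F\<^sub>1_def F\<^sub>2_def\<close>)
    then have "1 \<le> 1/2 + F\<^sub>1 / 2 + F\<^sub>2 / 2"
      by (simp only: ennreal_1[symmetric] ennreal_le_iff2) auto
    then have "1/4 \<le> F\<^sub>1 \<or> 1/4 \<le> F\<^sub>2" by linarith
    then show ?thesis
    proof
      assume "1/4 \<le> F\<^sub>1"
      then have "\<delta>\<^sub>1 ^ n / 4 / (real n + 1) \<le> f (1/2) / (real n + 1)"
        using \<delta> by (intro divide_right_mono) (auto simp: F\<^sub>1_def field_simps)
      with tr_ge_left[OF f(1) x] show ?thesis by (simp add: c_def)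
    next
      assume "1/4 \<le> F\<^sub>2"
      then have "P * (\<delta>\<^sub>2 ^ n / 4 / 2) \<le> P * (f 1 / 2)"
        using \<delta> P by (intro mult_left_mono divide_right_mono) (auto simp: F\<^sub>2_def field_simps)
      moreover have "c \<le> P * (\<delta>\<^sub>2 ^ n / 4 / 2)" unfolding c_def by (rule min.cobounded2)
      ultimately show ?thesis using tr_ge_right[OF f(1) x] unfolding P_def[symmetric] by linarith
    qed
  qed
  ultimately show ?thesis by blast
qed

lemma tr_scale: "transfer_op (\<lambda>x. k * f x) x = k * transfer_op f x"
proof -
  have "push_fwd a b T T' (\<lambda>x. k * f x) x = k * push_fwd a b T T' f x" for a b T T'
    by (simp add: push_fwd_def)
  then show ?thesis by (simp add: transfer_op_def sum_distrib_left algebra_simps)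
qed

lemma tr_add: "transfer_op (\<lambda>x. f x + g x) x = transfer_op f x + transfer_op g x"
proof -
  have "push_fwd a b T T' (\<lambda>x. f x + g x) x = push_fwd a b T T' f x + push_fwd a b T T' g x" for a b T T'
    by (simp add: push_fwd_def add_divide_distrib)
  then show ?thesis by (simp add: transfer_op_def sum.distrib[symmetric] algebra_simps)
qed

lemma tr_sum: "finite J \<Longrightarrow> transfer_op (\<lambda>x. \<Sum>i\<in>J. f i x) x = (\<Sum>i\<in>J. transfer_op (f i) x)"
proof (induction J rule: finite_induct)
  case empty
  show ?case using tr_scale[of 0 "\<lambda>_. 0" x] by simp
next
  case (insert i J)
  then show ?case by (simp add: tr_add)
qed

end

section \<open>Existence of an invariant density\<close>

lemma pointwise_cluster_point:
  fixes g :: "nat \<Rightarrow> 'a \<Rightarrow> real" and M :: "'a \<Rightarrow> real"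
  assumes "\<And>k x. g k x \<in> {0..M x}"
  shows "\<exists>G f. G \<noteq> bot \<and> (\<forall>x. ((\<lambda>u. u x) \<longlongrightarrow> f x) G) \<and>
    (\<forall>P. eventually (\<lambda>k. P (g k)) sequentially \<longrightarrow> eventually P G)"
proof -
  have "compactin (product_topology (\<lambda>_. euclidean) UNIV) (Pi\<^sub>E UNIV (\<lambda>x. {0..M x}))"
    by (subst compactin_PiE) auto
  then have "compact (Pi\<^sub>E UNIV (\<lambda>x. {0..M x}))"
    by (simp add: euclidean_product_topology)
  moreover have "eventually (\<lambda>u. u \<in> Pi\<^sub>E UNIV (\<lambda>x. {0..M x})) (filtermap g sequentially)"
    using assms by (auto simp: eventually_filtermap PiE_UNIV_domain)
  ultimately obtain f where f: "inf (nhds f) (filtermap g sequentially) \<noteq> bot"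
    unfolding compact_filter by (metis filtermap_bot_iff sequentially_bot)
  define G where "G = inf (nhds f) (filtermap g sequentially)"
  have "((\<lambda>u. u x) \<longlongrightarrow> f x) G" for x
  proof -
    have "((\<lambda>u. u x) \<longlongrightarrow> f x) (nhds f)"
    proof (rule topological_tendstoI)
      fix S :: "real set" assume S: "open S" "f x \<in> S"
      have "continuous_on UNIV (\<lambda>u::'a \<Rightarrow> real. u x)"
        by (rule continuous_on_product_coordinates)
      then have "open ((\<lambda>u::'a \<Rightarrow> real. u x) -` S)" using S(1) open_vimage by blast
      from eventually_nhds_in_open[OF this, of f] S(2)
      show "\<forall>\<^sub>F u in nhds f. u x \<in> S" by simp
    qed
    then show ?thesis unfolding G_def by (rule tendsto_mono[rotated]) simp
  qed
  moreover have "eventually P G" if "eventually (\<lambda>k. P (g k)) sequentially" for P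
    unfolding G_def using that
    by (intro filter_leD[OF inf_le2]) (simp add: eventually_filtermap)
  ultimately show ?thesis using f by (intro exI[of _ G] exI[of _ f]) (auto simp: G_def)
qed

locale contracting_random_maps = random_maps +
  assumes \<alpha>\<^sub>0_less: "\<alpha> j\<^sub>0 < 1" and \<eta>: "(\<Sum>r\<in>RR. p r * K r powr (- \<alpha> j\<^sub>0)) < 1"
begin

definition dens_seq :: "nat \<Rightarrow> real \<Rightarrow> real" where
  "dens_seq k = (transfer_op ^^ k) (indicator {0<..1})"

definition cesaro :: "nat \<Rightarrow> real \<Rightarrow> real" where
  "cesaro k x = (\<Sum>i<Suc k. dens_seq i x) / real (Suc k)"

lemma dens_seq_Suc: "dens_seq (Suc k) = transfer_op (dens_seq k)"
  by (simp add: dens_seq_def)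

lemma dens_seq_dens: "cone_density (dens_seq k)"
proof (induction k)
  case 0
  show ?case unfolding cone_density_def dens_seq_def
    by (auto intro: decr_cone_cong[OF decr_cone_const[of 1]])
qed (simp add: dens_seq_Suc tr_dens)

lemma dens_seq_mass: "(\<integral>\<^sup>+x. ennreal (dens_seq k x) \<partial>lborel) = 1"
proof (induction k)
  case 0
  show ?case by (simp add: dens_seq_def ennreal_indicator)
qed (simp add: dens_seq_Suc tr_mass dens_seq_dens)

lemma admissible_exponent:
  obtains \<beta> where "\<alpha> j\<^sub>0 < \<beta>" "\<beta> \<le> 1" "(\<Sum>r\<in>RR. p r * K r powr (- \<beta>)) < 1"
proof -
  have "((\<lambda>\<beta>. \<Sum>r\<in>RR. p r * K r powr (- \<beta>)) \<longlongrightarrow> (\<Sum>r\<in>RR. p r * K r powr (- \<alpha> j\<^sub>0))) (at_right (\<alpha> j\<^sub>0))"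
    using K by (intro tendsto_intros) force
  then have "\<forall>\<^sub>F \<beta> in at_right (\<alpha> j\<^sub>0). (\<Sum>r\<in>RR. p r * K r powr (- \<beta>)) < 1"
    using \<eta> by (rule order_tendstoD)
  moreover have "\<forall>\<^sub>F \<beta> in at_right (\<alpha> j\<^sub>0). \<beta> \<in> {\<alpha> j\<^sub>0<..<1}"
    using \<alpha>\<^sub>0_less by (rule eventually_at_right_real)
  ultimately have "\<forall>\<^sub>F \<beta> in at_right (\<alpha> j\<^sub>0). (\<Sum>r\<in>RR. p r * K r powr (- \<beta>)) < 1 \<and> \<beta> \<in> {\<alpha> j\<^sub>0<..<1}"
    by (rule eventually_conj)
  then show ?thesis using that by (auto dest!: eventually_happens)
qed

lemma dens_seq_bnd:
  assumes "\<alpha> j\<^sub>0 < \<beta>" "\<beta> \<le> 1" "(\<Sum>r\<in>RR. p r * K r powr (- \<beta>)) < 1"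
  obtains A\<^sub>1 A\<^sub>2 where "0 < A\<^sub>1" "0 < A\<^sub>2" "\<And>k. power_bound \<beta> A\<^sub>1 A\<^sub>2 (dens_seq k)"
proof -
  define \<theta> where "\<theta> = (\<Sum>r\<in>RR. p r * K r powr (- \<beta>))"
  define A\<^sub>2 where "A\<^sub>2 = max 1 (6 / (1 - \<theta>))"
  define A\<^sub>1 where "A\<^sub>1 = max 1 (A\<^sub>2 * (2 + \<alpha> j\<^sub>0) / (p j\<^sub>0 * \<alpha> j\<^sub>0))"
  have \<alpha>\<^sub>0: "0 < \<alpha> j\<^sub>0" by (rule \<alpha>_pos[OF j\<^sub>0])
  have one_le: "1 \<le> A * u powr e" if "1 \<le> A" "0 < u" "u \<le> 1" "e \<le> 0" for A u e :: real
  proof -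
    have "1 powr e \<le> u powr e" using that by (intro powr_mono2') auto
    then have "1 * 1 \<le> A * u powr e" using that by (intro mult_mono) auto
    then show ?thesis by simp
  qed
  have "power_bound \<beta> A\<^sub>1 A\<^sub>2 (dens_seq k)" for k
  proof (induction k)
    case 0
    show ?case using assms \<alpha>\<^sub>0
      by (auto simp: dens_seq_def power_bound_def indicator_def A\<^sub>1_def A\<^sub>2_def intro!: one_le)
  next
    case (Suc k)
    show ?case unfolding dens_seq_Suc
      using assms Suc dens_seq_dens dens_seq_mass
      by (intro bnd_tr[OF _ _ \<theta>_def]) (auto simp: \<theta>_def A\<^sub>1_def A\<^sub>2_def)
  qed
  then show ?thesis by (intro that[of A\<^sub>1 A\<^sub>2]) (auto simp: A\<^sub>1_def A\<^sub>2_def)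
qed

lemma dens_seq_lower:
  obtains c where "0 < c" "\<And>k x. x \<in> {0<..1} \<Longrightarrow> c \<le> dens_seq k x"
proof -
  obtain \<beta> where \<beta>: "\<alpha> j\<^sub>0 < \<beta>" "\<beta> \<le> 1" "(\<Sum>r\<in>RR. p r * K r powr (- \<beta>)) < 1"
    by (rule admissible_exponent)
  obtain A\<^sub>1 A\<^sub>2 where A: "0 < A\<^sub>1" "0 < A\<^sub>2" "\<And>k. power_bound \<beta> A\<^sub>1 A\<^sub>2 (dens_seq k)"
    using dens_seq_bnd[OF \<beta>] by metis
  obtain c where c: "0 < c" "\<forall>f x. cone_density f \<and> (\<integral>\<^sup>+x. ennreal (f x) \<partial>lborel) = 1 \<and> power_bound \<beta> A\<^sub>1 A\<^sub>2 f \<and> x \<in> {0<..1} \<longrightarrow> c \<le> transfer_op f x"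
    using tr_lower_bound[OF \<beta>(1) less_imp_le[OF A(1)] less_imp_le[OF A(2)]] by (elim exE conjE)
  have "min 1 c \<le> dens_seq k x" if "x \<in> {0<..1}" for k x
  proof (cases k)
    case 0
    with that show ?thesis by (simp add: dens_seq_def)
  next
    case (Suc i)
    show ?thesis unfolding Suc dens_seq_Suc
      using c(2)[rule_format, of "dens_seq i" x] dens_seq_dens dens_seq_mass A(3) that by simp
  qed
  with c(1) show ?thesis by (intro that[of "min 1 c"]) auto
qed

lemma cesaro_eq: "cesaro k = (\<lambda>x. (1 / real (Suc k)) * (\<Sum>i<Suc k. dens_seq i x))"
  by (simp add: cesaro_def fun_eq_iff)

lemma cesaro_dens: "cone_density (cesaro k)"
  unfolding cone_density_def cesaro_eq
proof (intro conjI allI impI)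
  show "(1 / real (Suc k)) * (\<Sum>i<Suc k. dens_seq i x) = 0" if "x \<notin> {0<..1}" for x
    using densD(3)[OF dens_seq_dens that] by simp
qed (intro decr_cone_scale decr_cone_sum densD[OF dens_seq_dens]; simp)+

lemma cesaro_le:
  assumes "\<And>i. dens_seq i x \<le> M"
  shows "cesaro k x \<le> M"
proof -
  have "(\<Sum>i<Suc k. dens_seq i x) \<le> real (card {..<Suc k}) * M"
    by (intro sum_bounded_above assms)
  then show ?thesis unfolding cesaro_def by (simp add: divide_le_eq mult.commute del: sum.lessThan_Suc of_nat_Suc)
qed

lemma cesaro_ge:
  assumes "\<And>i. m \<le> dens_seq i x"
  shows "m \<le> cesaro k x"
proof -
  have "real (card {..<Suc k}) * m \<le> (\<Sum>i<Suc k. dens_seq i x)"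
    by (intro sum_bounded_below assms)
  then show ?thesis unfolding cesaro_def by (simp add: le_divide_eq mult.commute del: sum.lessThan_Suc of_nat_Suc)
qed

lemma tr_cesaro: "transfer_op (cesaro k) x - cesaro k x = (dens_seq (Suc k) x - dens_seq 0 x) / real (Suc k)"
proof -
  have "transfer_op (cesaro k) x = (1 / real (Suc k)) * (\<Sum>i<Suc k. dens_seq (Suc i) x)"
    unfolding cesaro_eq dens_seq_Suc by (simp only: tr_scale tr_sum finite_lessThan)
  also have "(\<Sum>i<Suc k. dens_seq (Suc i) x) - (\<Sum>i<Suc k. dens_seq i x) = dens_seq (Suc k) x - dens_seq 0 x"
    by (simp only: sum_subtractf[symmetric] sum_lessThan_telescope[of "\<lambda>i. dens_seq i x"])
  then have "(1 / real (Suc k)) * (\<Sum>i<Suc k. dens_seq (Suc i) x) - cesaro k x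
      = (dens_seq (Suc k) x - dens_seq 0 x) / real (Suc k)"
    unfolding cesaro_eq by (simp only: right_diff_distrib[symmetric]) simp
  finally show ?thesis .
qed

lemma tr_continuous_pointwise:
  assumes "\<And>x. ((\<lambda>u. u x) \<longlongrightarrow> f x) G"
  shows "((\<lambda>u. transfer_op u x) \<longlongrightarrow> transfer_op f x) G"
proof -
  have "((\<lambda>u. push_fwd a b T T' u x) \<longlongrightarrow> push_fwd a b T T' f x) G" for a b T T'
    using tendsto_divide_zero assms unfolding push_fwd_def divide_inverse
    by (auto intro!: tendsto_intros assms)
  then show ?thesis unfolding transfer_op_def by (intro tendsto_intros)
qed

lemma dens_pointwise_limit:
  assumes "G \<noteq> bot" and lim: "\<And>x. ((\<lambda>u. u x) \<longlongrightarrow> f x) G" and ev: "eventually cone_density G"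
  shows "cone_density f"
proof -
  have cone: "decr_cone n a b f" if "eventually (decr_cone n a b) G" for a b
  proof (rule decr_coneI)
    show "0 \<le> f x" if "a < x" "x \<le> b" for x
      by (rule tendsto_lowerbound[OF lim _ \<open>G \<noteq> bot\<close>])
         (use \<open>eventually (decr_cone n a b) G\<close> in eventually_elim, use that in \<open>auto dest: decr_coneD\<close>)
    show "f y \<le> f x" if "a < x" "x \<le> y" "y \<le> b" for x y
      by (rule tendsto_le[OF \<open>G \<noteq> bot\<close> lim lim])
         (use \<open>eventually (decr_cone n a b) G\<close> in eventually_elim, use that in \<open>auto dest: decr_coneD\<close>)
    show "(x - a) ^ n * f x \<le> (y - a) ^ n * f y" if "a < x" "x \<le> y" "y \<le> b" for x y
      by (rule tendsto_le[OF \<open>G \<noteq> bot\<close> tendsto_mult_left[OF lim] tendsto_mult_left[OF lim]])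
         (use \<open>eventually (decr_cone n a b) G\<close> in eventually_elim, use that in \<open>auto dest: decr_coneD\<close>)
  qed
  show ?thesis unfolding cone_density_def
  proof (intro conjI allI impI cone)
    show "eventually (decr_cone n 0 (1/2)) G" "eventually (decr_cone n (1/2) 1) G"
      using ev by (auto elim!: eventually_mono simp: cone_density_def)
    fix x :: real assume "x \<notin> {0<..1}"
    then have "\<forall>\<^sub>F u in G. u x = 0" using ev by (auto elim!: eventually_mono simp: cone_density_def)
    then have "((\<lambda>u. u x) \<longlongrightarrow> 0) G" by (rule tendsto_eventually)
    then show "f x = 0" using tendsto_unique[OF \<open>G \<noteq> bot\<close> lim] by blast
  qed
qed

theorem invariant_density_exists:
  "\<exists>h c. cone_density h \<and> (\<integral>\<^sup>+x. ennreal (h x) \<partial>lborel) = 1 \<and> (\<forall>x. transfer_op h x = h x) \<and>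
    0 < c \<and> (\<forall>x\<in>{0<..1}. c \<le> h x) \<and>
    (\<forall>\<beta>. \<alpha> j\<^sub>0 < \<beta> \<and> \<beta> \<le> 1 \<and> (\<Sum>r\<in>RR. p r * K r powr (- \<beta>)) < 1 \<longrightarrow>
      (\<exists>A\<^sub>1>0. \<exists>A\<^sub>2>0. power_bound \<beta> A\<^sub>1 A\<^sub>2 h))"
proof -
  obtain \<beta>\<^sub>0 where \<beta>\<^sub>0: "\<alpha> j\<^sub>0 < \<beta>\<^sub>0" "\<beta>\<^sub>0 \<le> 1" "(\<Sum>r\<in>RR. p r * K r powr (- \<beta>\<^sub>0)) < 1"
    by (rule admissible_exponent)
  obtain B\<^sub>1 B\<^sub>2 where B: "0 < B\<^sub>1" "0 < B\<^sub>2" "\<And>k. power_bound \<beta>\<^sub>0 B\<^sub>1 B\<^sub>2 (dens_seq k)"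
    using dens_seq_bnd[OF \<beta>\<^sub>0] by metis
  define M where "M x = (if x \<le> 1/2 then B\<^sub>1 * x powr (\<beta>\<^sub>0 - \<alpha> j\<^sub>0 - 1) else B\<^sub>2 * (x - 1/2) powr (\<beta>\<^sub>0 - 1))" for x
  have M: "dens_seq k x \<le> M x" for k x
    using B densD(3)[OF dens_seq_dens, of x k] by (cases "x \<in> {0<..1}") (auto simp: M_def power_bound_def)
  have "cesaro k x \<in> {0..M x}" for k x
    using densD(4)[OF cesaro_dens] cesaro_le[OF M] by auto
  then obtain G f where G: "G \<noteq> bot" and "\<forall>x. ((\<lambda>u. u x) \<longlongrightarrow> f x) G"
    "\<forall>P. eventually (\<lambda>k. P (cesaro k)) sequentially \<longrightarrow> eventually P G"
    using pointwise_cluster_point[of cesaro M] by blast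
  then have lim: "((\<lambda>u. u x) \<longlongrightarrow> f x) G"
    and ev: "eventually (\<lambda>k. P (cesaro k)) sequentially \<Longrightarrow> eventually P G" for x P
    by blast+
  have dens_f: "cone_density f"
    by (intro dens_pointwise_limit[OF G lim] ev always_eventually allI cesaro_dens)
  have f_le: "f x \<le> m" if "\<And>k. dens_seq k x \<le> m" for x m
    by (rule tendsto_upperbound[OF lim ev G]) (intro always_eventually allI cesaro_le that)
  have f_ge: "m \<le> f x" if "\<And>k. m \<le> dens_seq k x" for x m
    by (rule tendsto_lowerbound[OF lim ev G]) (intro always_eventually allI cesaro_ge that)
  have tr_f: "transfer_op f x = f x" for x
  proof -
    have lim': "((\<lambda>u. transfer_op u x - u x) \<longlongrightarrow> transfer_op f x - f x) G"
      by (intro tendsto_diff lim tr_continuous_pointwise)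
    have le: "\<bar>transfer_op f x - f x\<bar> \<le> e" if "0 < e" for e
    proof (rule tendsto_upperbound[OF tendsto_rabs[OF lim'] _ G], rule ev)
      have "(\<lambda>k. 2 * M x / real (Suc k)) \<longlonglongrightarrow> 0"

        by (rule LIMSEQ_Suc[OF lim_const_over_n])
      then have "\<forall>\<^sub>F k in sequentially. 2 * M x / real (Suc k) < e"
        using that by (rule order_tendstoD)
      then show "\<forall>\<^sub>F k in sequentially. \<bar>transfer_op (cesaro k) x - cesaro k x\<bar> \<le> e"
      proof eventually_elim
        case (elim k)
        have "\<bar>dens_seq (Suc k) x - dens_seq 0 x\<bar> \<le> 2 * M x"
          using M[of "Suc k" x] M[of 0 x] densD(4)[OF dens_seq_dens, of "Suc k" x] densD(4)[OF dens_seq_dens, of 0 x]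
          by linarith
        then have "\<bar>dens_seq (Suc k) x - dens_seq 0 x\<bar> / real (Suc k) \<le> 2 * M x / real (Suc k)"
          by (rule divide_right_mono) simp
        with elim show ?case by (simp only: tr_cesaro abs_divide abs_of_nat)
      qed
    qed
    show ?thesis
    proof (rule ccontr)
      assume "transfer_op f x \<noteq> f x"
      with le[of "\<bar>transfer_op f x - f x\<bar> / 2"] show False by simp
    qed
  qed
  obtain c where c: "0 < c" "\<And>k x. x \<in> {0<..1} \<Longrightarrow> c \<le> dens_seq k x"
    using dens_seq_lower by metis
  have f_c: "c \<le> f x" if "x \<in> {0<..1}" for x by (intro f_ge c(2) that)
  have bnd_f: "power_bound \<beta> A\<^sub>1 A\<^sub>2 f" if "\<And>k. power_bound \<beta> A\<^sub>1 A\<^sub>2 (dens_seq k)" for \<beta> A\<^sub>1 A\<^sub>2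
    using that unfolding power_bound_def by (auto intro!: f_le)
  define J where "J = enn2real (\<integral>\<^sup>+x. ennreal (f x) \<partial>lborel)"
  have "(\<integral>\<^sup>+x. ennreal (f x) \<partial>lborel) < \<infinity>"
    using B by (intro bnd_mass_finite[OF dens_f bnd_f \<beta>\<^sub>0(1)]) (auto intro: less_imp_le)
  then have J: "(\<integral>\<^sup>+x. ennreal (f x) \<partial>lborel) = ennreal J" by (simp add: J_def)
  have "ennreal c = (\<integral>\<^sup>+x. ennreal c * indicator {0<..1::real} x \<partial>lborel)"
    by (simp add: nn_integral_cmult_indicator)
  also have "\<dots> \<le> ennreal J"
    unfolding J[symmetric] using f_c by (intro nn_integral_mono) (auto simp: indicator_def intro!: ennreal_leI)
  finally have J0: "0 < J" using c(1) by (simp add: ennreal_le_iff2)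
  define h where "h x = (1 / J) * f x" for x
  have [measurable]: "f \<in> borel_measurable borel" by (rule dens_measurable[OF dens_f])
  have "(\<integral>\<^sup>+x. ennreal (h x) \<partial>lborel) = ennreal (1 / J) * ennreal J"
  proof -
    have "0 \<le> 1 / J" using J0 by simp
    then have "(\<integral>\<^sup>+x. ennreal (h x) \<partial>lborel) = (\<integral>\<^sup>+x. ennreal (1 / J) * ennreal (f x) \<partial>lborel)"
      by (simp only: h_def ennreal_mult')
    then show ?thesis by (simp add: nn_integral_cmult J)
  qed
  also have "\<dots> = 1" using J0 by (simp add: ennreal_mult[symmetric])
  finally have mass: "(\<integral>\<^sup>+x. ennreal (h x) \<partial>lborel) = 1" .
  show ?thesis
  proof (rule exI[of _ h], rule exI[of _ "c / J"], intro conjI allI ballI impI; (elim conjE)?)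
    show "cone_density h" unfolding cone_density_def h_def
      using decr_cone_scale[OF _ densD(1)[OF dens_f], of "1 / J"]
        decr_cone_scale[OF _ densD(2)[OF dens_f], of "1 / J"] densD(3)[OF dens_f] J0
      by simp
    show "transfer_op h x = h x" for x unfolding h_def[abs_def] tr_scale tr_f by simp
    show "0 < c / J" using c J0 by simp
    show "x \<in> {0<..1} \<Longrightarrow> c / J \<le> h x" for x
      using f_c[of x] J0 by (auto simp: h_def divide_right_mono)
    fix \<beta> assume \<beta>: "\<alpha> j\<^sub>0 < \<beta>" "\<beta> \<le> 1" "(\<Sum>r\<in>RR. p r * K r powr (- \<beta>)) < 1"
    obtain A\<^sub>1 A\<^sub>2 where A: "0 < A\<^sub>1" "0 < A\<^sub>2" "\<And>k. power_bound \<beta> A\<^sub>1 A\<^sub>2 (dens_seq k)"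
      using dens_seq_bnd[OF \<beta>] by metis
    have "power_bound \<beta> (A\<^sub>1 / J) (A\<^sub>2 / J) h"
      using bnd_f[OF A(3)] J0 by (auto simp: power_bound_def h_def divide_right_mono)
    with A J0 show "\<exists>A\<^sub>1>0. \<exists>A\<^sub>2>0. power_bound \<beta> A\<^sub>1 A\<^sub>2 h"
      by (intro exI[of _ "A\<^sub>1 / J"] exI[of _ "A\<^sub>2 / J"] conjI) auto
  qed (rule mass)
qed

end

section \<open>Stationary measures of random maps\<close>

locale stationary_system = prob_space \<mu> for \<mu> :: "real measure" +
  fixes I :: "nat set" and p :: "nat \<Rightarrow> real" and T :: "nat \<Rightarrow> real \<Rightarrow> real"
  assumes fin [simp]: "finite I"
    and p_pos: "j \<in> I \<Longrightarrow> 0 < p j" and p_sum: "(\<Sum>j\<in>I. p j) = 1"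
    and T_measurable [measurable]: "j \<in> I \<Longrightarrow> T j \<in> measurable \<mu> \<mu>"
    and stationary: "A \<in> sets \<mu> \<Longrightarrow>
      (\<Sum>j\<in>I. ennreal (p j) * emeasure \<mu> (T j -` A \<inter> space \<mu>)) = emeasure \<mu> A"
    and invariant_trivial: "A \<in> sets \<mu> \<Longrightarrow> (\<And>j. j \<in> I \<Longrightarrow> AE x in \<mu>. T j x \<in> A \<longleftrightarrow> x \<in> A) \<Longrightarrow>
      emeasure \<mu> A = 0 \<or> emeasure \<mu> (space \<mu> - A) = 0"
begin

lemma stationary_measure:
  assumes "finite_measure \<nu>" "(\<Sum>j\<in>I. ennreal (p j) * emeasure \<nu> (S j)) = emeasure \<nu> A"
  shows "(\<Sum>j\<in>I. p j * measure \<nu> (S j)) = measure \<nu> A"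
proof -
  interpret \<nu>: finite_measure \<nu> by fact
  have "ennreal (\<Sum>j\<in>I. p j * measure \<nu> (S j)) = (\<Sum>j\<in>I. ennreal (p j * measure \<nu> (S j)))"
    using p_pos by (intro sum_ennreal[symmetric]) (simp add: less_imp_le)
  also have "\<dots> = ennreal (measure \<nu> A)"
    unfolding \<nu>.emeasure_eq_measure[symmetric] assms(2)[symmetric] using p_pos
    by (intro sum.cong) (auto simp: \<nu>.emeasure_eq_measure ennreal_mult less_imp_le)
  finally show ?thesis
    using p_pos by (subst (asm) ennreal_inj) (auto intro!: sum_nonneg simp: less_imp_le)
qed

theorem stationary_unique:
  assumes \<nu>: "prob_space \<nu>" "sets \<nu> = sets \<mu>" "absolutely_continuous \<mu> \<nu>"
    and \<nu>_stat: "\<And>A. A \<in> sets \<mu> \<Longrightarrow>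
      (\<Sum>j\<in>I. ennreal (p j) * emeasure \<nu> (T j -` A \<inter> space \<mu>)) = emeasure \<nu> A"
  shows "\<nu> = \<mu>"
proof -
  interpret \<nu>: prob_space \<nu> by fact
  have [simp]: "space \<nu> = space \<mu>" using \<nu>(2) by (rule sets_eq_imp_space_eq)
  note [simp] = \<nu>(2)
  obtain g where g [measurable]: "g \<in> borel_measurable \<mu>" and cone_density: "density \<mu> g = \<nu>"
    using Radon_Nikodym[OF \<nu>(3,2)] by blast
  have em: "emeasure \<nu> E = (\<integral>\<^sup>+x. g x * indicator E x \<partial>\<mu>)" if "E \<in> sets \<mu>" for E
    unfolding cone_density[symmetric] using that by (intro emeasure_density) auto
  \<comment> \<open>\<open>A\<close> maximizes \<open>\<nu> - \<mu>\<close>; as \<open>\<nu> - \<mu>\<close> is stationary, so does each preimage of \<open>A\<close>.\<close>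
  define A where "A = {x \<in> space \<mu>. 1 < g x}"
  have A [measurable]: "A \<in> sets \<mu>" by (simp add: A_def)
  let ?M = "measure \<mu>" and ?V = "measure \<nu>"
  have le: "?V E \<le> ?M E" if E: "E \<in> sets \<mu>" "E \<inter> A = {}" for E
  proof -
    have "emeasure \<nu> E \<le> (\<integral>\<^sup>+x. indicator E x \<partial>\<mu>)"
      unfolding em[OF E(1)] using E sets.sets_into_space[OF E(1)]
      by (intro nn_integral_mono) (auto simp: indicator_def A_def not_less)
    then show ?thesis using E(1) by (simp add: emeasure_eq_measure \<nu>.emeasure_eq_measure)
  qed
  have ge: "?M E \<le> ?V E" if E: "E \<in> sets \<mu>" "E \<subseteq> A" for E
  proof -
    have "(\<integral>\<^sup>+x. indicator E x \<partial>\<mu>) \<le> emeasure \<nu> E"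
      unfolding em[OF E(1)] using E
      by (intro nn_integral_mono) (auto simp: indicator_def A_def)
    then show ?thesis using E(1) by (simp add: emeasure_eq_measure \<nu>.emeasure_eq_measure)
  qed
  have null: "?M E = 0" if E: "E \<in> sets \<mu>" "E \<subseteq> A" "?V E \<le> ?M E" for E
  proof -
    note [measurable] = E(1)
    have "emeasure \<nu> E = (\<integral>\<^sup>+x. indicator E x + (g x - 1) * indicator E x \<partial>\<mu>)"
      unfolding em[OF E(1)] using E(2) by (intro nn_integral_cong)
        (auto simp: indicator_def A_def add_diff_inverse_ennreal less_imp_le)
    also have "\<dots> = emeasure \<mu> E + (\<integral>\<^sup>+x. (g x - 1) * indicator E x \<partial>\<mu>)"
      by (subst nn_integral_add) auto
    finally have eq: "emeasure \<nu> E = emeasure \<mu> E + (\<integral>\<^sup>+x. (g x - 1) * indicator E x \<partial>\<mu>)" .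
    have "emeasure \<mu> E + (\<integral>\<^sup>+x. (g x - 1) * indicator E x \<partial>\<mu>) \<le> emeasure \<mu> E + 0"
      unfolding eq[symmetric] using E(3)
      by (simp add: emeasure_eq_measure \<nu>.emeasure_eq_measure ennreal_leI)
    then have "(\<integral>\<^sup>+x. (g x - 1) * indicator E x \<partial>\<mu>) = 0"
      by (subst (asm) ennreal_add_left_cancel_le) auto
    then have "AE x in \<mu>. (g x - 1) * indicator E x = 0"
      by (subst (asm) nn_integral_0_iff_AE) auto
    then have "AE x in \<mu>. x \<notin> E"
    proof eventually_elim
      case (elim x)
      then show ?case using E(2) by (auto simp: indicator_def A_def diff_eq_0_iff_ennreal)
    qed
    then have "emeasure \<mu> E = 0" using AE_iff_null_sets[OF E(1)] by auto
    then show ?thesis by (simp add: measure_def)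
  qed
  have M_split: "?M E = ?M (E \<inter> B) + ?M (E - B)" and V_split: "?V E = ?V (E \<inter> B) + ?V (E - B)"
    if "E \<in> sets \<mu>" "B \<in> sets \<mu>" for E B
    using that finite_measure_Union[of "E \<inter> B" "E - B"] \<nu>.finite_measure_Union[of "E \<inter> B" "E - B"]
    by (auto simp: Int_Diff_Un)
  define S where "S j = T j -` A \<inter> space \<mu>" for j
  have S [measurable]: "S j \<in> sets \<mu>" if "j \<in> I" for j
    unfolding S_def using that by measurable
  define D where "D j = (?V (A - S j) - ?M (A - S j)) + (?M (S j - A) - ?V (S j - A))" for j
  have D: "D j = (?V A - ?M A) - (?V (S j) - ?M (S j))" if "j \<in> I" for j
    using that M_split[of A "S j"] V_split[of A "S j"] M_split[of "S j" A] V_split[of "S j" A]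
    by (simp add: D_def Int_commute)
  have D_nonneg: "0 \<le> ?V (A - S j) - ?M (A - S j)" "0 \<le> ?M (S j - A) - ?V (S j - A)" if "j \<in> I" for j
    using that ge[of "A - S j"] le[of "S j - A"] by auto
  have statM: "(\<Sum>j\<in>I. p j * ?M (S j)) = ?M A"
    unfolding S_def by (rule stationary_measure[OF _ stationary[OF A]]) unfold_locales
  have statV: "(\<Sum>j\<in>I. p j * ?V (S j)) = ?V A"
    unfolding S_def by (rule stationary_measure[OF _ \<nu>_stat[OF A]]) unfold_locales
  have "(\<Sum>j\<in>I. p j * D j) = (\<Sum>j\<in>I. p j * (?V A - ?M A) - p j * ?V (S j) + p j * ?M (S j))"
    by (intro sum.cong) (auto simp: D algebra_simps)
  also have "\<dots> = 0"
    by (simp add: sum.distrib sum_subtractf statM statV p_sum flip: sum_distrib_right)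
  finally have "\<forall>j\<in>I. p j * D j = 0"
    using D_nonneg p_pos by (subst (asm) sum_nonneg_eq_0_iff) (auto simp: D_def less_imp_le intro!: mult_nonneg_nonneg add_nonneg_nonneg)
  then have D0: "D j = 0" if "j \<in> I" for j using p_pos that by fastforce
  have AS: "?M (A - S j) = 0" if "j \<in> I" for j
  proof (rule null)
    show "?V (A - S j) \<le> ?M (A - S j)"
      using D_nonneg[OF that] D0[OF that] unfolding D_def by linarith
  qed (use that in auto)
  have "?M (S j - A) = ?M (S j) - ?M A" if "j \<in> I" for j
    using M_split[OF A S[OF that]] M_split[OF S[OF that] A] AS[OF that] by (simp add: Int_commute)
  then have "(\<Sum>j\<in>I. p j * ?M (S j - A)) = (\<Sum>j\<in>I. p j * ?M (S j) - p j * ?M A)"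
    by (intro sum.cong) (simp_all add: right_diff_distrib)
  also have "\<dots> = 0" by (simp add: sum_subtractf statM p_sum flip: sum_distrib_right)
  finally have "\<forall>j\<in>I. p j * ?M (S j - A) = 0"
    using p_pos by (subst (asm) sum_nonneg_eq_0_iff) (auto simp: less_imp_le)
  then have SA: "?M (S j - A) = 0" if "j \<in> I" for j using p_pos that by fastforce
  have "AE x in \<mu>. T j x \<in> A \<longleftrightarrow> x \<in> A" if j: "j \<in> I" for j
  proof -
    have "AE x in \<mu>. x \<notin> A - S j"
      using AS[OF j] j by (intro AE_not_in null_setsI) (auto simp: emeasure_eq_measure)
    moreover have "AE x in \<mu>. x \<notin> S j - A"
      using SA[OF j] j by (intro AE_not_in null_setsI) (auto simp: emeasure_eq_measure)
    ultimately show ?thesis using AE_space by eventually_elim (auto simp: S_def)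
  qed
  then have "emeasure \<mu> A = 0 \<or> emeasure \<mu> (space \<mu> - A) = 0"
    by (intro invariant_trivial) auto
  then have MA: "?M A = 0"
  proof
    assume "emeasure \<mu> (space \<mu> - A) = 0"
    then have "?M (space \<mu> - A) = 0" by (simp add: measure_def)
    moreover have "(space \<mu> - A) \<inter> A = {}" by auto
    with calculation le[of "space \<mu> - A"] have "?V (space \<mu> - A) = 0"
      by (simp add: measure_le_0_iff)
    ultimately have "?M A = 1" "?V A = 1"
      using prob_compl[OF A] \<nu>.prob_compl[of A] by auto
    then show ?thesis by (intro null) auto
  qed (simp add: measure_def)
  then have "A \<in> null_sets \<mu>" by (auto simp: emeasure_eq_measure)
  then have "A \<in> null_sets \<nu>" using \<nu>(3) by (auto simp: absolutely_continuous_def)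
  then have VA: "?V A = 0" by (simp add: measure_def null_setsD1)
  have V_le: "?V E \<le> ?M E" if E [measurable]: "E \<in> sets \<mu>" for E
  proof -
    have "?V (E \<inter> A) \<le> ?V A" by (intro \<nu>.finite_measure_mono) auto
    with VA V_split[OF E A] M_split[OF E A] le[of "E - A"] show ?thesis
      by (smt (verit) Diff_disjoint E A inf_commute measure_nonneg sets.Diff)
  qed
  show ?thesis
  proof (rule measure_eqI)
    fix E assume "E \<in> sets \<nu>"
    then have E [measurable]: "E \<in> sets \<mu>" by simp
    have "?V (space \<mu> - E) \<le> ?M (space \<mu> - E)" by (intro V_le) auto
    then have "?M E \<le> ?V E" using prob_compl[OF E] \<nu>.prob_compl[of E] by simp
    with V_le[OF E] show "emeasure \<nu> E = emeasure \<mu> E"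
      by (simp add: emeasure_eq_measure \<nu>.emeasure_eq_measure)
  qed simp
qed

subsection \<open>Ergodicity of the skew product\<close>

abbreviation "PM \<equiv> point_measure I (\<lambda>j. ennreal (p j))"
abbreviation "Bern \<equiv> bernoulli_measure I p"

lemma sum_p_ennreal: "(\<Sum>j\<in>I. ennreal (p j)) = 1"
  using sum_ennreal[of I p] p_pos p_sum by (simp add: less_imp_le)

sublocale PM: prob_space PM
  by (rule prob_spaceI) (simp add: space_point_measure emeasure_point_measure_finite sum_p_ennreal)

sublocale seq: sequence_space PM ..

lemma Bern_eq: "Bern = (\<Pi>\<^sub>M n\<in>UNIV. PM)"
  by (simp add: bernoulli_measure_def)

sublocale Bern: prob_space Bern
  unfolding Bern_eq by (rule seq.P.prob_space_axioms)

sublocale prod: pair_prob_space Bern \<mu> ..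

lemma space_Bern: "space Bern = {\<omega>. \<forall>i. \<omega> i \<in> I}"
  by (auto simp: Bern_eq space_PiM space_point_measure PiE_UNIV_domain)

lemma coord_PM: "(\<lambda>\<omega>. \<omega> i) \<in> measurable Bern PM"
  unfolding Bern_eq by measurable

lemma coord_measurable [measurable]: "(\<lambda>\<omega>. \<omega> i) \<in> measurable Bern (count_space I)"
proof -
  have "measurable Bern PM = measurable Bern (count_space I)"
    by (intro measurable_cong_sets) (simp_all add: sets_point_measure)
  then show ?thesis using coord_PM by simp
qed

lemma Bern_measurableI:
  assumes "\<And>i. (\<lambda>\<omega>. f \<omega> i) \<in> measurable M PM"
  shows "f \<in> measurable M Bern"
  unfolding Bern_eq
proof (rule measurable_PiM_single'[where f="\<lambda>i \<omega>. f \<omega> i", OF assms])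
  show "(\<lambda>\<omega> i. f \<omega> i) \<in> space M \<rightarrow> (\<Pi>\<^sub>E i\<in>UNIV. space PM)"
  proof
    fix \<omega> assume "\<omega> \<in> space M"
    then have "f \<omega> i \<in> space PM" for i by (rule measurable_space[OF assms])
    then show "f \<omega> \<in> (\<Pi>\<^sub>E i\<in>UNIV. space PM)" by (simp only: PiE_UNIV_domain) blast
  qed
qed

lemma shift_measurable [measurable]: "(\<lambda>\<omega> n. \<omega> (Suc n)) \<in> measurable Bern Bern"
  by (intro Bern_measurableI coord_PM)

lemma cons_measurable: "j \<in> I \<Longrightarrow> (\<lambda>\<omega>. case_nat j \<omega>) \<in> measurable Bern Bern"
proof (intro Bern_measurableI)
  fix i assume "j \<in> I"
  then show "(\<lambda>\<omega>. case i of 0 \<Rightarrow> j | Suc n \<Rightarrow> \<omega> n) \<in> measurable Bern PM"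
    by (cases i) (simp_all add: space_point_measure coord_PM)
qed

lemma skew_measurable:
  "skew_product T \<in> measurable (Bern \<Otimes>\<^sub>M \<mu>) (Bern \<Otimes>\<^sub>M \<mu>)"
proof -
  have "(\<lambda>z. T (fst z 0) (snd z)) \<in> measurable (Bern \<Otimes>\<^sub>M \<mu>) \<mu>"
  proof (rule measurable_compose_countable'[where I=I and f="\<lambda>j z. T j (snd z)" and g="\<lambda>z. fst z 0"])
    show "(\<lambda>z. fst z 0) \<in> measurable (Bern \<Otimes>\<^sub>M \<mu>) (count_space I)"
      using measurable_compose[OF measurable_fst coord_measurable[of 0]] by simp
  qed (auto simp: countable_finite)
  moreover have "(\<lambda>z. (\<lambda>n. fst z (Suc n))) \<in> measurable (Bern \<Otimes>\<^sub>M \<mu>) Bern"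
    using measurable_compose[OF measurable_fst shift_measurable] by simp
  ultimately have "(\<lambda>z. (\<lambda>n. fst z (Suc n), T (fst z 0) (snd z))) \<in> measurable (Bern \<Otimes>\<^sub>M \<mu>) (Bern \<Otimes>\<^sub>M \<mu>)"
    by (rule measurable_Pair[rotated])
  then show ?thesis by (simp add: skew_product_def case_prod_beta')
qed

lemma nn_integral_Bern:
  assumes [measurable]: "g \<in> borel_measurable Bern"
  shows "(\<integral>\<^sup>+\<omega>. g \<omega> \<partial>Bern) = (\<Sum>j\<in>I. ennreal (p j) * (\<integral>\<^sup>+\<omega>. g (case_nat j \<omega>) \<partial>Bern))"
proof -
  have m: "(\<lambda>(s, \<omega>). case_nat s \<omega>) \<in> measurable (PM \<Otimes>\<^sub>M Bern) Bern"
    unfolding Bern_eq by measurable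
  have g: "(\<lambda>z. g (case_nat (fst z) (snd z))) \<in> borel_measurable (PM \<Otimes>\<^sub>M Bern)"
    using measurable_compose[OF m assms] by (simp add: case_prod_beta')
  have "(\<integral>\<^sup>+\<omega>. g \<omega> \<partial>Bern) = (\<integral>\<^sup>+\<omega>. g \<omega> \<partial>distr (PM \<Otimes>\<^sub>M Bern) Bern (\<lambda>(s, \<omega>). case_nat s \<omega>))"
    using seq.PiM_iter unfolding Bern_eq by simp
  also have "\<dots> = (\<integral>\<^sup>+z. g (case_nat (fst z) (snd z)) \<partial>(PM \<Otimes>\<^sub>M Bern))"
    by (subst nn_integral_distr[OF m]) (auto simp: case_prod_beta')
  also have "\<dots> = (\<integral>\<^sup>+j. \<integral>\<^sup>+\<omega>. g (case_nat j \<omega>) \<partial>Bern \<partial>PM)"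
    using Bern.nn_integral_fst[OF g] by simp
  also have "\<dots> = (\<Sum>j\<in>I. ennreal (p j) * (\<integral>\<^sup>+\<omega>. g (case_nat j \<omega>) \<partial>Bern))"
    by (rule nn_integral_point_measure_finite[OF fin])
  finally show ?thesis .
qed

lemma nn_integral_stationary:
  assumes g [measurable]: "g \<in> borel_measurable \<mu>"
  shows "(\<Sum>j\<in>I. ennreal (p j) * (\<integral>\<^sup>+x. g (T j x) \<partial>\<mu>)) = (\<integral>\<^sup>+x. g x \<partial>\<mu>)"
  using g
proof (induction rule: borel_measurable_induct)
  case (cong f g)
  have "(\<integral>\<^sup>+x. f (T j x) \<partial>\<mu>) = (\<integral>\<^sup>+x. g (T j x) \<partial>\<mu>)" if "j \<in> I" for j
    using cong(3) measurable_space[OF T_measurable[OF that]] by (intro nn_integral_cong) auto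
  moreover have "(\<integral>\<^sup>+x. f x \<partial>\<mu>) = (\<integral>\<^sup>+x. g x \<partial>\<mu>)" by (intro nn_integral_cong cong(3))
  ultimately show ?case using cong(4) by simp
next
  case (set A)
  have "(\<integral>\<^sup>+x. indicator A (T j x) \<partial>\<mu>) = emeasure \<mu> (T j -` A \<inter> space \<mu>)" if "j \<in> I" for j
  proof -
    have "(\<integral>\<^sup>+x. indicator A (T j x) \<partial>\<mu>) = (\<integral>\<^sup>+x. indicator (T j -` A \<inter> space \<mu>) x \<partial>\<mu>)"
      by (intro nn_integral_cong) (auto simp: indicator_def)
    then show ?thesis
      using measurable_sets[OF T_measurable[OF that] set] by (simp only: nn_integral_indicator)
  qed
  with stationary[OF set] set show ?case by simp
next
  case (mult u v)
  then show ?case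
    by (simp add: nn_integral_cmult sum_distrib_left mult_ac flip: mult.IH)
next
  case (add u v)
  then show ?case
    by (simp add: nn_integral_add distrib_left sum.distrib)
next
  case (seq U)
  have inc: "incseq (\<lambda>i x. U i (T j x))" for j
    using seq(3) by (auto simp: incseq_def le_fun_def)
  have inc': "incseq (\<lambda>i. ennreal (p j) * (\<integral>\<^sup>+x. U i (T j x) \<partial>\<mu>))" for j
    using seq(3) by (auto simp: incseq_def le_fun_def intro!: mult_left_mono nn_integral_mono)
  have "(\<integral>\<^sup>+x. (SUP i. U i (T j x)) \<partial>\<mu>) = (SUP i. \<integral>\<^sup>+x. U i (T j x) \<partial>\<mu>)" if "j \<in> I" for j
    using seq(1) that inc by (intro nn_integral_monotone_convergence_SUP) auto
  then have "(\<Sum>j\<in>I. ennreal (p j) * (\<integral>\<^sup>+x. (SUP i. U i (T j x)) \<partial>\<mu>))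
      = (\<Sum>j\<in>I. SUP i. ennreal (p j) * (\<integral>\<^sup>+x. U i (T j x) \<partial>\<mu>))"
    by (intro sum.cong) (auto simp: SUP_mult_left_ennreal)
  also have "\<dots> = (SUP i. \<Sum>j\<in>I. ennreal (p j) * (\<integral>\<^sup>+x. U i (T j x) \<partial>\<mu>))"
    by (rule ennreal_SUP_sum[symmetric]) (rule inc')
  also have "\<dots> = (SUP i. \<integral>\<^sup>+x. U i x \<partial>\<mu>)" by (simp add: seq.IH)
  also have "\<dots> = (\<integral>\<^sup>+x. (SUP i. U i x) \<partial>\<mu>)"
    using seq(1,3) by (intro nn_integral_monotone_convergence_SUP[symmetric]) auto
  moreover have "(SUP i. U i) = (\<lambda>x. SUP i. U i x)" by (auto simp: fun_eq_iff image_comp)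
  ultimately show ?case by simp
qed

lemma section_measurable:
  assumes "B \<in> sets (Bern \<Otimes>\<^sub>M \<mu>)" "x \<in> space \<mu>"
  shows "{\<omega> \<in> space Bern. (\<omega>, x) \<in> B} \<in> sets Bern"
proof -
  have "{\<omega> \<in> space Bern. (\<omega>, x) \<in> B} = (\<lambda>\<omega>. (\<omega>, x)) -` B \<inter> space Bern" by auto
  then show ?thesis using measurable_sets[OF measurable_Pair2'[OF assms(2)] assms(1)] by simp
qed

lemma emeasure_section_measurable:
  assumes B: "B \<in> sets (Bern \<Otimes>\<^sub>M \<mu>)"
  shows "(\<lambda>x. emeasure Bern {\<omega> \<in> space Bern. (\<omega>, x) \<in> B}) \<in> borel_measurable \<mu>"
proof -
  have "{\<omega> \<in> space Bern. (\<omega>, x) \<in> B} = (\<lambda>\<omega>. (\<omega>, x)) -` B" for x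
    using sets.sets_into_space[OF B] by (auto simp: space_pair_measure)
  then show ?thesis using prod.measurable_emeasure_Pair2[OF B] by simp
qed

lemma emeasure_product_sections:
  assumes B: "B \<in> sets (Bern \<Otimes>\<^sub>M \<mu>)"
  shows "emeasure (Bern \<Otimes>\<^sub>M \<mu>) B = (\<integral>\<^sup>+x. emeasure Bern {\<omega> \<in> space Bern. (\<omega>, x) \<in> B} \<partial>\<mu>)"
proof -
  have "emeasure (Bern \<Otimes>\<^sub>M \<mu>) B = (\<integral>\<^sup>+x. \<integral>\<^sup>+\<omega>. indicator B (\<omega>, x) \<partial>Bern \<partial>\<mu>)"
    using prod.nn_integral_snd[of "indicator B"] B by simp
  also have "\<dots> = (\<integral>\<^sup>+x. emeasure Bern {\<omega> \<in> space Bern. (\<omega>, x) \<in> B} \<partial>\<mu>)"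
  proof (rule nn_integral_cong)
    fix x assume x: "x \<in> space \<mu>"
    have "(\<integral>\<^sup>+\<omega>. indicator B (\<omega>, x) \<partial>Bern) = (\<integral>\<^sup>+\<omega>. indicator {\<omega> \<in> space Bern. (\<omega>, x) \<in> B} \<omega> \<partial>Bern)"
      by (intro nn_integral_cong) (auto simp: indicator_def)
    then show "(\<integral>\<^sup>+\<omega>. indicator B (\<omega>, x) \<partial>Bern) = emeasure Bern {\<omega> \<in> space Bern. (\<omega>, x) \<in> B}"
      using section_measurable[OF B x] by simp
  qed
  finally show ?thesis .
qed

lemma section_preimage:
  fixes E :: "nat set"
  assumes B: "B \<in> sets (Bern \<Otimes>\<^sub>M \<mu>)" and Z: "Z \<in> sets Bern" and x: "x \<in> space \<mu>"
  defines "S \<equiv> {\<omega> \<in> space Bern. \<omega> 0 \<in> E \<and> (\<lambda>n. \<omega> (Suc n)) \<in> Z \<and> skew_product T (\<omega>, x) \<in> B}"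
  shows "emeasure Bern S
    = (\<Sum>j\<in>I. ennreal (p j) * (indicator E j * emeasure Bern {\<omega> \<in> space Bern. \<omega> \<in> Z \<and> (\<omega>, T j x) \<in> B}))"
proof -
  have "S = ((\<lambda>\<omega>. \<omega> 0) -` (E \<inter> I) \<inter> space Bern) \<inter> ((\<lambda>\<omega> n. \<omega> (Suc n)) -` Z \<inter> space Bern)
      \<inter> {\<omega> \<in> space Bern. (\<omega>, x) \<in> skew_product T -` B \<inter> space (Bern \<Otimes>\<^sub>M \<mu>)}"
    using x by (auto simp: S_def space_pair_measure space_Bern)
  also have "\<dots> \<in> sets Bern"
    by (rule sets.Int[OF sets.Int[OF measurable_sets[OF coord_measurable] measurable_sets[OF shift_measurable Z]]
      section_measurable[OF measurable_sets[OF skew_measurable B] x]]) simp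
  finally have S: "S \<in> sets Bern" .
  have "emeasure Bern S = (\<integral>\<^sup>+\<omega>. indicator S \<omega> \<partial>Bern)" using S by simp
  also have "\<dots> = (\<Sum>j\<in>I. ennreal (p j) * (\<integral>\<^sup>+\<omega>. indicator S (case_nat j \<omega>) \<partial>Bern))"
    using S by (intro nn_integral_Bern) simp
  also have "\<dots> = (\<Sum>j\<in>I. ennreal (p j) * (indicator E j * emeasure Bern {\<omega> \<in> space Bern. \<omega> \<in> Z \<and> (\<omega>, T j x) \<in> B}))"
  proof (intro sum.cong refl arg_cong2[where f="(*)"])
    fix j assume j: "j \<in> I"
    define R where "R = {\<omega> \<in> space Bern. \<omega> \<in> Z \<and> (\<omega>, T j x) \<in> B}"
    have "R = {\<omega> \<in> space Bern. (\<omega>, T j x) \<in> B} \<inter> Z" using sets.sets_into_space[OF Z] by (auto simp: R_def)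
    then have R: "R \<in> sets Bern"
      using section_measurable[OF B measurable_space[OF T_measurable[OF j] x]] Z by simp
    have "indicator S (case_nat j \<omega>) = (indicator E j * indicator R \<omega> :: ennreal)" if "\<omega> \<in> space Bern" for \<omega>
    proof -
      have "case_nat j \<omega> \<in> space Bern" using measurable_space[OF cons_measurable[OF j] that] .
      then show ?thesis using that by (auto simp: S_def R_def indicator_def skew_product_def)
    qed
    then have "(\<integral>\<^sup>+\<omega>. indicator S (case_nat j \<omega>) \<partial>Bern) = (\<integral>\<^sup>+\<omega>. indicator E j * indicator R \<omega> \<partial>Bern)"
      by (intro nn_integral_cong) auto
    also have "\<dots> = indicator E j * emeasure Bern R" using R by (rule nn_integral_cmult_indicator)
    finally show "(\<integral>\<^sup>+\<omega>. indicator S (case_nat j \<omega>) \<partial>Bern) = indicator E j * emeasure Bern R" .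
  qed
  finally show ?thesis .
qed

lemma skew_measure_preserving: "measure_preserving_map (Bern \<Otimes>\<^sub>M \<mu>) (skew_product T)"
  unfolding measure_preserving_map_def
proof (intro conjI skew_measurable measure_eqI)
  fix B assume "B \<in> sets (distr (Bern \<Otimes>\<^sub>M \<mu>) (Bern \<Otimes>\<^sub>M \<mu>) (skew_product T))"
  then have B: "B \<in> sets (Bern \<Otimes>\<^sub>M \<mu>)" by simp
  define \<phi> where "\<phi> x = emeasure Bern {\<omega> \<in> space Bern. (\<omega>, x) \<in> B}" for x
  have \<phi> [measurable]: "\<phi> \<in> borel_measurable \<mu>"
    unfolding \<phi>_def[abs_def] by (rule emeasure_section_measurable[OF B])
  let ?B = "skew_product T -` B \<inter> space (Bern \<Otimes>\<^sub>M \<mu>)"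
  have B': "?B \<in> sets (Bern \<Otimes>\<^sub>M \<mu>)" by (rule measurable_sets[OF skew_measurable B])
  have "emeasure (distr (Bern \<Otimes>\<^sub>M \<mu>) (Bern \<Otimes>\<^sub>M \<mu>) (skew_product T)) B = emeasure (Bern \<Otimes>\<^sub>M \<mu>) ?B"
    by (rule emeasure_distr[OF skew_measurable B])
  also have "\<dots> = (\<integral>\<^sup>+x. emeasure Bern {\<omega> \<in> space Bern. (\<omega>, x) \<in> ?B} \<partial>\<mu>)"
    by (rule emeasure_product_sections[OF B'])
  also have "\<dots> = (\<integral>\<^sup>+x. (\<Sum>j\<in>I. ennreal (p j) * \<phi> (T j x)) \<partial>\<mu>)"
  proof (rule nn_integral_cong)
    fix x assume x: "x \<in> space \<mu>"
    have "{\<omega> \<in> space Bern. (\<omega>, x) \<in> ?B} = {\<omega> \<in> space Bern. \<omega> 0 \<in> UNIV \<and> (\<lambda>n. \<omega> (Suc n)) \<in> space Bern \<and> skew_product T (\<omega>, x) \<in> B}"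
      using x by (auto simp: space_pair_measure space_Bern)
    then show "emeasure Bern {\<omega> \<in> space Bern. (\<omega>, x) \<in> ?B} = (\<Sum>j\<in>I. ennreal (p j) * \<phi> (T j x))"
      using section_preimage[OF B sets.top x, of UNIV] by (simp add: \<phi>_def)
  qed
  also have "\<dots> = (\<Sum>j\<in>I. ennreal (p j) * (\<integral>\<^sup>+x. \<phi> (T j x) \<partial>\<mu>))"
    by (simp add: nn_integral_sum nn_integral_cmult)
  also have "\<dots> = (\<integral>\<^sup>+x. \<phi> x \<partial>\<mu>)" by (rule nn_integral_stationary[OF \<phi>])
  also have "\<dots> = emeasure (Bern \<Otimes>\<^sub>M \<mu>) B" by (simp add: emeasure_product_sections[OF B] \<phi>_def)
  finally show "emeasure (distr (Bern \<Otimes>\<^sub>M \<mu>) (Bern \<Otimes>\<^sub>M \<mu>) (skew_product T)) B = emeasure (Bern \<Otimes>\<^sub>M \<mu>) B" .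
qed simp


lemma harmonic_const:
  fixes \<phi> :: "real \<Rightarrow> real"
  assumes \<phi> [measurable]: "\<phi> \<in> borel_measurable \<mu>"
    and bounds: "\<And>x. x \<in> space \<mu> \<Longrightarrow> 0 \<le> \<phi> x \<and> \<phi> x \<le> 1"
    and harm: "\<And>x. x \<in> space \<mu> \<Longrightarrow> (\<Sum>j\<in>I. p j * \<phi> (T j x)) = \<phi> x"
  shows "AE x in \<mu>. \<phi> x = expectation \<phi>"
proof -
  define D where "D x = (\<Sum>j\<in>I. p j * (\<phi> (T j x) - \<phi> x)\<^sup>2)" for x
  have T_space: "T j x \<in> space \<mu>" if "j \<in> I" "x \<in> space \<mu>" for j x
    using measurable_space[OF T_measurable[OF that(1)] that(2)] .
  have D0: "0 \<le> D x" for x unfolding D_def using p_pos by (intro sum_nonneg) (auto simp: less_imp_le)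
  have [measurable]: "D \<in> borel_measurable \<mu>" unfolding D_def[abs_def] by measurable
  have D: "D x + (\<phi> x)\<^sup>2 = (\<Sum>j\<in>I. p j * (\<phi> (T j x))\<^sup>2)" if "x \<in> space \<mu>" for x
  proof -
    have "D x = (\<Sum>j\<in>I. p j * (\<phi> (T j x))\<^sup>2 - 2 * \<phi> x * (p j * \<phi> (T j x)) + p j * (\<phi> x)\<^sup>2)"
      unfolding D_def by (intro sum.cong) (auto simp: power2_eq_square algebra_simps)
    also have "\<dots> = (\<Sum>j\<in>I. p j * (\<phi> (T j x))\<^sup>2) - 2 * \<phi> x * \<phi> x + (\<phi> x)\<^sup>2"
      by (simp add: sum.distrib sum_subtractf harm[OF that] p_sum flip: sum_distrib_left sum_distrib_right)
    finally show ?thesis by (simp add: power2_eq_square)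
  qed
  have "(\<integral>\<^sup>+x. ennreal (D x) \<partial>\<mu>) + (\<integral>\<^sup>+x. ennreal ((\<phi> x)\<^sup>2) \<partial>\<mu>) = (\<integral>\<^sup>+x. ennreal (D x + (\<phi> x)\<^sup>2) \<partial>\<mu>)"
    using D0 by (subst nn_integral_add[symmetric]) auto
  also have "\<dots> = (\<integral>\<^sup>+x. (\<Sum>j\<in>I. ennreal (p j) * ennreal ((\<phi> (T j x))\<^sup>2)) \<partial>\<mu>)"
  proof (rule nn_integral_cong)
    fix x assume x: "x \<in> space \<mu>"
    have "ennreal (\<Sum>j\<in>I. p j * (\<phi> (T j x))\<^sup>2) = (\<Sum>j\<in>I. ennreal (p j * (\<phi> (T j x))\<^sup>2))"
      using p_pos by (intro sum_ennreal[symmetric]) (auto simp: less_imp_le)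
    also have "\<dots> = (\<Sum>j\<in>I. ennreal (p j) * ennreal ((\<phi> (T j x))\<^sup>2))"
      using p_pos by (intro sum.cong refl ennreal_mult) (auto simp: less_imp_le)
    finally show "ennreal (D x + (\<phi> x)\<^sup>2) = (\<Sum>j\<in>I. ennreal (p j) * ennreal ((\<phi> (T j x))\<^sup>2))"
      by (simp only: D[OF x])
  qed
  also have "\<dots> = (\<Sum>j\<in>I. ennreal (p j) * (\<integral>\<^sup>+x. ennreal ((\<phi> (T j x))\<^sup>2) \<partial>\<mu>))"
    by (simp add: nn_integral_sum nn_integral_cmult)
  also have "\<dots> = (\<integral>\<^sup>+x. ennreal ((\<phi> x)\<^sup>2) \<partial>\<mu>)"
    by (rule nn_integral_stationary) measurable
  finally have eq: "(\<integral>\<^sup>+x. ennreal (D x) \<partial>\<mu>) + (\<integral>\<^sup>+x. ennreal ((\<phi> x)\<^sup>2) \<partial>\<mu>) = (\<integral>\<^sup>+x. ennreal ((\<phi> x)\<^sup>2) \<partial>\<mu>)" .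
  have "(\<integral>\<^sup>+x. ennreal ((\<phi> x)\<^sup>2) \<partial>\<mu>) \<le> (\<integral>\<^sup>+x. 1 \<partial>\<mu>)"
    using bounds by (intro nn_integral_mono) (auto simp: power_le_one)
  then have fin: "(\<integral>\<^sup>+x. ennreal ((\<phi> x)\<^sup>2) \<partial>\<mu>) \<noteq> top"
    by (auto simp: emeasure_space_1 top_unique)
  have "(\<integral>\<^sup>+x. ennreal ((\<phi> x)\<^sup>2) \<partial>\<mu>) + (\<integral>\<^sup>+x. ennreal (D x) \<partial>\<mu>) \<le> (\<integral>\<^sup>+x. ennreal ((\<phi> x)\<^sup>2) \<partial>\<mu>) + 0"
    using eq by (simp add: add.commute)
  then have "(\<integral>\<^sup>+x. ennreal (D x) \<partial>\<mu>) = 0"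
    using fin unfolding ennreal_add_left_cancel_le by auto
  then have "AE x in \<mu>. ennreal (D x) = 0"
    by (subst (asm) nn_integral_0_iff_AE) auto
  then have inv: "AE x in \<mu>. \<forall>j\<in>I. \<phi> (T j x) = \<phi> x"
  proof eventually_elim
    case (elim x)
    then have "D x = 0" using D0[of x] by (simp add: ennreal_eq_0_iff)
    then have "\<forall>j\<in>I. p j * (\<phi> (T j x) - \<phi> x)\<^sup>2 = 0"
      unfolding D_def using p_pos by (subst (asm) sum_nonneg_eq_0_iff) (auto simp: less_imp_le)
    then show ?case using p_pos by fastforce
  qed
  define c where "c = expectation \<phi>"
  have int: "integrable \<mu> \<phi>"
    using bounds by (intro integrable_const_bound[of _ 1]) auto
  have not_gt: "\<not> (AE x in \<mu>. c < \<phi> x)"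
  proof
    assume "AE x in \<mu>. c < \<phi> x"
    then have "expectation (\<lambda>_. c) < expectation \<phi>"
      using int by (intro integral_less_AE_space) (auto simp: emeasure_space_1)
    then show False by (simp add: c_def prob_space)
  qed
  have not_lt: "\<not> (AE x in \<mu>. \<phi> x < c)"
  proof
    assume "AE x in \<mu>. \<phi> x < c"
    then have "expectation \<phi> < expectation (\<lambda>_. c)"
      using int by (intro integral_less_AE_space) (auto simp: emeasure_space_1)
    then show False by (simp add: c_def prob_space)
  qed
  have level: "(AE x in \<mu>. \<not> P (\<phi> x)) \<or> (AE x in \<mu>. P (\<phi> x))"
    if [measurable]: "Measurable.pred borel P" for P :: "real \<Rightarrow> bool"
  proof -
    let ?A = "{x \<in> space \<mu>. P (\<phi> x)}"
    have A: "?A \<in> sets \<mu>" by measurable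
    have "AE x in \<mu>. T j x \<in> ?A \<longleftrightarrow> x \<in> ?A" if "j \<in> I" for j
      using inv AE_space by eventually_elim (use that T_space in auto)
    then have "emeasure \<mu> ?A = 0 \<or> emeasure \<mu> (space \<mu> - ?A) = 0"
      by (rule invariant_trivial[OF A])
    then show ?thesis
    proof
      assume "emeasure \<mu> ?A = 0"
      then have "AE x in \<mu>. x \<notin> ?A" using A by (intro AE_not_in null_setsI) auto
      then have "AE x in \<mu>. \<not> P (\<phi> x)" using AE_space by eventually_elim auto
      then show ?thesis ..
    next
      assume "emeasure \<mu> (space \<mu> - ?A) = 0"
      then have "AE x in \<mu>. x \<notin> space \<mu> - ?A" using A by (intro AE_not_in null_setsI) auto
      then have "AE x in \<mu>. P (\<phi> x)" using AE_space by eventually_elim auto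
      then show ?thesis ..
    qed
  qed
  have "AE x in \<mu>. \<not> c < \<phi> x" using level[of "\<lambda>y. c < y"] not_gt by auto
  moreover have "AE x in \<mu>. \<not> \<phi> x < c" using level[of "\<lambda>y. y < c"] not_lt by auto
  ultimately show ?thesis unfolding c_def[symmetric] by eventually_elim auto
qed

lemma AE_T:
  assumes "AE x in \<mu>. P x" "j \<in> I"
  shows "AE x in \<mu>. P (T j x)"
proof -
  obtain N where N: "N \<in> null_sets \<mu>" "{x \<in> space \<mu>. \<not> P x} \<subseteq> N"
    using assms(1) unfolding eventually_ae_filter by auto
  have "(\<Sum>j\<in>I. ennreal (p j) * emeasure \<mu> (T j -` N \<inter> space \<mu>)) = 0"
    using stationary[of N] N(1) by (simp add: null_setsD1 null_setsD2)
  then have "ennreal (p j) * emeasure \<mu> (T j -` N \<inter> space \<mu>) = 0"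
    using assms(2) by (subst (asm) sum_nonneg_eq_0_iff) auto
  then have "emeasure \<mu> (T j -` N \<inter> space \<mu>) = 0" using p_pos[OF assms(2)] by auto
  then have "AE x in \<mu>. x \<notin> T j -` N \<inter> space \<mu>"
    using N(1) assms(2) by (intro AE_not_in null_setsI) auto
  then show ?thesis using AE_space
  proof eventually_elim
    case (elim x)
    then show ?case using N(2) measurable_space[OF T_measurable[OF assms(2)], of x] by auto
  qed
qed

primrec seq_cyl :: "nat set list \<Rightarrow> (nat \<Rightarrow> nat) set" where
  "seq_cyl [] = space Bern"
| "seq_cyl (E # Es) = {\<omega> \<in> space Bern. \<omega> 0 \<in> E \<and> (\<lambda>n. \<omega> (Suc n)) \<in> seq_cyl Es}"

lemma seq_cyl_iff: "\<omega> \<in> seq_cyl Es \<longleftrightarrow> \<omega> \<in> space Bern \<and> (\<forall>i<length Es. \<omega> i \<in> Es ! i)"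
  by (induction Es arbitrary: \<omega>) (auto simp: space_Bern All_less_Suc2)

lemma seq_cyl_sets [measurable]: "seq_cyl Es \<in> sets Bern"
proof (induction Es)
  case (Cons E Es)
  have "seq_cyl (E # Es) = ((\<lambda>\<omega>. \<omega> 0) -` (E \<inter> I) \<inter> space Bern) \<inter> ((\<lambda>\<omega> n. \<omega> (Suc n)) -` seq_cyl Es \<inter> space Bern)"
    by (auto simp: space_Bern)
  also have "\<dots> \<in> sets Bern"
    by (rule sets.Int[OF measurable_sets[OF coord_measurable] measurable_sets[OF shift_measurable Cons]]) simp
  finally show ?case .
qed simp

lemma seq_cyl_section:
  assumes B: "B \<in> sets (Bern \<Otimes>\<^sub>M \<mu>)" and inv: "skew_product T -` B \<inter> space (Bern \<Otimes>\<^sub>M \<mu>) = B"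
    and c: "AE x in \<mu>. emeasure Bern {\<omega> \<in> space Bern. (\<omega>, x) \<in> B} = c"
  shows "AE x in \<mu>. emeasure Bern {\<omega> \<in> space Bern. \<omega> \<in> seq_cyl Es \<and> (\<omega>, x) \<in> B} = c * emeasure Bern (seq_cyl Es)"
proof (induction Es)
  case Nil
  show ?case using c by eventually_elim (simp add: Bern.emeasure_space_1)
next
  case (Cons E Es)
  have "AE x in \<mu>. \<forall>j\<in>I. emeasure Bern {\<omega> \<in> space Bern. \<omega> \<in> seq_cyl Es \<and> (\<omega>, T j x) \<in> B} = c * emeasure Bern (seq_cyl Es)"
    using AE_T[OF Cons] by (intro AE_finite_allI) auto
  then show ?case using AE_space
  proof eventually_elim
    case (elim x)
    have "{\<omega> \<in> space Bern. \<omega> \<in> seq_cyl (E # Es) \<and> (\<omega>, x) \<in> B}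
        = {\<omega> \<in> space Bern. \<omega> 0 \<in> E \<and> (\<lambda>n. \<omega> (Suc n)) \<in> seq_cyl Es \<and> skew_product T (\<omega>, x) \<in> B}"
    proof -
      have "(\<omega>, x) \<in> B \<longleftrightarrow> skew_product T (\<omega>, x) \<in> B" if "\<omega> \<in> space Bern" for \<omega>
        using inv that elim(2) by (subst inv[symmetric]) (auto simp: space_pair_measure)
      then show ?thesis by auto
    qed
    then have "emeasure Bern {\<omega> \<in> space Bern. \<omega> \<in> seq_cyl (E # Es) \<and> (\<omega>, x) \<in> B}
        = (\<Sum>j\<in>I. ennreal (p j) * (indicator E j * emeasure Bern {\<omega> \<in> space Bern. \<omega> \<in> seq_cyl Es \<and> (\<omega>, T j x) \<in> B}))"
      using section_preimage[OF B seq_cyl_sets elim(2), of E Es] by simp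
    also have "\<dots> = c * (\<Sum>j\<in>I. ennreal (p j) * (indicator E j * emeasure Bern (seq_cyl Es)))"
      using elim(1) by (simp add: sum_distrib_left mult_ac)
    also have "(\<Sum>j\<in>I. ennreal (p j) * (indicator E j * emeasure Bern (seq_cyl Es))) = emeasure Bern (seq_cyl (E # Es))"
    proof -
      have U: "space Bern \<times> space \<mu> \<in> sets (Bern \<Otimes>\<^sub>M \<mu>)" by auto
      have "T j x \<in> space \<mu>" if "j \<in> I" for j
        using measurable_space[OF T_measurable[OF that] elim(2)] .
      moreover have "skew_product T (\<omega>, x) \<in> space Bern \<times> space \<mu>" if "\<omega> \<in> space Bern" for \<omega>
        using measurable_space[OF skew_measurable, of "(\<omega>, x)"] that elim(2) by (simp add: space_pair_measure)
      ultimately have L: "{\<omega> \<in> space Bern. \<omega> 0 \<in> E \<and> (\<lambda>n. \<omega> (Suc n)) \<in> seq_cyl Es \<and>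
            skew_product T (\<omega>, x) \<in> space Bern \<times> space \<mu>} = seq_cyl (E # Es)"
        and R: "\<And>j. j \<in> I \<Longrightarrow> {\<omega> \<in> space Bern. \<omega> \<in> seq_cyl Es \<and> (\<omega>, T j x) \<in> space Bern \<times> space \<mu>} = seq_cyl Es"
        by (auto simp: seq_cyl_iff)
      show ?thesis
        unfolding L[symmetric] section_preimage[OF U seq_cyl_sets elim(2)]
        by (intro sum.cong refl) (simp only: R)
    qed
    finally show ?case .
  qed
qed

theorem skew_product_ergodic: "ergodic_map (Bern \<Otimes>\<^sub>M \<mu>) (skew_product T)"
  unfolding ergodic_map_def
proof (intro conjI ballI impI skew_measure_preserving)
  fix B assume B: "B \<in> sets (Bern \<Otimes>\<^sub>M \<mu>)" and inv: "skew_product T -` B \<inter> space (Bern \<Otimes>\<^sub>M \<mu>) = B"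
  define S where "S x = {\<omega> \<in> space Bern. (\<omega>, x) \<in> B}" for x
  define \<phi> where "\<phi> x = measure Bern (S x)" for x
  have em: "emeasure Bern (S x) = ennreal (\<phi> x)" for x
    by (simp add: \<phi>_def Bern.emeasure_eq_measure)
  have \<phi>_m [measurable]: "\<phi> \<in> borel_measurable \<mu>"
  proof -
    have "\<phi> = (\<lambda>x. enn2real (emeasure Bern {\<omega> \<in> space Bern. (\<omega>, x) \<in> B}))"
      by (simp add: \<phi>_def measure_def S_def fun_eq_iff)
    then show ?thesis
      using measurable_compose[OF emeasure_section_measurable[OF B] borel_measurable_enn2real[OF measurable_ident]]
      by simp
  qed
  have "(\<Sum>j\<in>I. p j * \<phi> (T j x)) = \<phi> x" if x: "x \<in> space \<mu>" for x
  proof -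
    have "S x = {\<omega> \<in> space Bern. \<omega> 0 \<in> UNIV \<and> (\<lambda>n. \<omega> (Suc n)) \<in> space Bern \<and> skew_product T (\<omega>, x) \<in> B}"
      unfolding S_def using x by (subst inv[symmetric]) (auto simp: space_pair_measure space_Bern)
    then have "emeasure Bern (S x) = (\<Sum>j\<in>I. ennreal (p j) * emeasure Bern (S (T j x)))"
      using section_preimage[OF B sets.top x, of UNIV] by (simp add: S_def)
    also have "\<dots> = (\<Sum>j\<in>I. ennreal (p j * \<phi> (T j x)))"
      using p_pos by (intro sum.cong) (auto simp: em ennreal_mult' less_imp_le)
    also have "\<dots> = ennreal (\<Sum>j\<in>I. p j * \<phi> (T j x))"
      using p_pos by (intro sum_ennreal) (auto simp: \<phi>_def less_imp_le)
    finally show ?thesis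
      using p_pos by (subst (asm) em, subst (asm) ennreal_inj) (auto simp: \<phi>_def less_imp_le intro!: sum_nonneg)
  qed
  then have const: "AE x in \<mu>. \<phi> x = expectation \<phi>"
    by (intro harmonic_const[OF \<phi>_m]) (simp_all add: \<phi>_def)
  define c where "c = expectation \<phi>"
  have c0: "0 \<le> c" unfolding c_def \<phi>_def by (intro Bochner_Integration.integral_nonneg) auto
  have AE_c: "AE x in \<mu>. emeasure Bern (S x) = ennreal c"
    using const by (auto simp: em c_def elim!: eventually_mono)
  have "AE x in \<mu>. \<forall>Es\<in>lists (Pow I). emeasure Bern {\<omega> \<in> space Bern. \<omega> \<in> seq_cyl Es \<and> (\<omega>, x) \<in> B} = ennreal c * emeasure Bern (seq_cyl Es)"
  proof (rule AE_ball_countable')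
    show "countable (lists (Pow I))" by (intro countable_lists countable_finite) simp
  qed (rule seq_cyl_section[OF B inv AE_c[unfolded S_def]])
  then have "AE x in \<mu>. c = 0 \<or> c = 1"
    using AE_c AE_space
  proof eventually_elim
    case (elim x)
    have Sx: "S x \<in> sets Bern" unfolding S_def by (rule section_measurable[OF B elim(3)])
    have "density Bern (indicator (S x)) = scale_measure (ennreal c) Bern"
    proof (rule measure_eqI_PiM_infinite[where I=UNIV and M="\<lambda>_. PM"])
      show "finite_measure (density Bern (indicator (S x)))"
        using Sx by (intro finite_measureI) (simp add: emeasure_density Bern.emeasure_eq_measure)
      fix A :: "nat \<Rightarrow> nat set" and J :: "nat set"
      assume J: "finite J" "J \<subseteq> UNIV" and A: "\<And>i. i \<in> J \<Longrightarrow> A i \<in> sets PM"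
      define Es where "Es = map (\<lambda>i. if i \<in> J then A i else I) [0..<Suc (Max (insert 0 J))]"
      have A': "A i \<subseteq> I" if "i \<in> J" for i using A[OF that] by (auto simp: sets_point_measure)
      have Es: "Es \<in> lists (Pow I)" by (auto simp: Es_def dest: subsetD[OF A'])
      have eq: "prod_emb UNIV (\<lambda>_. PM) J (Pi\<^sub>E J A) = seq_cyl Es"
      proof -
        have "i < Suc (Max (insert 0 J))" if "i \<in> J" for i
          using J that by (simp add: less_Suc_eq_le)
        then have "(\<forall>i\<in>J. \<omega> i \<in> A i) \<longleftrightarrow> (\<forall>i<length Es. \<omega> i \<in> Es ! i)" if "\<omega> \<in> space Bern" for \<omega>
          using that by (auto simp: Es_def space_Bern simp del: upt_Suc)
        then show ?thesis
          by (auto simp: prod_emb_def seq_cyl_iff space_Bern space_point_measure PiE_UNIV_domain PiE_iff Pi_iff)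
      qed
      have "{\<omega> \<in> space Bern. \<omega> \<in> seq_cyl Es \<and> (\<omega>, x) \<in> B} = S x \<inter> seq_cyl Es"
        by (auto simp: S_def)
      then have "emeasure Bern (S x \<inter> seq_cyl Es) = ennreal c * emeasure Bern (seq_cyl Es)"
        using bspec[OF elim(1) Es] by simp
      then show "emeasure (density Bern (indicator (S x))) (prod_emb UNIV (\<lambda>_. PM) J (Pi\<^sub>E J A))
        = emeasure (scale_measure (ennreal c) Bern) (prod_emb UNIV (\<lambda>_. PM) J (Pi\<^sub>E J A))"
        unfolding eq by (simp add: emeasure_restricted[OF Sx])
    qed (simp_all add: Bern_eq)
    then have "emeasure (density Bern (indicator (S x))) (S x) = emeasure (scale_measure (ennreal c) Bern) (S x)"
      by simp
    then have "emeasure Bern (S x) = ennreal c * emeasure Bern (S x)"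
      using Sx by (simp add: emeasure_restricted)
    then have "ennreal c = ennreal (c * c)" using elim(2) c0 by (simp add: ennreal_mult)
    then have "c = c * c" using c0 by (subst (asm) ennreal_inj) auto
    then show ?case by auto
  qed
  then have c01: "c = 0 \<or> c = 1" by simp
  have "emeasure (Bern \<Otimes>\<^sub>M \<mu>) B = (\<integral>\<^sup>+x. emeasure Bern (S x) \<partial>\<mu>)"
    unfolding S_def by (rule emeasure_product_sections[OF B])
  also have "\<dots> = (\<integral>\<^sup>+x. ennreal c \<partial>\<mu>)"
    using AE_c by (rule nn_integral_cong_AE)
  also have "\<dots> = ennreal c" by (simp add: emeasure_space_1)
  finally have mB: "emeasure (Bern \<Otimes>\<^sub>M \<mu>) B = ennreal c" .
  show "emeasure (Bern \<Otimes>\<^sub>M \<mu>) B = 0 \<or> emeasure (Bern \<Otimes>\<^sub>M \<mu>) (space (Bern \<Otimes>\<^sub>M \<mu>) - B) = 0"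
    using c01
  proof
    assume "c = 1"
    then have "emeasure (Bern \<Otimes>\<^sub>M \<mu>) (space (Bern \<Otimes>\<^sub>M \<mu>) - B) = 0"
      using mB B by (subst emeasure_compl) (auto simp: prod.emeasure_space_1)
    then show ?thesis ..
  qed (use mB in simp)
qed

end

section \<open>Absolutely continuous stationary measures\<close>

lemma sets_lborel01 [simp]: "sets lborel01 = sets (restrict_space borel {0..1})"
  by (simp add: lborel01_def sets_restrict_space)

lemma space_lborel01 [simp]: "space lborel01 = {0..1}"
  by (simp add: lborel01_def space_restrict_space)

lemma sets_restrict_unit: "A \<in> sets (restrict_space borel {0..1}) \<longleftrightarrow> A \<subseteq> {0..1::real} \<and> A \<in> sets borel"
  by (rule sets_restrict_space_iff) simp

lemma AE_lborel01: "(AE x in lborel01. P x) \<longleftrightarrow> (AE x in lborel. x \<in> {0<..1} \<longrightarrow> P x)"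
proof -
  have "(AE x in lborel01. P x) \<longleftrightarrow> (AE x in lborel. x \<in> {0..1} \<longrightarrow> P x)"
    unfolding lborel01_def by (rule AE_restrict_space_iff) simp
  also have "\<dots> \<longleftrightarrow> (AE x in lborel. x \<in> {0<..1} \<longrightarrow> P x)"
  proof
    assume "AE x in lborel. x \<in> {0<..1} \<longrightarrow> P x"
    with AE_lborel_singleton[of "0::real"] show "AE x in lborel. x \<in> {0..1} \<longrightarrow> P x"
      by eventually_elim auto
  qed (auto elim!: eventually_mono)
  finally show ?thesis .
qed

context contracting_random_maps
begin

lemma rmap_unit: "j \<in> I \<Longrightarrow> x \<in> {0..1} \<Longrightarrow> rmap j x \<in> {0..1}"
  using rmap_mem[of j x] by (cases "x = 0") (auto simp: rmap_def)

lemma rmap_invariant_trivial: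
  assumes A [measurable]: "A \<in> sets borel"
    and inv: "\<And>j. j \<in> I \<Longrightarrow> AE x in lborel. x \<in> {0<..1} \<longrightarrow> (rmap j x \<in> A \<longleftrightarrow> x \<in> A)"
  shows "emeasure lborel (A \<inter> {0<..1}) = 0 \<or> emeasure lborel ({0<..1} - A) = 0"
proof -
  obtain j where j: "j \<in> I" "j \<notin> RR" using RR(2) by auto
  show ?thesis
  proof (rule S_map_ergodic[OF \<alpha>_pos[OF j(1)] A])
    show "AE x in lborel. x \<in> {0<..1/2} \<longrightarrow> (left_br (\<alpha> j) x \<in> A \<longleftrightarrow> x \<in> A)"
      using inv[OF j(1)] by eventually_elim (auto simp: rmap_def)
    show "AE x in lborel. x \<in> {1/2<..1} \<longrightarrow> (dbl_br x \<in> A \<longleftrightarrow> x \<in> A)"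
      using inv[OF j(1)] by eventually_elim (use j(2) in \<open>auto simp: rmap_def right_br_def\<close>)
  qed
qed

theorem acs_measure_exists_unique:
  assumes "\<forall>j\<in>I. \<forall>x\<in>{0..1}. T j x = rmap j x"
  shows "\<exists>\<mu> h c. acs_prob_measure I p T \<mu> \<and> (\<forall>\<nu>. acs_prob_measure I p T \<nu> \<longrightarrow> \<nu> = \<mu>) \<and>
    ergodic_map (bernoulli_measure I p \<Otimes>\<^sub>M \<mu>) (skew_product T) \<and> density_version \<mu> h \<and>
    0 < c \<and> (\<forall>x\<in>{0..1}. c \<le> h x) \<and> decr_cone n 0 (1/2) h \<and> decr_cone n (1/2) 1 h \<and>
    (\<forall>\<beta>. \<alpha> j\<^sub>0 < \<beta> \<and> \<beta> \<le> 1 \<and> (\<Sum>r\<in>RR. p r * K r powr (- \<beta>)) < 1 \<longrightarrow>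
      (\<exists>A\<^sub>1>0. \<exists>A\<^sub>2>0. power_bound \<beta> A\<^sub>1 A\<^sub>2 h))"
proof -
  have T: "T j x = rmap j x" if "j \<in> I" "x \<in> {0..1}" for j x
    using assms that by blast
  obtain f c where f: "cone_density f" "(\<integral>\<^sup>+x. ennreal (f x) \<partial>lborel) = 1" "\<forall>x. transfer_op f x = f x"
    and c: "0 < c" "\<forall>x\<in>{0<..1}. c \<le> f x"
    and power_bound: "\<forall>\<beta>. \<alpha> j\<^sub>0 < \<beta> \<and> \<beta> \<le> 1 \<and> (\<Sum>r\<in>RR. p r * K r powr (- \<beta>)) < 1 \<longrightarrow>
      (\<exists>A\<^sub>1>0. \<exists>A\<^sub>2>0. power_bound \<beta> A\<^sub>1 A\<^sub>2 f)"
    using invariant_density_exists by (elim exE conjE)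
  have fm [measurable]: "f \<in> borel_measurable borel" by (rule dens_measurable[OF f(1)])
  define h where "h x = (if x = 0 then c else f x)" for x
  have h_pos: "0 < h x" if "x \<in> {0..1}" for x
    using c(1) bspec[OF c(2), of x] that by (cases "x = 0") (auto simp: h_def)
  have hm: "h \<in> borel_measurable lborel01"
    unfolding h_def[abs_def] lborel01_def by (intro measurable_restrict_space1) simp
  define \<mu> where "\<mu> = density lborel01 (\<lambda>x. ennreal (h x))"
  have [simp]: "sets \<mu> = sets (restrict_space borel {0..1})" "space \<mu> = {0..1}"
    by (simp_all add: \<mu>_def)
  have em: "emeasure \<mu> A = (\<integral>\<^sup>+x. indicator A x * ennreal (f x) \<partial>lborel)"
    if A: "A \<subseteq> {0..1}" "A \<in> sets borel" for A
  proof -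
    have "emeasure \<mu> A = (\<integral>\<^sup>+x. ennreal (h x) * indicator A x \<partial>lborel01)"
      unfolding \<mu>_def using hm A by (intro emeasure_density) (auto simp: sets_restrict_unit)
    also have "\<dots> = (\<integral>\<^sup>+x. ennreal (h x) * indicator A x * indicator {0..1} x \<partial>lborel)"
      unfolding lborel01_def by (rule nn_integral_restrict_space) simp
    also have "\<dots> = (\<integral>\<^sup>+x. indicator A x * ennreal (f x) \<partial>lborel)"
    proof (rule nn_integral_cong_AE)
      show "AE x in lborel. ennreal (h x) * indicator A x * indicator {0..1} x = indicator A x * ennreal (f x)"
        using AE_lborel_singleton[of "0::real"]
        by eventually_elim (use A(1) in \<open>auto simp: h_def indicator_def\<close>)
    qed
    finally show ?thesis .
  qed
  have preim: "T j -` A \<inter> {0..1} \<in> sets borel"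
      "emeasure \<mu> (T j -` A \<inter> {0..1}) = (\<integral>\<^sup>+y. indicator A (rmap j y) * ennreal (f y) \<partial>lborel)"
    if j: "j \<in> I" and A [measurable]: "A \<in> sets borel" for j A
  proof -
    have "T j -` A \<inter> {0..1} = rmap j -` A \<inter> {0..1}" using T[OF j] by auto
    also have "\<dots> \<in> sets borel"
      using measurable_sets[OF rmap_measurable A, of j] by simp
    finally show m: "T j -` A \<inter> {0..1} \<in> sets borel" .
    have "emeasure \<mu> (T j -` A \<inter> {0..1}) = (\<integral>\<^sup>+y. indicator (T j -` A \<inter> {0..1}) y * ennreal (f y) \<partial>lborel)"
      using m by (intro em) auto
    also have "\<dots> = (\<integral>\<^sup>+y. indicator A (rmap j y) * ennreal (f y) \<partial>lborel)"
    proof (rule nn_integral_cong)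
      fix y
      show "indicator (T j -` A \<inter> {0..1}) y * ennreal (f y) = indicator A (rmap j y) * ennreal (f y)"
        using T[OF j, of y] densD(3)[OF f(1), of y] by (cases "y \<in> {0<..1}") (auto simp: indicator_def)
    qed
    finally show "emeasure \<mu> (T j -` A \<inter> {0..1}) = (\<integral>\<^sup>+y. indicator A (rmap j y) * ennreal (f y) \<partial>lborel)" .
  qed
  have AE_\<mu>: "(AE x in \<mu>. P x) \<longleftrightarrow> (AE x in lborel. x \<in> {0<..1} \<longrightarrow> P x)" for P
  proof -
    have "(AE x in \<mu>. P x) \<longleftrightarrow> (AE x in lborel01. 0 < ennreal (h x) \<longrightarrow> P x)"
      unfolding \<mu>_def using hm by (intro AE_density) simp
    also have "\<dots> \<longleftrightarrow> (AE x in lborel. x \<in> {0<..1} \<longrightarrow> P x)"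
      unfolding AE_lborel01 using h_pos by (intro AE_cong) auto
    finally show ?thesis .
  qed
  have null: "emeasure \<mu> A = 0" if A: "A \<subseteq> {0..1}" "A \<in> sets borel" "emeasure lborel (A \<inter> {0<..1}) = 0" for A
  proof -
    have "A \<inter> {0<..1} \<in> null_sets lborel" using A by auto
    then have "AE x in lborel. x \<notin> A \<inter> {0<..1}" by (rule AE_not_in)
    then have "AE x in lborel. indicator A x * ennreal (f x) = 0"
      by eventually_elim (use densD(3)[OF f(1)] in \<open>auto simp: indicator_def\<close>)
    then have "(\<integral>\<^sup>+x. indicator A x * ennreal (f x) \<partial>lborel) = (\<integral>\<^sup>+x. 0 \<partial>(lborel :: real measure))"
      by (rule nn_integral_cong_AE)
    then show ?thesis using em[OF A(1,2)] by simp
  qed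
  have stat: "(\<Sum>j\<in>I. ennreal (p j) * emeasure \<mu> (T j -` A \<inter> {0..1})) = emeasure \<mu> A"
    if A: "A \<in> sets (restrict_space borel {0..1})" for A
  proof -
    have A': "A \<subseteq> {0..1}" and [measurable]: "A \<in> sets borel" using A by (auto simp: sets_restrict_unit)
    have "(\<Sum>j\<in>I. ennreal (p j) * emeasure \<mu> (T j -` A \<inter> {0..1}))
        = (\<Sum>j\<in>I. ennreal (p j) * (\<integral>\<^sup>+y. indicator A (rmap j y) * ennreal (f y) \<partial>lborel))"
      by (intro sum.cong refl) (simp add: preim)
    also have "\<dots> = (\<integral>\<^sup>+x. indicator A x * ennreal (transfer_op f x) \<partial>lborel)"
      by (rule tr_integral[symmetric, OF f(1)]) simp
    also have "\<dots> = emeasure \<mu> A" using A' by (simp add: f(3) em)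
    finally show ?thesis .
  qed
  have prob: "prob_space \<mu>"
  proof (rule prob_spaceI)
    have "emeasure \<mu> {0..1} = (\<integral>\<^sup>+x. ennreal (f x) \<partial>lborel)"
      using densD(3)[OF f(1)] by (subst em) (auto intro!: nn_integral_cong simp: indicator_def)
    then show "emeasure \<mu> (space \<mu>) = 1" using f(2) by simp
  qed
  have T_meas: "T j \<in> measurable M M" if "j \<in> I" "sets M = sets (restrict_space borel {0..1})" for j M
  proof -
    have "rmap j \<in> measurable (restrict_space borel {0..1}) (restrict_space borel {0..1})"
      using rmap_unit[OF that(1)]
      by (intro measurable_restrict_space2 measurable_restrict_space1) (auto simp: space_restrict_space)
    then have "T j \<in> measurable (restrict_space borel {0..1}) (restrict_space borel {0..1})"
      using T[OF that(1)] by (subst measurable_cong[of _ _ "rmap j"]) (auto simp: space_restrict_space)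
    then show ?thesis using measurable_cong_sets[OF that(2) that(2)] by simp
  qed
  interpret prob_space \<mu> by (rule prob)
  interpret sys: stationary_system \<mu> I p T
  proof
    fix A assume A: "A \<in> sets \<mu>" and inv: "\<And>j. j \<in> I \<Longrightarrow> AE x in \<mu>. T j x \<in> A \<longleftrightarrow> x \<in> A"
    have A': "A \<subseteq> {0..1}" and Am [measurable]: "A \<in> sets borel" using A by (auto simp: sets_restrict_unit)
    have "AE x in lborel. x \<in> {0<..1} \<longrightarrow> (rmap j x \<in> A \<longleftrightarrow> x \<in> A)" if "j \<in> I" for j
      using inv[OF that] unfolding AE_\<mu> by eventually_elim (use T[OF that] in auto)
    then have "emeasure lborel (A \<inter> {0<..1}) = 0 \<or> emeasure lborel ({0<..1} - A) = 0"
      by (rule rmap_invariant_trivial[OF Am])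
    moreover have "({0..1} - A) \<inter> {0<..1} = {0<..1} - A" by auto
    ultimately show "emeasure \<mu> A = 0 \<or> emeasure \<mu> (space \<mu> - A) = 0"
      using null[OF A' Am] null[of "{0..1} - A"] by auto
  qed (use p_pos p_sum T_meas stat in auto)
  have acs: "acs_prob_measure I p T \<mu>"
    unfolding acs_prob_measure_def acs_measure_def absolutely_continuous_def
  proof (intro conjI ballI stat prob)
    show "null_sets lborel01 \<subseteq> null_sets \<mu>"
      unfolding \<mu>_def using hm by (intro absolutely_continuousI_density[unfolded absolutely_continuous_def]) simp
  qed simp_all
  have uniq: "\<nu> = \<mu>" if "acs_prob_measure I p T \<nu>" for \<nu>
  proof (rule sys.stationary_unique)
    show "prob_space \<nu>" "sets \<nu> = sets \<mu>"
      using that by (auto simp: acs_prob_measure_def acs_measure_def)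
    show "(\<Sum>j\<in>I. ennreal (p j) * emeasure \<nu> (T j -` A \<inter> space \<mu>)) = emeasure \<nu> A" if "A \<in> sets \<mu>" for A
      using \<open>acs_prob_measure I p T \<nu>\<close> that by (auto simp: acs_prob_measure_def acs_measure_def)
    have "null_sets \<mu> \<subseteq> null_sets lborel01"
    proof
      fix N assume N: "N \<in> null_sets \<mu>"
      then have "AE x in \<mu>. x \<notin> N" by (rule AE_not_in)
      then have "AE x in lborel01. x \<notin> N" by (simp only: AE_\<mu> AE_lborel01)
      moreover have "N \<in> sets lborel01" using N by auto
      ultimately show "N \<in> null_sets lborel01" by (simp only: AE_iff_null_sets)
    qed
    then show "absolutely_continuous \<mu> \<nu>"
      using that by (auto simp: acs_prob_measure_def acs_measure_def absolutely_continuous_def)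
  qed
  show ?thesis
  proof (rule exI[of _ \<mu>], rule exI[of _ h], rule exI[of _ c], intro conjI allI ballI impI; (elim conjE)?)
    show "density_version \<mu> h"
      unfolding density_version_def using hm h_pos by (auto simp: \<mu>_def less_imp_le)
    show "decr_cone n 0 (1/2) h" "decr_cone n (1/2) 1 h"
      by (rule decr_cone_cong[OF densD(1)[OF f(1)]] decr_cone_cong[OF densD(2)[OF f(1)]]; simp add: h_def)+
    show "c \<le> h x" if "x \<in> {0..1}" for x
      using c(2) that by (cases "x = 0") (auto simp: h_def)
    show "\<exists>A\<^sub>1>0. \<exists>A\<^sub>2>0. power_bound \<beta> A\<^sub>1 A\<^sub>2 h"
      if "\<alpha> j\<^sub>0 < \<beta>" "\<beta> \<le> 1" "(\<Sum>r\<in>RR. p r * K r powr (- \<beta>)) < 1" for \<beta>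
      using power_bound that by (auto simp: power_bound_def h_def)
  qed (fact acs uniq sys.skew_product_ergodic c(1))+
qed

end

lemma S_map_right: "x \<in> {1/2<..1} \<Longrightarrow> S_map \<alpha> x = dbl_br x"
  by (simp add: S_map_def dbl_br_def)

lemma S_family_not_R_family:
  assumes "f \<in> S_family"
  shows "f \<notin> R_family"
proof
  assume "f \<in> R_family"
  then obtain \<alpha> K where K: "0 < K" "K < 1" and f: "f = R_map \<alpha> K" by (auto simp: R_family_def)
  from assms obtain \<alpha>' where f': "f = S_map \<alpha>'" by (auto simp: S_family_def)
  have "f (3/4) = 1/2" by (simp add: f' S_map_def)
  moreover have "f (3/4) = 1/2 + K / 4 + (1 - K) / 8" by (simp add: f R_map_def power2_eq_square)
  ultimately have "1/2 + K / 4 + (1 - K) / 8 = 1/2" by simp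
  with K show False by (simp add: field_simps)
qed

theorem theorem1p2:
  fixes N :: nat
    and T :: "nat \<Rightarrow> real \<Rightarrow> real"
    and p \<alpha> K :: "nat \<Rightarrow> real"
    and \<Sigma> \<Sigma>\<^sub>S \<Sigma>\<^sub>R :: "nat set"
    and \<alpha>\<^sub>m\<^sub>i\<^sub>n \<eta> \<gamma> :: real
  assumes Sigma: "\<Sigma> = {1..N}"
    and maps: "\<And>j. j \<in> \<Sigma> \<Longrightarrow> T j \<in> S_family \<union> R_family"
    and Sigma_S: "\<Sigma>\<^sub>S = {j \<in> \<Sigma>. T j \<in> S_family}" "\<Sigma>\<^sub>S \<noteq> {}"
    and Sigma_R: "\<Sigma>\<^sub>R = {j \<in> \<Sigma>. T j \<in> R_family}" "\<Sigma>\<^sub>R \<noteq> {}"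
    and alpha: "\<And>j. j \<in> \<Sigma> \<Longrightarrow> \<alpha> j > 0"
      "\<And>j x. j \<in> \<Sigma> \<Longrightarrow> x \<in> {0..1/2} \<Longrightarrow> T j x = x * (1 + 2 powr \<alpha> j * x powr \<alpha> j)"
    and K: "\<And>j. j \<in> \<Sigma>\<^sub>R \<Longrightarrow> 0 < K j \<and> K j < 1"
      "\<And>j x. j \<in> \<Sigma>\<^sub>R \<Longrightarrow> x \<in> {1/2<..1} \<Longrightarrow>
         T j x = 1/2 + K j * (x - 1/2) + 2 * (1 - K j) * (x - 1/2)\<^sup>2"
    and alpha_min: "\<alpha>\<^sub>m\<^sub>i\<^sub>n = Min (\<alpha> ` \<Sigma>)" "\<alpha>\<^sub>m\<^sub>i\<^sub>n < 1"
    and p: "\<And>j. j \<in> \<Sigma> \<Longrightarrow> p j > 0" "(\<Sum>j\<in>\<Sigma>. p j) = 1"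
    and gamma: "\<gamma> = Sup {\<delta>. \<delta> \<ge> 0 \<and> (\<Sum>r\<in>\<Sigma>\<^sub>R. p r * K r powr (- \<delta>)) < 1}"
    and eta: "\<eta> = (\<Sum>r\<in>\<Sigma>\<^sub>R. p r * K r powr (- \<alpha>\<^sub>m\<^sub>i\<^sub>n))" "\<eta> < 1"
  shows "(\<exists>!\<mu>. acs_prob_measure \<Sigma> p T \<mu>) \<and>
    (\<forall>\<mu>. acs_prob_measure \<Sigma> p T \<mu> \<longrightarrow>
       ergodic_map (bernoulli_measure \<Sigma> p \<Otimes>\<^sub>M \<mu>) (skew_product T) \<and>
       (\<exists>h. density_version \<mu> h \<and>
          (\<exists>c>0. \<forall>x\<in>{0..1}. c \<le> h x) \<and>
          antimono_on {0<..1/2} h \<and> antimono_on {1/2<..1} h \<and>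
          locally_lipschitz_on {0<..1/2} h \<and> locally_lipschitz_on {1/2<..1} h \<and>
          (\<forall>\<beta>\<in>{\<alpha>\<^sub>m\<^sub>i\<^sub>n<..<\<gamma>} \<inter> {0<..1}. \<exists>a\<^sub>1>0. \<exists>a\<^sub>2>0.
             (\<forall>x\<in>{0<..1/2}. h x \<le> a\<^sub>1 * x powr (- \<alpha>\<^sub>m\<^sub>i\<^sub>n - 1 + \<beta>)) \<and>
             (\<forall>x\<in>{1/2<..1}. h x \<le> a\<^sub>2 * (x - 1/2) powr (- 1 + \<beta>)))))"
proof -
  have fin: "finite \<Sigma>" by (simp add: Sigma)
  obtain s where s: "s \<in> \<Sigma>" "T s \<in> S_family" using Sigma_S by auto
  have "\<alpha>\<^sub>m\<^sub>i\<^sub>n \<in> \<alpha> ` \<Sigma>" unfolding alpha_min(1) using fin s by (intro Min_in) auto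
  then obtain j\<^sub>0 where j\<^sub>0: "j\<^sub>0 \<in> \<Sigma>" "\<alpha> j\<^sub>0 = \<alpha>\<^sub>m\<^sub>i\<^sub>n" by auto
  define n where "n = nat \<lceil>2 + Max (\<alpha> ` \<Sigma>)\<rceil>"
  have n: "2 + \<alpha> j \<le> real n" if "j \<in> \<Sigma>" for j
  proof -
    have "\<alpha> j \<le> Max (\<alpha> ` \<Sigma>)" using fin that by simp
    then show ?thesis unfolding n_def by linarith
  qed
  have n2: "2 \<le> n" using n[OF s(1)] alpha(1)[OF s(1)] by simp
  interpret rm: contracting_random_maps \<Sigma> \<Sigma>\<^sub>R p \<alpha> K n j\<^sub>0
  proof
    show "\<Sigma> - \<Sigma>\<^sub>R \<noteq> {}" using s S_family_not_R_family Sigma_R(1) by auto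
    show "1 + \<alpha> j \<le> real n" if "j \<in> \<Sigma>" for j using n[OF that] by simp
  qed (use fin Sigma_R alpha K p j\<^sub>0 alpha_min eta n2 in auto)
  have T: "T j x = rm.rmap j x" if j: "j \<in> \<Sigma>" and x: "x \<in> {0..1}" for j x
  proof (cases "x \<le> 1/2")
    case True
    then show ?thesis using alpha(2)[OF j, of x] x by (simp add: rm.rmap_def left_br_def)
  next
    case False
    then have x': "x \<in> {1/2<..1}" using x by auto
    show ?thesis
    proof (cases "j \<in> \<Sigma>\<^sub>R")
      case True
      then show ?thesis using K(2)[OF True x'] False by (simp add: rm.rmap_def rm.right_br_def slow_br_def)
    next
      case not_R: False
      then have "T j \<in> S_family" using maps[OF j] j by (auto simp: Sigma_R(1))
      then show ?thesis using S_map_right[OF x'] False not_R by (auto simp: rm.rmap_def rm.right_br_def S_family_def)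
    qed
  qed
  obtain \<mu> h c where acs: "acs_prob_measure \<Sigma> p T \<mu>" and uniq: "\<forall>\<nu>. acs_prob_measure \<Sigma> p T \<nu> \<longrightarrow> \<nu> = \<mu>"
    and erg: "ergodic_map (bernoulli_measure \<Sigma> p \<Otimes>\<^sub>M \<mu>) (skew_product T)" and h: "density_version \<mu> h"
    and c: "0 < c" "\<forall>x\<in>{0..1}. c \<le> h x"
    and cone: "decr_cone n 0 (1/2) h" "decr_cone n (1/2) 1 h"
    and power_bound: "\<forall>\<beta>. \<alpha> j\<^sub>0 < \<beta> \<and> \<beta> \<le> 1 \<and> (\<Sum>r\<in>\<Sigma>\<^sub>R. p r * K r powr (- \<beta>)) < 1 \<longrightarrow>
      (\<exists>A\<^sub>1>0. \<exists>A\<^sub>2>0. rm.power_bound \<beta> A\<^sub>1 A\<^sub>2 h)"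
    using rm.acs_measure_exists_unique[of T] T by blast
  have "\<exists>a\<^sub>1>0. \<exists>a\<^sub>2>0. (\<forall>x\<in>{0<..1/2}. h x \<le> a\<^sub>1 * x powr (- \<alpha>\<^sub>m\<^sub>i\<^sub>n - 1 + \<beta>)) \<and>
      (\<forall>x\<in>{1/2<..1}. h x \<le> a\<^sub>2 * (x - 1/2) powr (- 1 + \<beta>))"
    if \<beta>: "\<beta> \<in> {\<alpha>\<^sub>m\<^sub>i\<^sub>n<..<\<gamma>} \<inter> {0<..1}" for \<beta>
  proof -
    let ?D = "{\<delta>. \<delta> \<ge> 0 \<and> (\<Sum>r\<in>\<Sigma>\<^sub>R. p r * K r powr (- \<delta>)) < 1}"
    have "\<alpha>\<^sub>m\<^sub>i\<^sub>n \<in> ?D" using eta alpha(1)[OF j\<^sub>0(1)] j\<^sub>0(2) by simp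
    then obtain \<delta> where \<delta>: "\<beta> < \<delta>" "(\<Sum>r\<in>\<Sigma>\<^sub>R. p r * K r powr (- \<delta>)) < 1"
      using less_cSupD[of ?D \<beta>] \<beta> unfolding gamma by auto
    have "(\<Sum>r\<in>\<Sigma>\<^sub>R. p r * K r powr (- \<beta>)) \<le> (\<Sum>r\<in>\<Sigma>\<^sub>R. p r * K r powr (- \<delta>))"
      using \<delta>(1) K(1) p(1) Sigma_R(1)
      by (intro sum_mono mult_left_mono powr_mono') (auto intro: less_imp_le)
    with \<delta>(2) obtain A\<^sub>1 A\<^sub>2 where A: "0 < A\<^sub>1" "0 < A\<^sub>2" "rm.power_bound \<beta> A\<^sub>1 A\<^sub>2 h"
      using power_bound \<beta> j\<^sub>0(2) by auto
    have e: "\<beta> - \<alpha> j\<^sub>0 - 1 = - \<alpha>\<^sub>m\<^sub>i\<^sub>n - 1 + \<beta>" "\<beta> - 1 = - 1 + \<beta>" by (simp_all add: j\<^sub>0(2))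
    show ?thesis using A unfolding rm.power_bound_def e by blast
  qed
  then have "\<exists>h. density_version \<mu> h \<and> (\<exists>c>0. \<forall>x\<in>{0..1}. c \<le> h x) \<and>
      antimono_on {0<..1/2} h \<and> antimono_on {1/2<..1} h \<and>
      locally_lipschitz_on {0<..1/2} h \<and> locally_lipschitz_on {1/2<..1} h \<and>
      (\<forall>\<beta>\<in>{\<alpha>\<^sub>m\<^sub>i\<^sub>n<..<\<gamma>} \<inter> {0<..1}. \<exists>a\<^sub>1>0. \<exists>a\<^sub>2>0.
         (\<forall>x\<in>{0<..1/2}. h x \<le> a\<^sub>1 * x powr (- \<alpha>\<^sub>m\<^sub>i\<^sub>n - 1 + \<beta>)) \<and>
         (\<forall>x\<in>{1/2<..1}. h x \<le> a\<^sub>2 * (x - 1/2) powr (- 1 + \<beta>)))"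
    using h c cone decr_cone_lipschitz[OF cone(1)] decr_cone_lipschitz[OF cone(2)]
    unfolding decr_cone_def by blast
  with acs uniq erg show ?thesis by metis
qed

end
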